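(* Let $\Omega\subset\mathbb R^3$ be an arbitrary (possibly unbounded) open set. Coefficients: let $a_0,a_1\in]0,\infty[$ and $a_{ij}=a_{ji}\in L^\infty(\Omega)$ ($i,j=1,2,3$) satisfy $a_0|\xi|^2\le\sum_{i,j=1}^3a_{ij}(x)\xi_i\xi_j\le a_1|\xi|^2$ for all $\xi\in\mathbb R^3$ and a.e. $x\in\Omega$; put $A(x)=(a_{ij}(x))_{i,j}$. Let $\beta\colon\Omega\to\mathbb R$ be measurable such that (a) for every $\nu>0$ there is $C_\nu>0$ with $\int_\Omega|\beta||u|^2\,dx\le\nu\int_\Omega|\nabla u|^2\,dx+C_\nu\int_\Omega|u|^2\,dx$ for all $u\in H^1_0(\Omega)$; (b) there is $\lambda_1>0$ with $\int_\Omega A\nabla u\cdot\nabla u\,dx+\int_\Omega\beta|u|^2\,dx\ge\lambda_1\int_\Omega|u|^2\,dx$ for all $u\in H^1_0(\Omega)$. Nonlinearity: let $f\colon\Omega\times\mathbb R\to\mathbb R$ be such that $f(\cdot,u)$ is measurable for every $u\in\mathbb R$, $f(\cdot,0)\in L^2(\Omega)$, for a.e. $x\in\Omega$ the function $f(x,\cdot)$ is of class $C^1$, $\partial_uf(\cdot,0)\in L^\infty(\Omega)$, and there are constants $C>0$, $0<\gamma\le1$, $1\le\alpha<2$ with $\alpha+\gamma=2$ such that $|\partial_uf(x,u_1)-\partial_uf(x,u_2)|\le C(1+|u_1|^\alpha+|u_2|^\alpha)|u_1-u_2|^\gamma$ for a.e. $x\in\Omega$ and all $u_1,u_2\in\mathbb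 R$. Fix $\epsilon\in]0,1]$. Let $\mathcal I$ be a compact invariant subset of the local semiflow generated in $Z_0=H^1_0(\Omega)\times L^2(\Omega)$ by the damped wave equation $\epsilon u_{tt}+u_t+\beta(x)u-\sum_{ij}(a_{ij}(x)u_{x_j})_{x_i}=f(x,u)$ in $\Omega$, $u=0$ on $\partial\Omega$ (see context). Then $\mathcal I$ is a bounded subset of $Z_1=D(\mathbf A)\times H^1_0(\Omega)$.
   Context: Spaces and operators. $H^1_0(\Omega)$ carries the scalar product $\langle u,v\rangle_{H^1_0}=\int_\Omega A\nabla u\cdot\nabla v\,dx+\int_\Omega\beta uv\,dx$ (equivalent to the usual one). $\mathbf A$ is the positive selfadjoint operator on $L^2(\Omega)$ defined by this form (i.e. by $u\mapsto\beta u-\sum_{ij}(a_{ij}u_{x_j})_{x_i}$); $D(\mathbf A)$ carries the norm $\|\mathbf Au\|_{L^2}$. $Z_0=H^1_0(\Omega)\times L^2(\Omega)$, $Z_1=D(\mathbf A)\times H^1_0(\Omega)$, and $\mathbf B_{\epsilon,0}\colon Z_1\to Z_0$, $\mathbf B_{\epsilon,0}(u,v)=(v,-(1/\epsilon)(v+\mathbf Au))$, generates a $C^0$-semigroup $\mathbf T_{\epsilon,0}(t)$, $t\ge0$, on $Z_0$. $\hat f(u)(x):=f(x,u(x))$; under the assumptions $\hat f$ maps $H^1_0(\Omega)$ into $L^2(\Omega)$ and is $C^1$. The local semiflow on $Z_0$ is given by the unique maximal continuous solutions of the mild formulation $(u(t),v(t))=\mathbf T_{\epsilon,0}(t)(u_0,v_0)+\int_0^t\mathbf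 T_{\epsilon,0}(t-p)(0,(1/\epsilon)\hat f(u(p)))\,dp$ (integral in $Z_0$). A full solution is a function $(u,v)\colon\mathbb R\to Z_0$ such that for all $s\le t$ in $\mathbb R$, $(u(t),v(t))=\mathbf T_{\epsilon,0}(t-s)(u(s),v(s))+\int_s^t\mathbf T_{\epsilon,0}(t-p)(0,(1/\epsilon)\hat f(u(p)))\,dp$. A set $\mathcal I\subset Z_0$ is invariant if for every $(u_0,v_0)\in\mathcal I$ there is a full solution $(u,v)$ with $(u(0),v(0))=(u_0,v_0)$ and $(u(t),v(t))\in\mathcal I$ for all $t\in\mathbb R$. *)

theory Defs
  imports "HOL-Analysis.Analysis"
begin

section \<open>The Hilbert space of square-integrable functions on three-space\<close>

definition square_integrable :: "(real^3 \<Rightarrow> real) \<Rightarrow> bool" where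
  "square_integrable u \<longleftrightarrow>
     u \<in> borel_measurable lebesgue \<and> integrable lebesgue (\<lambda>x. (u x)\<^sup>2)"

definition l2_rel :: "(real^3 \<Rightarrow> real) \<Rightarrow> (real^3 \<Rightarrow> real) \<Rightarrow> bool" where
  "l2_rel u v \<longleftrightarrow> square_integrable u \<and> square_integrable v \<and> (AE x in lebesgue. u x = v x)"

lemma square_integrable_zero: "square_integrable (\<lambda>x. 0)"
  by (simp add: square_integrable_def)

lemma integrable_mult_l2:
  assumes "square_integrable u" "square_integrable v"
  shows "integrable lebesgue (\<lambda>x. u x * v x)"
proof (rule Bochner_Integration.integrable_bound)
  show "integrable lebesgue (\<lambda>x. (u x)\<^sup>2 + (v x)\<^sup>2)"
    using assms by (auto simp: square_integrable_def)
  show "(\<lambda>x. u x * v x) \<in> borel_measurable lebesgue"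
    using assms by (auto simp: square_integrable_def)
  have "\<bar>a * b\<bar> \<le> a\<^sup>2 + b\<^sup>2" for a b :: real
    using sum_squares_bound[of "\<bar>a\<bar>" "\<bar>b\<bar>"] abs_ge_zero[of "a * b"]
    unfolding abs_mult power2_abs by linarith
  then show "AE x in lebesgue. norm (u x * v x) \<le> norm ((u x)\<^sup>2 + (v x)\<^sup>2)"
    by simp
qed

lemma square_integrable_add:
  assumes "square_integrable u" "square_integrable v"
  shows "square_integrable (\<lambda>x. u x + v x)"
proof -
  have "integrable lebesgue (\<lambda>x. (u x)\<^sup>2 + (v x)\<^sup>2 + 2 * (u x * v x))"
    using assms integrable_mult_l2[OF assms] by (auto simp: square_integrable_def)
  then show ?thesis
    using assms by (auto simp: square_integrable_def power2_sum mult.assoc)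
qed

lemma square_integrable_scaleR:
  "square_integrable u \<Longrightarrow> square_integrable (\<lambda>x. c * u x)"
  by (auto simp: square_integrable_def power_mult_distrib)

lemma square_integrable_diff:
  assumes "square_integrable u" "square_integrable v"
  shows "square_integrable (\<lambda>x. u x - v x)"
  using square_integrable_add[OF assms(1) square_integrable_scaleR[OF assms(2), of "-1"]] by simp

lemma part_equivp_l2_rel: "part_equivp l2_rel"
proof (rule part_equivpI)
  show "\<exists>u. l2_rel u u"
    using square_integrable_zero by (auto simp: l2_rel_def)
  show "symp l2_rel"
    by (auto simp: symp_def l2_rel_def elim: eventually_mono)
  show "transp l2_rel"
    unfolding transp_def l2_rel_def by (auto elim: eventually_elim2)
qed

quotient_type l2 = "real^3 \<Rightarrow> real" / partial: l2_rel
  by (rule part_equivp_l2_rel)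

instantiation l2 :: real_vector
begin

lift_definition zero_l2 :: l2 is "\<lambda>x. 0"
  by (simp add: l2_rel_def square_integrable_zero)

lift_definition plus_l2 :: "l2 \<Rightarrow> l2 \<Rightarrow> l2" is "\<lambda>u v x. u x + v x"
  unfolding l2_rel_def by (auto intro: square_integrable_add elim: eventually_elim2)

lift_definition scaleR_l2 :: "real \<Rightarrow> l2 \<Rightarrow> l2" is "\<lambda>c u x. c * u x"
  unfolding l2_rel_def by (auto intro: square_integrable_scaleR elim: eventually_mono)

lift_definition uminus_l2 :: "l2 \<Rightarrow> l2" is "\<lambda>u x. - u x"
  unfolding l2_rel_def square_integrable_def by (auto elim: eventually_mono)

lift_definition minus_l2 :: "l2 \<Rightarrow> l2 \<Rightarrow> l2" is "\<lambda>u v x. u x - v x"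
  unfolding l2_rel_def by (auto intro: square_integrable_diff elim: eventually_elim2)

instance
proof
  fix u v w :: l2 and a b :: real
  show "u + v + w = u + (v + w)"
    by transfer (simp add: l2_rel_def square_integrable_add add.assoc)
  show "u + v = v + u"
    by transfer (simp add: l2_rel_def square_integrable_add add.commute)
  show "0 + u = u"
    by transfer (simp add: l2_rel_def)
  show "- u + u = 0"
    by transfer (simp add: l2_rel_def square_integrable_zero)
  show "u - v = u + - v"
    by transfer (simp add: l2_rel_def square_integrable_diff)
  show "a *\<^sub>R (u + v) = a *\<^sub>R u + a *\<^sub>R v"
    by transfer (auto simp: l2_rel_def algebra_simps
        intro!: square_integrable_add square_integrable_scaleR)
  show "(a + b) *\<^sub>R u = a *\<^sub>R u + b *\<^sub>R u"
    by transfer (auto simp: l2_rel_def algebra_simps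
        intro!: square_integrable_add square_integrable_scaleR)
  show "a *\<^sub>R b *\<^sub>R u = (a * b) *\<^sub>R u"
    by transfer (auto simp: l2_rel_def mult.assoc
        intro!: square_integrable_scaleR)
  show "1 *\<^sub>R u = u"
    by transfer (simp add: l2_rel_def)
qed

end

instantiation l2 :: real_inner
begin

lift_definition inner_l2 :: "l2 \<Rightarrow> l2 \<Rightarrow> real" is "\<lambda>u v. \<integral>x. u x * v x \<partial>lebesgue"
proof -
  fix u u' v v' assume "l2_rel u u'" "l2_rel v v'"
  then show "(\<integral>x. u x * v x \<partial>lebesgue) = (\<integral>x. u' x * v' x \<partial>lebesgue)"
    unfolding l2_rel_def square_integrable_def
    by (intro integral_cong_AE) (auto elim: eventually_elim2)
qed

definition norm_l2 :: "l2 \<Rightarrow> real" where "norm u = sqrt (inner u u)" for u :: l2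

definition dist_l2 :: "l2 \<Rightarrow> l2 \<Rightarrow> real" where "dist u v = norm (u - v)" for u v :: l2

definition sgn_l2 :: "l2 \<Rightarrow> l2" where "sgn u = u /\<^sub>R norm u" for u :: l2

definition uniformity_l2 :: "(l2 \<times> l2) filter" where
  "uniformity_l2 = (INF e\<in>{0<..}. principal {(x, y). dist x y < e})"

definition open_l2 :: "l2 set \<Rightarrow> bool" where
  "open_l2 S \<longleftrightarrow> (\<forall>x\<in>S. \<forall>\<^sub>F (x', y) in uniformity. x' = x \<longrightarrow> y \<in> S)"

instance
proof
  fix u v w :: l2 and a :: real
  show "sgn u = u /\<^sub>R norm u" by (rule sgn_l2_def)
  show "dist u v = norm (u - v)" by (rule dist_l2_def)
  show "(uniformity :: (l2 \<times> l2) filter) = (INF e\<in>{0<..}. principal {(x, y). dist x y < e})"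
    by (rule uniformity_l2_def)
  show "open S \<longleftrightarrow> (\<forall>x\<in>S. \<forall>\<^sub>F (x', y) in uniformity. x' = x \<longrightarrow> y \<in> S)" for S :: "l2 set"
    by (rule open_l2_def)
  show "inner u v = inner v u"
    by transfer (simp add: mult.commute)
  show "inner (u + v) w = inner u w + inner v w"
    by transfer (auto simp: l2_rel_def distrib_right integrable_mult_l2)
  show "inner (a *\<^sub>R u) v = a * inner u v"
    by transfer (simp add: mult.assoc)
  show "0 \<le> inner u u"
    by transfer simp
  show "inner u u = 0 \<longleftrightarrow> u = 0"
  proof transfer
    fix u assume "l2_rel u u"
    then have u: "square_integrable u" by (simp add: l2_rel_def)
    have "(\<integral>x. u x * u x \<partial>lebesgue) = 0 \<longleftrightarrow> (AE x in lebesgue. u x * u x = 0)"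
      by (rule integral_nonneg_eq_0_iff_AE) (auto intro: integrable_mult_l2 u)
    then show "(\<integral>x. u x * u x \<partial>lebesgue) = 0 \<longleftrightarrow> l2_rel u (\<lambda>x. 0)"
      using u by (simp add: l2_rel_def square_integrable_zero)
  qed
  show "norm u = sqrt (inner u u)" by (rule norm_l2_def)
qed

end

text \<open>
  \<open>l2_class\<close> sends a square-integrable function to its class modulo null sets; it is
  unspecified on other functions.  \<open>fn\<close> picks a representative of a class.
\<close>

abbreviation l2_class :: "(real^3 \<Rightarrow> real) \<Rightarrow> l2" where "l2_class \<equiv> abs_l2"

abbreviation fn :: "l2 \<Rightarrow> real^3 \<Rightarrow> real" where "fn \<equiv> rep_l2"

lemma square_integrable_fn: "square_integrable (fn u)"
  using Quotient_rep_reflp[OF Quotient_l2, of u] by (simp add: l2_rel_def)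

lemma fn_l2_class: "square_integrable u \<Longrightarrow> AE x in lebesgue. fn (l2_class u) x = u x"
  using Quotient_rep_abs[OF Quotient_l2, of u] by (simp add: l2_rel_def)

lemma l2_class_fn: "l2_class (fn u) = u"
  by (rule Quotient_abs_rep[OF Quotient_l2])

lemma l2_eq_iff: "u = v \<longleftrightarrow> (AE x in lebesgue. fn u x = fn v x)"
  using Quotient_rel_rep[OF Quotient_l2, of u v]
  by (simp add: l2_rel_def square_integrable_fn)

lemma inner_l2_fn: "inner u v = (\<integral>x. fn u x * fn v x \<partial>lebesgue)"
  by (simp add: inner_l2.rep_eq)

lemma norm_l2_fn: "norm u = sqrt (\<integral>x. (fn u x)\<^sup>2 \<partial>lebesgue)"
  by (simp add: norm_eq_sqrt_inner inner_l2_fn power2_eq_square)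


section \<open>Function spaces on an open set\<close>

text \<open>
  A function on \<open>\<Omega>\<close> is identified with its extension by zero, so that \<open>L\<^sup>2(\<Omega>)\<close> is a
  closed subspace of \<^typ>\<open>l2\<close> with the same norm.
\<close>

definition L2 :: "(real^3) set \<Rightarrow> l2 set" where
  "L2 \<Omega> = {u. AE x in lebesgue. x \<notin> \<Omega> \<longrightarrow> fn u x = 0}"

definition Linfty :: "(real^3) set \<Rightarrow> (real^3 \<Rightarrow> real) \<Rightarrow> bool" where
  "Linfty \<Omega> g \<longleftrightarrow> g \<in> borel_measurable (lebesgue_on \<Omega>) \<and>
     (\<exists>K. AE x in lebesgue_on \<Omega>. \<bar>g x\<bar> \<le> K)"

definition partial_deriv :: "3 \<Rightarrow> (real^3 \<Rightarrow> real) \<Rightarrow> real^3 \<Rightarrow> real" where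
  "partial_deriv i \<phi> x = frechet_derivative \<phi> (at x) (axis i 1)"

fun times_differentiable :: "nat \<Rightarrow> (real^3 \<Rightarrow> real) \<Rightarrow> bool" where
  "times_differentiable 0 \<phi> \<longleftrightarrow> True"
| "times_differentiable (Suc k) \<phi> \<longleftrightarrow>
     (\<forall>x. \<phi> differentiable (at x)) \<and> (\<forall>i. times_differentiable k (partial_deriv i \<phi>))"

text \<open>
  The test functions, i.e. the smooth functions with compact support in \<open>\<Omega>\<close>.  A function which
  is differentiable arbitrarily often has continuous derivatives of all orders.
\<close>

definition test_functions :: "(real^3) set \<Rightarrow> (real^3 \<Rightarrow> real) set" where
  "test_functions \<Omega> =
     {\<phi>. (\<forall>k. times_differentiable k \<phi>) \<and>
         compact (closure {x. \<phi> x \<noteq> 0}) \<and> closure {x. \<phi> x \<noteq> 0} \<subseteq> \<Omega>}"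

text \<open>
  An \<open>H\<^sup>1\<close> function \<open>u\<close> is represented by the pair \<open>(u, \<nabla>u)\<close> of the function and its weak
  gradient.  The norm of the product type is then the usual \<open>H\<^sup>1\<close> norm
  \<open>(\<parallel>u\<parallel>\<^sup>2 + \<parallel>\<nabla>u\<parallel>\<^sup>2)\<^sup>1\<^sup>/\<^sup>2\<close>, and \<open>H\<^sup>1\<^sub>0(\<Omega>)\<close> is the closure of the test functions in it.  Since
  the gradient is determined by the function, passing to pairs does not change the space.
\<close>

type_synonym h1 = "l2 \<times> (l2^3)"

definition H10 :: "(real^3) set \<Rightarrow> h1 set" where
  "H10 \<Omega> = closure ((\<lambda>\<phi>. (l2_class \<phi>, \<chi> i. l2_class (partial_deriv i \<phi>))) ` test_functions \<Omega>)"

abbreviation grad :: "h1 \<Rightarrow> 3 \<Rightarrow> real^3 \<Rightarrow> real" where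
  "grad u i \<equiv> fn (snd u $ i)"


section \<open>The elliptic operator\<close>

text \<open>The form \<open>\<integral>\<^sub>\<Omega> A\<nabla>u \<cdot> \<nabla>v dx + \<integral>\<^sub>\<Omega> \<beta>uv dx\<close>, which is the scalar product of \<open>H\<^sup>1\<^sub>0(\<Omega>)\<close>.\<close>

definition energy_form ::
  "(real^3) set \<Rightarrow> (real^3 \<Rightarrow> real^3^3) \<Rightarrow> (real^3 \<Rightarrow> real) \<Rightarrow> h1 \<Rightarrow> h1 \<Rightarrow> real" where
  "energy_form \<Omega> A \<beta> u v =
     (\<integral>x. (\<Sum>i\<in>UNIV. \<Sum>j\<in>UNIV. A x $ i $ j * grad u j x * grad v i x) \<partial>lebesgue_on \<Omega>)
     + (\<integral>x. \<beta> x * fn (fst u) x * fn (fst v) x \<partial>lebesgue_on \<Omega>)"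

text \<open>
  The graph of the selfadjoint operator defined by the form: \<open>u\<close> is in the domain with
  image \<open>y \<in> L\<^sup>2(\<Omega>)\<close> iff the form at \<open>(u, v)\<close> is the \<open>L\<^sup>2\<close> product of \<open>y\<close> and \<open>v\<close>,
  for all \<open>v \<in> H\<^sup>1\<^sub>0(\<Omega>)\<close>.
\<close>

definition form_op_graph ::
  "(real^3) set \<Rightarrow> (real^3 \<Rightarrow> real^3^3) \<Rightarrow> (real^3 \<Rightarrow> real) \<Rightarrow> (h1 \<times> l2) set" where
  "form_op_graph \<Omega> A \<beta> =
     {(u, y). u \<in> H10 \<Omega> \<and> y \<in> L2 \<Omega> \<and> (\<forall>v\<in>H10 \<Omega>. energy_form \<Omega> A \<beta> u v = inner y (fst v))}"

definition form_op_dom ::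
  "(real^3) set \<Rightarrow> (real^3 \<Rightarrow> real^3^3) \<Rightarrow> (real^3 \<Rightarrow> real) \<Rightarrow> h1 set" where
  "form_op_dom \<Omega> A \<beta> = Domain (form_op_graph \<Omega> A \<beta>)"

definition form_op ::
  "(real^3) set \<Rightarrow> (real^3 \<Rightarrow> real^3^3) \<Rightarrow> (real^3 \<Rightarrow> real) \<Rightarrow> h1 \<Rightarrow> l2" where
  "form_op \<Omega> A \<beta> u = (THE y. (u, y) \<in> form_op_graph \<Omega> A \<beta>)"


section \<open>Phase spaces\<close>

text \<open>
  The norm of \<open>Z\<^sub>0\<close> is that of the product type; it is equivalent to the one built from
  \<^const>\<open>energy_form\<close>, hence compactness, continuity and integrals in \<open>Z\<^sub>0\<close> are the same for both.
\<close>

definition Z0 :: "(real^3) set \<Rightarrow> (h1 \<times> l2) set" where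
  "Z0 \<Omega> = H10 \<Omega> \<times> L2 \<Omega>"

text \<open>
  \<open>Z\<^sub>1 = D(A) \<times> H\<^sup>1\<^sub>0(\<Omega>)\<close> as a subset of \<open>Z\<^sub>0\<close>; the second component, there a mere \<open>L\<^sup>2\<close> class,
  has to be (the class of) an \<open>H\<^sup>1\<^sub>0\<close> function, recovered by \<open>as_h1\<close>.
\<close>

definition Z1 ::
  "(real^3) set \<Rightarrow> (real^3 \<Rightarrow> real^3^3) \<Rightarrow> (real^3 \<Rightarrow> real) \<Rightarrow> (h1 \<times> l2) set" where
  "Z1 \<Omega> A \<beta> = form_op_dom \<Omega> A \<beta> \<times> (fst ` H10 \<Omega>)"

definition as_h1 :: "(real^3) set \<Rightarrow> l2 \<Rightarrow> h1" where
  "as_h1 \<Omega> v = (THE w. w \<in> H10 \<Omega> \<and> fst w = v)"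

definition Z1_norm ::
  "(real^3) set \<Rightarrow> (real^3 \<Rightarrow> real^3^3) \<Rightarrow> (real^3 \<Rightarrow> real) \<Rightarrow> h1 \<times> l2 \<Rightarrow> real" where
  "Z1_norm \<Omega> A \<beta> z =
     sqrt ((norm (form_op \<Omega> A \<beta> (fst z)))\<^sup>2
           + energy_form \<Omega> A \<beta> (as_h1 \<Omega> (snd z)) (as_h1 \<Omega> (snd z)))"

definition bounded_in_Z1 ::
  "(real^3) set \<Rightarrow> (real^3 \<Rightarrow> real^3^3) \<Rightarrow> (real^3 \<Rightarrow> real) \<Rightarrow> (h1 \<times> l2) set \<Rightarrow> bool" where
  "bounded_in_Z1 \<Omega> A \<beta> S \<longleftrightarrow> S \<subseteq> Z1 \<Omega> A \<beta> \<and> (\<exists>M. \<forall>z\<in>S. Z1_norm \<Omega> A \<beta> z \<le> M)"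


section \<open>The semigroup of the linear damped wave equation\<close>

definition C0_semigroup_on ::
  "'a::real_normed_vector set \<Rightarrow> (real \<Rightarrow> 'a \<Rightarrow> 'a) \<Rightarrow> bool" where
  "C0_semigroup_on Z T \<longleftrightarrow>
     (\<forall>t\<ge>0. (\<forall>x\<in>Z. T t x \<in> Z) \<and>
            (\<forall>x\<in>Z. \<forall>y\<in>Z. T t (x + y) = T t x + T t y) \<and>
            (\<forall>c. \<forall>x\<in>Z. T t (c *\<^sub>R x) = c *\<^sub>R T t x) \<and>
            (\<exists>K. \<forall>x\<in>Z. norm (T t x) \<le> K * norm x)) \<and>
     (\<forall>x\<in>Z. T 0 x = x) \<and>
     (\<forall>s\<ge>0. \<forall>t\<ge>0. \<forall>x\<in>Z. T (s + t) x = T s (T t x)) \<and>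
     (\<forall>x\<in>Z. ((\<lambda>t. T t x) \<longlongrightarrow> x) (at_right 0))"

definition generator_on ::
  "'a::real_normed_vector set \<Rightarrow> (real \<Rightarrow> 'a \<Rightarrow> 'a) \<Rightarrow> ('a \<times> 'a) set" where
  "generator_on Z T =
     {(x, y). x \<in> Z \<and> y \<in> Z \<and> ((\<lambda>h. (1 / h) *\<^sub>R (T h x - x)) \<longlongrightarrow> y) (at_right 0)}"

text \<open>
  The graph of \<open>(u, v) \<mapsto> (v, -(1/\<epsilon>)(v + A u))\<close> on \<open>Z\<^sub>1\<close>; below, \<open>w\<close> is \<open>v\<close> regarded as an
  element of \<open>H\<^sup>1\<^sub>0(\<Omega>)\<close> and \<open>y\<close> is \<open>A u\<close>.
\<close>

definition wave_op_graph ::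
  "(real^3) set \<Rightarrow> (real^3 \<Rightarrow> real^3^3) \<Rightarrow> (real^3 \<Rightarrow> real) \<Rightarrow> real \<Rightarrow>
   ((h1 \<times> l2) \<times> (h1 \<times> l2)) set" where
  "wave_op_graph \<Omega> A \<beta> \<epsilon> =
     {((u, fst w), (w, - ((1 / \<epsilon>) *\<^sub>R (fst w + y)))) | u w y.
        (u, y) \<in> form_op_graph \<Omega> A \<beta> \<and> w \<in> H10 \<Omega>}"

definition wave_semigroup ::
  "(real^3) set \<Rightarrow> (real^3 \<Rightarrow> real^3^3) \<Rightarrow> (real^3 \<Rightarrow> real) \<Rightarrow> real \<Rightarrow>
   (real \<Rightarrow> h1 \<times> l2 \<Rightarrow> h1 \<times> l2) \<Rightarrow> bool" where
  "wave_semigroup \<Omega> A \<beta> \<epsilon> T \<longleftrightarrow>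
     C0_semigroup_on (Z0 \<Omega>) T \<and> generator_on (Z0 \<Omega>) T = wave_op_graph \<Omega> A \<beta> \<epsilon>"


section \<open>Full solutions and invariant sets\<close>

definition nemytskii :: "(real^3) set \<Rightarrow> (real^3 \<Rightarrow> real \<Rightarrow> real) \<Rightarrow> h1 \<Rightarrow> l2" where
  "nemytskii \<Omega> f u = l2_class (\<lambda>x. if x \<in> \<Omega> then f x (fn (fst u) x) else 0)"

definition full_solution ::
  "(real^3) set \<Rightarrow> (real^3 \<Rightarrow> real \<Rightarrow> real) \<Rightarrow> real \<Rightarrow>
   (real \<Rightarrow> h1 \<times> l2 \<Rightarrow> h1 \<times> l2) \<Rightarrow> (real \<Rightarrow> h1 \<times> l2) \<Rightarrow> bool" where
  "full_solution \<Omega> f \<epsilon> T U \<longleftrightarrow>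
     (\<forall>t. U t \<in> Z0 \<Omega>) \<and>
     (\<forall>s t. s \<le> t \<longrightarrow>
        ((\<lambda>p. T (t - p) (0, (1 / \<epsilon>) *\<^sub>R nemytskii \<Omega> f (fst (U p))))
           has_integral (U t - T (t - s) (U s))) {s..t})"

definition invariant_set ::
  "(real^3) set \<Rightarrow> (real^3 \<Rightarrow> real \<Rightarrow> real) \<Rightarrow> real \<Rightarrow>
   (real \<Rightarrow> h1 \<times> l2 \<Rightarrow> h1 \<times> l2) \<Rightarrow> (h1 \<times> l2) set \<Rightarrow> bool" where
  "invariant_set \<Omega> f \<epsilon> T S \<longleftrightarrow> S \<subseteq> Z0 \<Omega> \<and>
     (\<forall>z\<in>S. \<exists>U. full_solution \<Omega> f \<epsilon> T U \<and> U 0 = z \<and> (\<forall>t. U t \<in> S))"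

end

theory Submission
  imports Defs
begin

text \<open>
  The linear semigroup decays exponentially, by a Lyapunov functional.  Along a full solution
  \<open>U = (u, v)\<close> in the compact set, the difference quotients \<open>(U (t + h) - U t) / h\<close> solve a linear
  equation whose inhomogeneity is the difference quotient of the nonlinearity.  Although the
  embedding of \<open>H\<^sup>1\<^sub>0\<close> into \<open>L\<^sup>6\<close> makes the cubic growth critical, on a compact set of \<open>u\<close> the
  nonlinearity is Lipschitz with an arbitrarily small constant in the \<open>H\<^sup>1\<close> norm, up to a large
  constant in the \<open>L\<^sup>2\<close> norm (a compact set is uniformly close to bounded functions).  The latter
  part is harmless, because \<open>u\<close> is Lipschitz in \<open>L\<^sup>2\<close>, and the small part is absorbed by the decay over
  the time interval from \<open>-\<infinity>\<close> to \<open>t\<close>.  So \<open>U\<close> is Lipschitz in \<open>Z\<^sub>0\<close> with a uniform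
  constant, which in a Hilbert space means that it stays in a bounded subset of the domain of the
  generator.
\<close>

section \<open>The space of square-integrable functions\<close>

text \<open>Smallness of the Lipschitz constant is the crux: a constant of the order of the squared
  radius of the set in \<open>Z0 \<Omega>\<close> would not be beaten by the fixed decay rate
  \<open>\<omega>\<close>, and a Gronwall estimate would not be uniform in time. The critical term
  is \<open>u ^ 4 * w\<^sup>2\<close>, with \<open>w\<close> a difference of states; for bounded
  \<open>u\<close> it costs only the \<open>L\<^sup>2\<close> norm of \<open>w\<close>. Invariance
  supplies an unbounded past: the difference of two earlier states, bounded by \<open>2 * R\<close>,
  enters with the factor \<open>exp (- \<omega> * r)\<close> and disappears as \<open>r\<close>
  grows, so regularity is gained and not merely propagated. Increments of a bounded solution have a
  finite supremum \<open>S\<close> from the start, hence an inequality of the form "\<open>S\<close>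
  is at most \<open>S / 2\<close> plus a multiple of \<open>h\<close>" may be solved for
  \<open>S\<close>. The \<open>L\<^sup>2\<close> Lipschitz bound on \<open>u\<close> comes from the
  first row of the generator, which sends \<open>(u, v)\<close> to a state with first component
  \<open>v\<close>. Since \<open>T\<close> is specified only on \<open>Z0 \<Omega>\<close>, a closed
  subspace of the ambient type, the semigroup theory is developed relative to such a
  subspace.\<close>

lemma fn_borel [measurable]: "fn u \<in> borel_measurable lebesgue"
  using square_integrable_fn[of u] by (simp add: square_integrable_def)

lemma integrable_fn_square: "integrable lebesgue (\<lambda>x. (fn u x)\<^sup>2)"
  using square_integrable_fn[of u] by (simp add: square_integrable_def)

lemma l2_class_add:
  "square_integrable u \<Longrightarrow> square_integrable v \<Longrightarrow> l2_class u + l2_class v = l2_class (\<lambda>x. u x + v x)"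
  by (simp add: plus_l2.abs_eq l2_rel_def)

lemma l2_class_diff:
  "square_integrable u \<Longrightarrow> square_integrable v \<Longrightarrow> l2_class u - l2_class v = l2_class (\<lambda>x. u x - v x)"
  by (simp add: minus_l2.abs_eq l2_rel_def)

lemma l2_class_scaleR:
  "square_integrable u \<Longrightarrow> c *\<^sub>R l2_class u = l2_class (\<lambda>x. c * u x)"
  by (simp add: scaleR_l2.abs_eq l2_rel_def)

lemma fn_add: "AE x in lebesgue. fn (u + v) x = fn u x + fn v x"
  using fn_l2_class[OF square_integrable_add[OF square_integrable_fn[of u] square_integrable_fn[of v]]]
  by (simp add: l2_class_add[symmetric] square_integrable_fn l2_class_fn)

lemma fn_diff: "AE x in lebesgue. fn (u - v) x = fn u x - fn v x"
  using fn_l2_class[OF square_integrable_diff[OF square_integrable_fn[of u] square_integrable_fn[of v]]]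
  by (simp add: l2_class_diff[symmetric] square_integrable_fn l2_class_fn)

lemma fn_scaleR: "AE x in lebesgue. fn (c *\<^sub>R u) x = c * fn u x"
  using fn_l2_class[OF square_integrable_scaleR[OF square_integrable_fn[of u], of c]]
  by (simp add: l2_class_scaleR[symmetric] square_integrable_fn l2_class_fn)

lemma fn_zero: "AE x in lebesgue. fn 0 x = 0"
  using fn_scaleR[of 0 0] by simp

lemma norm_l2_square: "(norm u)\<^sup>2 = (\<integral>x. (fn u x)\<^sup>2 \<partial>lebesgue)"
  by (simp add: norm_l2_fn)

lemma norm_diff_l2_square: "(norm (u - v))\<^sup>2 = (\<integral>x. (fn u x - fn v x)\<^sup>2 \<partial>lebesgue)"
  unfolding norm_l2_square
  by (rule integral_cong_AE) (use fn_diff[of u v] in \<open>auto elim: eventually_mono\<close>)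

lemma norm_l2_class_square:
  assumes "square_integrable u"
  shows "(norm (l2_class u))\<^sup>2 = (\<integral>x. (u x)\<^sup>2 \<partial>lebesgue)"
  unfolding norm_l2_square
  by (rule integral_cong_AE)
     (use assms fn_l2_class[OF assms] in \<open>auto simp: square_integrable_def elim: eventually_mono\<close>)

lemma nn_integral_fn_square: "(\<integral>\<^sup>+x. ennreal ((fn u x)\<^sup>2) \<partial>lebesgue) = ennreal ((norm u)\<^sup>2)"
  unfolding norm_l2_square by (rule nn_integral_eq_integral) (auto simp: integrable_fn_square)

lemma nn_integral_fn_diff_square:
  "(\<integral>\<^sup>+x. ennreal ((fn u x - fn v x)\<^sup>2) \<partial>lebesgue) = ennreal ((norm (u - v))\<^sup>2)"
  unfolding norm_diff_l2_square
  by (rule nn_integral_eq_integral)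
     (use square_integrable_diff[OF square_integrable_fn[of u] square_integrable_fn[of v]]
      in \<open>auto simp: square_integrable_def\<close>)

lemma square_integrable_nn_integral:
  assumes [measurable]: "u \<in> borel_measurable lebesgue"
    and "(\<integral>\<^sup>+x. ennreal ((u x)\<^sup>2) \<partial>lebesgue) < \<infinity>"
  shows "square_integrable u"
  unfolding square_integrable_def using assms by (auto simp: integrable_iff_bounded)

lemma norm_l2_class_nn_integral:
  assumes "square_integrable u"
  shows "ennreal ((norm (l2_class u))\<^sup>2) = (\<integral>\<^sup>+x. ennreal ((u x)\<^sup>2) \<partial>lebesgue)"
  unfolding norm_l2_class_square[OF assms]
  by (rule nn_integral_eq_integral[symmetric]) (use assms in \<open>auto simp: square_integrable_def\<close>)

text \<open>The squared differences tend to zero in \<open>L\<^sup>1\<close>, and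
  \<open>L\<^sup>1\<close> convergence yields an a.e. convergent subsequence. This is the bridge
  from norm limits to pointwise facts: closedness of \<open>L2 \<Omega>\<close> and Fatou in the
  Sobolev bound on \<open>H10 \<Omega>\<close>.\<close>

lemma l2_convergent_AE_subseq:
  assumes "X \<longlonglongrightarrow> u"
  obtains r :: "nat \<Rightarrow> nat" where "strict_mono r" "AE x in lebesgue. (\<lambda>n. fn (X (r n)) x) \<longlonglongrightarrow> fn u x"
proof -
  have "(\<lambda>n. (norm (X n - u))\<^sup>2) \<longlonglongrightarrow> 0"
    using tendsto_power[OF tendsto_norm[OF LIM_zero[OF assms]], of 2] by simp
  then have "(\<lambda>n. \<integral>x. norm ((fn (X n) x - fn u x)\<^sup>2) \<partial>lebesgue) \<longlonglongrightarrow> 0"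
    by (simp add: norm_diff_l2_square)
  moreover have "integrable lebesgue (\<lambda>x. (fn (X n) x - fn u x)\<^sup>2)" for n
    using square_integrable_diff[OF square_integrable_fn[of "X n"] square_integrable_fn[of u]]
    by (simp add: square_integrable_def)
  ultimately obtain r :: "nat \<Rightarrow> nat" where r: "strict_mono r"
      "AE x in lebesgue. (\<lambda>n. (fn (X (r n)) x - fn u x)\<^sup>2) \<longlonglongrightarrow> 0"
    using tendsto_L1_AE_subseq[of lebesgue "\<lambda>n x. (fn (X n) x - fn u x)\<^sup>2"] by blast
  have "(\<lambda>n. fn (X (r n)) x) \<longlonglongrightarrow> fn u x" if "(\<lambda>n. (fn (X (r n)) x - fn u x)\<^sup>2) \<longlonglongrightarrow> 0" for x
    using tendsto_real_sqrt[OF that] by (simp add: LIM_zero_cancel tendsto_rabs_zero_iff)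
  then have "AE x in lebesgue. (\<lambda>n. fn (X (r n)) x) \<longlonglongrightarrow> fn u x"
    using r(2) by (rule eventually_mono[rotated])
  with r(1) that show ?thesis by blast
qed

text \<open>There is room for the weight \<open>2^n\<close>: the weighted sum of squared increments
  still has integral at most the sum of \<open>(1/2)^n\<close>, so it is finite a.e., and together
  with a geometric series it dominates the increments themselves.\<close>

lemma l2_fast_Cauchy_AE_convergent:
  assumes X: "\<And>n. norm (X (Suc n) - X n) \<le> (1/2)^n"
  shows "AE x in lebesgue. convergent (\<lambda>n. fn (X n) x)"
proof -
  have "(\<integral>\<^sup>+x. (\<Sum>n. ennreal (2^n * (fn (X (Suc n)) x - fn (X n) x)\<^sup>2)) \<partial>lebesgue)
      = (\<Sum>n. \<integral>\<^sup>+x. ennreal (2^n * (fn (X (Suc n)) x - fn (X n) x)\<^sup>2) \<partial>lebesgue)"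
    by (rule nn_integral_suminf) simp
  also have "\<dots> = (\<Sum>n. ennreal (2^n * (norm (X (Suc n) - X n))\<^sup>2))"
    by (intro suminf_cong)
       (simp add: ennreal_mult nn_integral_cmult nn_integral_fn_diff_square)
  also have "\<dots> \<le> (\<Sum>n. ennreal ((1/2)^n))"
  proof (rule suminf_le)
    fix n
    have "2^n * (norm (X (Suc n) - X n))\<^sup>2 \<le> 2^n * ((1/2)^n)\<^sup>2"
      by (intro mult_left_mono power_mono X) auto
    also have "\<dots> = (1/2::real)^n"
      by (simp add: power2_eq_square power_one_over)
    finally show "ennreal (2^n * (norm (X (Suc n) - X n))\<^sup>2) \<le> ennreal ((1/2)^n)"
      by (rule ennreal_leI)
  qed auto
  also have "\<dots> = ennreal (\<Sum>n. (1/2)^n)"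
    by (rule suminf_ennreal2) (auto intro: summable_geometric)
  also have "\<dots> < \<infinity>" by simp
  finally have "AE x in lebesgue. (\<Sum>n. ennreal (2^n * (fn (X (Suc n)) x - fn (X n) x)\<^sup>2)) \<noteq> \<infinity>"
    by (intro nn_integral_PInf_AE) auto
  then show ?thesis
  proof eventually_elim
    case (elim x)
    define d where "d n = fn (X (Suc n)) x - fn (X n) x" for n
    have s1: "summable (\<lambda>n. 2^n * (d n)\<^sup>2)"
      using elim by (intro summable_suminf_not_top) (auto simp: d_def)
    have s2: "summable (\<lambda>n. (1/2::real)^n + 2^n * (d n)\<^sup>2)"
      by (intro summable_add s1 summable_geometric) simp
    have "summable d"
    proof (rule summable_comparison_test'[OF s2])
      fix n
      have "\<bar>d n\<bar> \<le> (1/2::real)^n + 2^n * (d n)\<^sup>2"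
      proof -
        \<comment> \<open>Expanding gives
          \<open>2^n * \<bar>d n\<bar> \<le> 1 + 4^n * (d n)\<^sup>2\<close>, the claim multiplied
          by \<open>2^n\<close>.\<close>
        have "0 \<le> (2^n * \<bar>d n\<bar> - 1)\<^sup>2 + 2^n * \<bar>d n\<bar>" by simp
        then have "2^n * \<bar>d n\<bar> \<le> 2^n * ((1/2::real)^n + 2^n * (d n)\<^sup>2)"
          by (simp add: power2_eq_square algebra_simps abs_mult_self_eq flip: power_mult_distrib)
        then show ?thesis by simp
      qed
      then show "norm (d n) \<le> (1/2)^n + 2^n * (d n)\<^sup>2" by simp
    qed
    then have "convergent (\<lambda>n. \<Sum>k<n. d k)"
      by (simp add: summable_iff_convergent)
    then have "convergent (\<lambda>n. fn (X 0) x + (\<Sum>k<n. d k))"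
      by (intro convergent_add convergent_const)
    moreover have "fn (X 0) x + (\<Sum>k<n. d k) = fn (X n) x" for n
      by (induction n) (auto simp: d_def)
    ultimately show ?case by simp
  qed
qed

text \<open>Riesz-Fischer: a fast subsequence converges a.e., and Fatou shows that its pointwise
  limit is also the norm limit. Completeness is behind the Baire argument, the integrals of
  continuous orbits and the Cauchy sequences used later.\<close>

instance l2 :: banach
proof
  fix X :: "nat \<Rightarrow> l2"
  assume C: "Cauchy X"
  have "\<exists>r::nat\<Rightarrow>nat. strict_mono r \<and> (\<forall>n. norm (X (r (Suc n)) - X (r n)) \<le> (1/2)^n)"
  proof -
    have "\<exists>M. \<forall>m\<ge>M. \<forall>n\<ge>M. norm (X m - X n) < (1/2)^k" for k
      using CauchyD[OF C, of "(1/2)^k"] by simp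
    then obtain M where M: "\<And>k m n. M k \<le> m \<Longrightarrow> M k \<le> n \<Longrightarrow> norm (X m - X n) < (1/2)^k"
      by metis
    \<comment> \<open>The summand \<open>n\<close> makes \<open>r\<close> strictly increasing, and
      the sum makes it dominate \<open>M n\<close> although \<open>M\<close> need not be
      monotone.\<close>
    define r where "r n = n + (\<Sum>k\<le>n. M k)" for n
    have le: "M n \<le> r n" "r n < r (Suc n)" for n
      by (auto simp: r_def intro: trans_le_add2 member_le_sum)
    then have "strict_mono r" by (simp add: strict_mono_Suc_iff)
    moreover have "norm (X (r (Suc n)) - X (r n)) \<le> (1/2)^n" for n
      using M[of n "r (Suc n)" "r n"] le[of n] by force
    ultimately show ?thesis by blast
  qed
  then obtain r :: "nat \<Rightarrow> nat" where r: "strict_mono r" "\<And>n. norm (X (r (Suc n)) - X (r n)) \<le> (1/2)^n"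
    by blast
  define Y where "Y n = X (r n)" for n
  have CY: "Cauchy Y"
    using Cauchy_subseq_Cauchy[OF C r(1)] by (simp add: Y_def[abs_def] comp_def)
  define g where "g x = lim (\<lambda>n. fn (Y n) x)" for x
  have conv: "AE x in lebesgue. (\<lambda>n. fn (Y n) x) \<longlonglongrightarrow> g x"
    using l2_fast_Cauchy_AE_convergent[of Y] r(2)
    by (auto simp: Y_def g_def convergent_LIMSEQ_iff elim: eventually_mono)
  have [measurable]: "g \<in> borel_measurable lebesgue"
    unfolding g_def by (rule borel_measurable_lim_metric) simp
  have dist: "(\<integral>\<^sup>+x. ennreal ((g x - fn (Y n) x)\<^sup>2) \<partial>lebesgue) \<le> ennreal (e\<^sup>2)"
    if "\<And>m. m \<ge> n \<Longrightarrow> norm (Y m - Y n) \<le> e" "0 \<le> e" for n e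
  proof -
    have "(\<integral>\<^sup>+x. ennreal ((g x - fn (Y n) x)\<^sup>2) \<partial>lebesgue)
        = (\<integral>\<^sup>+x. liminf (\<lambda>m. ennreal ((fn (Y m) x - fn (Y n) x)\<^sup>2)) \<partial>lebesgue)"
    proof (rule nn_integral_cong_AE, use conv in eventually_elim)
      case (elim x)
      then have "(\<lambda>m. ennreal ((fn (Y m) x - fn (Y n) x)\<^sup>2)) \<longlonglongrightarrow> ennreal ((g x - fn (Y n) x)\<^sup>2)"
        by (intro tendsto_intros)
      from lim_imp_Liminf[OF sequentially_bot this] show ?case
        by (rule sym)
    qed
    also have "\<dots> \<le> liminf (\<lambda>m. \<integral>\<^sup>+x. ennreal ((fn (Y m) x - fn (Y n) x)\<^sup>2) \<partial>lebesgue)"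
      by (rule nn_integral_liminf) simp
    also have "\<dots> \<le> ennreal (e\<^sup>2)"
    proof (rule Liminf_le)
      show "\<forall>\<^sub>F m in sequentially. (\<integral>\<^sup>+x. ennreal ((fn (Y m) x - fn (Y n) x)\<^sup>2) \<partial>lebesgue) \<le> ennreal (e\<^sup>2)"
        using eventually_ge_at_top[of n]
      proof eventually_elim
        case (elim m)
        then show ?case
          unfolding nn_integral_fn_diff_square by (intro ennreal_leI power_mono that) auto
      qed
    qed simp
    finally show ?thesis .
  qed
  \<comment> \<open>One index from which on all distances are at most 1 is enough: Fatou bounds
    \<open>g - fn (Y n)\<close>, and \<open>fn (Y n)\<close> is added back.\<close>
  have "square_integrable g"
  proof -
    obtain n where n: "\<And>m. m \<ge> n \<Longrightarrow> norm (Y m - Y n) \<le> 1"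
      using CauchyD[OF CY, of 1] by (meson less_imp_le order_refl zero_less_one)
    have "square_integrable (\<lambda>x. g x - fn (Y n) x)"
      using dist[OF n] by (intro square_integrable_nn_integral) (auto simp: less_top[symmetric] top_unique intro: le_less_trans)
    from square_integrable_add[OF this square_integrable_fn[of "Y n"]] show ?thesis by simp
  qed
  have "Y \<longlonglongrightarrow> l2_class g"
  proof (rule LIMSEQ_I)
    fix e :: real assume "0 < e"
    then obtain N where N: "\<And>m n. m \<ge> N \<Longrightarrow> n \<ge> N \<Longrightarrow> norm (Y m - Y n) < e / 2"
      using CauchyD[OF CY, of "e/2"] by auto
    have "norm (Y n - l2_class g) < e" if "n \<ge> N" for n
    proof -
      have "ennreal ((norm (l2_class g - Y n))\<^sup>2) = (\<integral>\<^sup>+x. ennreal ((g x - fn (Y n) x)\<^sup>2) \<partial>lebesgue)"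
        using norm_l2_class_nn_integral[OF square_integrable_diff[OF \<open>square_integrable g\<close> square_integrable_fn[of "Y n"]]]
        by (simp add: l2_class_diff[symmetric] \<open>square_integrable g\<close> square_integrable_fn l2_class_fn)
      also have "\<dots> \<le> ennreal ((e/2)\<^sup>2)"
        using N that \<open>0 < e\<close> by (intro dist) (auto intro: less_imp_le)
      finally have "norm (l2_class g - Y n) \<le> e/2"
        using \<open>0 < e\<close> by (simp add: power2_le_iff_abs_le)
      then show ?thesis using \<open>0 < e\<close> by (simp add: norm_minus_commute)
    qed
    then show "\<exists>N. \<forall>n\<ge>N. norm (Y n - l2_class g) < e" by blast
  qed
  then have "X \<longlonglongrightarrow> l2_class g"
    using C r(1) by (auto simp: Y_def[abs_def] comp_def intro: Cauchy_converges_subseq)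
  then show "convergent X" by (rule convergentI)
qed

section \<open>Strongly continuous semigroups on a closed subspace\<close>

text \<open>The operators of the semigroup are specified only on the phase space and may be anything
  elsewhere, so linearity is stated relative to a subset instead of through maps that are linear on
  the whole type.\<close>

definition linear_on_subspace :: "'a::real_normed_vector set \<Rightarrow> ('a \<Rightarrow> 'b::real_normed_vector) \<Rightarrow> bool" where
  "linear_on_subspace Z L \<longleftrightarrow> (\<forall>x\<in>Z. \<forall>y\<in>Z. L (x + y) = L x + L y) \<and> (\<forall>c. \<forall>x\<in>Z. L (c *\<^sub>R x) = c *\<^sub>R L x)"

lemma linear_on_subspace_add: "linear_on_subspace Z L \<Longrightarrow> x \<in> Z \<Longrightarrow> y \<in> Z \<Longrightarrow> L (x + y) = L x + L y"
  and linear_on_subspace_scaleR: "linear_on_subspace Z L \<Longrightarrow> x \<in> Z \<Longrightarrow> L (c *\<^sub>R x) = c *\<^sub>R L x"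
  by (auto simp: linear_on_subspace_def)

lemma linear_on_subspace_diff:
  assumes "linear_on_subspace Z L" "subspace Z" "x \<in> Z" "y \<in> Z"
  shows "L (x - y) = L x - L y"
  using linear_on_subspace_add[OF assms(1), of "x - y" y] assms by (simp add: subspace_diff)

lemma linear_on_subspace_sum:
  assumes "linear_on_subspace Z L" "subspace Z" "\<And>i. i \<in> S \<Longrightarrow> x i \<in> Z"
  shows "L (\<Sum>i\<in>S. c i *\<^sub>R x i) = (\<Sum>i\<in>S. c i *\<^sub>R L (x i))"
proof -
  have 0: "L 0 = 0"
    using linear_on_subspace_scaleR[OF assms(1), of 0 0] assms(2) by (simp add: subspace_0)
  show ?thesis
  proof (cases "finite S")
    case True
    then show ?thesis using assms(3)
    proof induction
      case (insert i S)
      have "L (c i *\<^sub>R x i + (\<Sum>i\<in>S. c i *\<^sub>R x i)) = L (c i *\<^sub>R x i) + L (\<Sum>i\<in>S. c i *\<^sub>R x i)"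
        by (intro linear_on_subspace_add[OF assms(1)] subspace_scale subspace_sum assms(2))
           (use insert.prems in auto)
      with insert show ?case by (simp add: linear_on_subspace_scaleR[OF assms(1)])
    qed (simp add: 0)
  qed (simp add: 0)
qed

text \<open>\<open>L\<close> is linear only on \<open>Z\<close>, so it is exchanged with the Riemann
  sums: these are finite combinations of values of \<open>g\<close>, stay in \<open>Z\<close>, and
  by closedness so does their limit \<open>I\<close>, to which the bound on \<open>L\<close> then
  applies.\<close>

lemma has_integral_linear_on_subspace:
  fixes g :: "real \<Rightarrow> 'a::real_normed_vector"
  assumes I: "(g has_integral I) {a..b}" and Z: "subspace Z" "closed Z" and g: "\<And>t. g t \<in> Z"
    and L: "linear_on_subspace Z L" and K: "\<And>x. x \<in> Z \<Longrightarrow> norm (L x) \<le> K * norm x"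
  shows "I \<in> Z" "((\<lambda>t. L (g t)) has_integral L I) {a..b}"
proof -
  let ?S = "\<lambda>p. \<Sum>(x, k)\<in>p. measure lborel k *\<^sub>R g x"
  have lim: "(?S \<longlongrightarrow> I) (division_filter (cbox a b))"
    using I unfolding box_real[symmetric] has_integral_cbox .
  have S_in: "?S p \<in> Z" for p :: "(real \<times> real set) set"
    using Z(1) g by (intro subspace_sum) (auto simp: split_beta intro: subspace_scale)
  show IZ: "I \<in> Z"
    by (rule Lim_in_closed_set[OF Z(2) _ division_filter_not_empty lim]) (simp add: S_in)
  have LS: "L (?S p) = (\<Sum>(x, k)\<in>p. measure lborel k *\<^sub>R L (g x))" for p
    using linear_on_subspace_sum[OF L Z(1), of p "\<lambda>xk. g (fst xk)" "\<lambda>xk. measure lborel (snd xk)"] g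
    by (simp add: split_beta)
  have "((\<lambda>p. L (?S p)) \<longlongrightarrow> L I) (division_filter (cbox a b))"
  proof (rule Lim_null[THEN iffD2], rule tendsto_norm_zero_cancel, rule tendsto_sandwich[OF _ _ tendsto_const])
    show "\<forall>\<^sub>F p in division_filter (cbox a b). norm (L (?S p) - L I) \<le> K * norm (?S p - I)"
      using K S_in IZ Z by (simp add: linear_on_subspace_diff[OF L Z(1), symmetric] subspace_diff)
    show "((\<lambda>p. K * norm (?S p - I)) \<longlongrightarrow> 0) (division_filter (cbox a b))"
      using tendsto_mult_right_zero[OF tendsto_norm_zero[OF LIM_zero[OF lim]]] .
  qed auto
  then show "((\<lambda>t. L (g t)) has_integral L I) {a..b}"
    unfolding box_real[symmetric] has_integral_cbox LS .
qed

text \<open>Banach-Steinhaus by Baire category: the relatively closed sets \<open>A k\<close>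
  exhaust \<open>Z\<close>, which is completely metrizable as a closed subset of a Banach space, so
  some \<open>A k\<close> contains a relative ball.\<close>

lemma uniform_boundedness_on_subspace:
  fixes F :: "nat \<Rightarrow> 'a::banach \<Rightarrow> 'b::real_normed_vector"
  assumes Z: "subspace Z" "closed Z"
    and F: "\<And>n. linear_on_subspace Z (F n)" "\<And>n. \<exists>K. \<forall>x\<in>Z. norm (F n x) \<le> K * norm x"
    and bdd: "\<And>x. x \<in> Z \<Longrightarrow> \<exists>C. \<forall>n. norm (F n x) \<le> C"
  shows "\<exists>K. \<forall>n. \<forall>x\<in>Z. norm (F n x) \<le> K * norm x"
proof -
  define A where "A k = {x\<in>Z. \<forall>n. norm (F n x) \<le> real k}" for k
  have cont: "continuous_on Z (F n)" for n
  proof -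
    obtain K where K: "\<And>x. x \<in> Z \<Longrightarrow> norm (F n x) \<le> K * norm x" using F(2) by blast
    have "dist (F n x) (F n y) \<le> \<bar>K\<bar> * dist x y" if "x \<in> Z" "y \<in> Z" for x y
      using order_trans[OF K[of "x - y"] mult_right_mono[OF abs_ge_self norm_ge_zero]] that Z(1)
      by (simp add: dist_norm linear_on_subspace_diff[OF F(1) Z(1)] subspace_diff)
    then have "\<bar>K\<bar>-lipschitz_on Z (F n)" by (intro lipschitz_onI) auto
    then show ?thesis by (rule lipschitz_on_continuous_on)
  qed
  have closed: "closedin (top_of_set Z) (A k)" for k
  proof -
    have "A k = (\<Inter>n. Z \<inter> F n -` cball 0 (real k))"
      by (auto simp: A_def)
    also have "closedin (top_of_set Z) \<dots>"
      by (intro closedin_Inter) (auto intro: continuous_closedin_preimage[OF cont closed_cball])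
    finally show ?thesis .
  qed
  have un: "\<Union>(range A) = Z"
  proof -
    have "\<exists>k. x \<in> A k" if xZ: "x \<in> Z" for x
    proof -
      obtain C where "\<And>n. norm (F n x) \<le> C" using bdd[OF xZ] by blast
      moreover obtain k where "C \<le> real k" using real_arch_simple by blast
      ultimately have "norm (F n x) \<le> real k" for n using order_trans by blast
      then show ?thesis using xZ by (auto simp: A_def)
    qed
    then show ?thesis by (auto simp: A_def)
  qed
  have cm: "completely_metrizable_space (top_of_set Z)"
    using Z(2) unfolding closed_closedin
    by (rule completely_metrizable_space_closedin[OF completely_metrizable_space_euclidean])
  obtain k where k: "top_of_set Z interior_of A k \<noteq> {}"
  proof (rule ccontr)
    assume "\<not> thesis"
    then have "top_of_set Z interior_of \<Union>(range A) = {}"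
      using that closed by (intro Baire_category_alt) (use cm in auto)
    moreover have "top_of_set Z interior_of Z = Z"
      using interior_of_topspace[of "top_of_set Z"] by simp
    ultimately show False using un subspace_0[OF Z(1)] by auto
  qed
  then obtain x0 U where U: "openin (top_of_set Z) U" "x0 \<in> U" "U \<subseteq> A k"
    by (auto simp: interior_of_def)
  then obtain r where r: "r > 0" "ball x0 r \<inter> Z \<subseteq> A k"
    by (metis openin_contains_ball order_trans)
  have x0: "x0 \<in> A k" "x0 \<in> Z" using U by (auto simp: A_def)
  have "norm (F n x) \<le> (4 * real k / r) * norm x" if x: "x \<in> Z" for n x
  proof (cases "x = 0")
    case True
    then show ?thesis using linear_on_subspace_scaleR[OF F(1)[of n], of 0 0] Z(1) by (simp add: subspace_0)
  next
    case False
    \<comment> \<open>Length \<open>r / 2\<close> keeps \<open>x0 + y\<close> strictly inside the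
      ball. Then \<open>F n y\<close> is a difference of two values of norm at most
      \<open>k\<close>, and undoing the scaling turns \<open>2 * k\<close> into
      \<open>4 * k / r\<close> times \<open>norm x\<close>.\<close>
    define y where "y = (r / (2 * norm x)) *\<^sub>R x"
    have y: "y \<in> Z" using x Z(1) by (simp add: y_def subspace_scale)
    have "norm y < r" using False r by (simp add: y_def)
    then have "x0 + y \<in> A k"
      using r(2) x0 y Z(1) by (auto simp: dist_norm subspace_add)
    then have "norm (F n (x0 + y)) \<le> k" "norm (F n x0) \<le> k"
      using x0 by (auto simp: A_def)
    moreover have "F n (x0 + y) = F n x0 + F n y"
      by (rule linear_on_subspace_add[OF F(1) x0(2) y])
    ultimately have "norm (F n y) \<le> 2 * real k"
      using norm_triangle_ineq4[of "F n x0 + F n y" "F n x0"] by simp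
    then have "(r / (2 * norm x)) * norm (F n x) \<le> 2 * real k"
      using r False unfolding y_def linear_on_subspace_scaleR[OF F(1) x] by simp
    then show ?thesis using r False by (simp add: field_simps)
  qed
  then show ?thesis by blast
qed

locale c0_semigroup =
  fixes Z :: "'a::banach set" and T :: "real \<Rightarrow> 'a \<Rightarrow> 'a"
  assumes subspace: "subspace Z" and closed: "closed Z" and semigroup: "C0_semigroup_on Z T"
begin

lemma in_Z: "t \<ge> 0 \<Longrightarrow> x \<in> Z \<Longrightarrow> T t x \<in> Z"
  and T_zero: "x \<in> Z \<Longrightarrow> T 0 x = x"
  and T_plus: "s \<ge> 0 \<Longrightarrow> t \<ge> 0 \<Longrightarrow> x \<in> Z \<Longrightarrow> T (s + t) x = T s (T t x)"
  and right_continuous: "x \<in> Z \<Longrightarrow> ((\<lambda>t. T t x) \<longlongrightarrow> x) (at_right 0)"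
  and linear: "t \<ge> 0 \<Longrightarrow> linear_on_subspace Z (T t)"
  and bounded: "t \<ge> 0 \<Longrightarrow> \<exists>K. \<forall>x\<in>Z. norm (T t x) \<le> K * norm x"
  using semigroup by (auto simp: C0_semigroup_on_def linear_on_subspace_def)

lemma T_diff: "t \<ge> 0 \<Longrightarrow> x \<in> Z \<Longrightarrow> y \<in> Z \<Longrightarrow> T t (x - y) = T t x - T t y"
  and T_add: "t \<ge> 0 \<Longrightarrow> x \<in> Z \<Longrightarrow> y \<in> Z \<Longrightarrow> T t (x + y) = T t x + T t y"
  and T_scaleR: "t \<ge> 0 \<Longrightarrow> x \<in> Z \<Longrightarrow> T t (c *\<^sub>R x) = c *\<^sub>R T t x"
  by (simp_all add: linear_on_subspace_diff[OF linear subspace] linear_on_subspace_add[OF linear]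
      linear_on_subspace_scaleR[OF linear])

text \<open>Otherwise there would be times \<open>t n\<close> tending to 0 with unbounded operator
  norms; but right continuity makes every \<open>T (t n) y\<close> convergent, hence bounded,
  against uniform boundedness.\<close>

lemma bounded_near_0: "\<exists>d>0. \<exists>K. \<forall>t\<in>{0..d}. \<forall>x\<in>Z. norm (T t x) \<le> K * norm x"
proof (rule ccontr)
  assume "\<not> ?thesis"
  then have "\<exists>t\<in>{0..1 / real (Suc n)}. \<exists>x\<in>Z. norm (T t x) > real (Suc n) * norm x" for n
    by (metis divide_pos_pos not_le of_nat_0_less_iff zero_less_Suc zero_less_one)
  then obtain t x where tx: "\<And>n. t n \<in> {0..1 / real (Suc n)}" "\<And>n. x n \<in> Z"
      "\<And>n. norm (T (t n) (x n)) > real (Suc n) * norm (x n)"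
    by metis
  \<comment> \<open>Right continuity is a limit along \<open>at_right 0\<close>, so time 0 has to be
    excluded. There \<open>T\<close> is the identity and the strict inequality with factor
    \<open>Suc n\<close> fails.\<close>
  have pos: "t n > 0" for n
  proof (rule ccontr)
    assume "\<not> t n > 0"
    then have "t n = 0" using tx(1)[of n] by auto
    then have "real (Suc n) * norm (x n) < norm (x n)" using tx(3)[of n] tx(2)[of n] by (simp add: T_zero)
    moreover have "1 * norm (x n) \<le> real (Suc n) * norm (x n)" by (intro mult_right_mono) auto
    ultimately show False by simp
  qed
  have "t \<longlonglongrightarrow> 0"
  proof (rule tendsto_sandwich[of "\<lambda>_. 0" _ _ "\<lambda>n. 1 / real (Suc n)"])
    show "(\<lambda>n. 1 / real (Suc n)) \<longlonglongrightarrow> 0"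
      using LIMSEQ_inverse_real_of_nat by (simp add: inverse_eq_divide)
  qed (use tx(1) in auto)
  then have lim: "filterlim t (at_right 0) sequentially"
    using pos by (auto simp: filterlim_at intro!: always_eventually simp: less_imp_neq[THEN not_sym])
  have "\<exists>K. \<forall>n. \<forall>x\<in>Z. norm (T (t n) x) \<le> K * norm x"
  proof (rule uniform_boundedness_on_subspace[OF subspace closed])
    fix y assume "y \<in> Z"
    then have "(\<lambda>n. T (t n) y) \<longlonglongrightarrow> y"
      using filterlim_compose[OF right_continuous lim] by blast
    then show "\<exists>C. \<forall>n. norm (T (t n) y) \<le> C"
      by (meson BseqE convergentI convergent_imp_Bseq)
  qed (use pos in \<open>auto intro!: linear bounded intro: less_imp_le\<close>)
  then obtain K where K: "\<And>n y. y \<in> Z \<Longrightarrow> norm (T (t n) y) \<le> K * norm y" by blast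
  obtain n where n: "K \<le> real n" using real_arch_simple by blast
  have "K * norm (x n) \<le> real (Suc n) * norm (x n)"
    using n by (intro mult_right_mono) auto
  then show False using K[OF tx(2), of n n] tx(3)[of n] by simp
qed

lemma bounded_on_compact: "\<exists>K\<ge>0. \<forall>t\<in>{0..a}. \<forall>x\<in>Z. norm (T t x) \<le> K * norm x"
proof -
  obtain d K where d: "d > 0" and K: "\<And>t x. t \<in> {0..d} \<Longrightarrow> x \<in> Z \<Longrightarrow> norm (T t x) \<le> K * norm x"
    using bounded_near_0 by blast
  have "\<exists>K\<ge>0. \<forall>t\<in>{0..real n * d}. \<forall>x\<in>Z. norm (T t x) \<le> K * norm x" for n
  proof (induction n)
    case 0
    show ?case by (rule exI[of _ 1]) (auto simp: T_zero)
  next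
    case (Suc n)
    then obtain K' where K': "K' \<ge> 0" "\<And>t x. t \<in> {0..real n * d} \<Longrightarrow> x \<in> Z \<Longrightarrow> norm (T t x) \<le> K' * norm x"
      by blast
    have "norm (T t x) \<le> (K' + K' * \<bar>K\<bar>) * norm x" if t: "t \<in> {0..real (Suc n) * d}" and x: "x \<in> Z" for t x
    proof (cases "t \<le> real n * d")
      case True
      with t x have "norm (T t x) \<le> K' * norm x" by (intro K') auto
      moreover have "K' * norm x \<le> (K' + K' * \<bar>K\<bar>) * norm x"
        using K'(1) by (intro mult_right_mono) auto
      ultimately show ?thesis by simp
    next
      case False
      let ?s = "t - real n * d"
      have s: "?s \<in> {0..d}" "real n * d \<ge> 0" using False t d by (auto simp: algebra_simps)
      have "norm (T t x) = norm (T (real n * d) (T ?s x))"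
        using T_plus[of "real n * d" ?s x] s x by simp
      also have "\<dots> \<le> K' * norm (T ?s x)"
        using s x by (intro K') (auto intro: in_Z)
      also have "\<dots> \<le> K' * (\<bar>K\<bar> * norm x)"
        using order_trans[OF K[OF s(1) x] mult_right_mono[OF abs_ge_self norm_ge_zero]] K'(1)
        by (intro mult_left_mono)
      also have "\<dots> \<le> (K' + K' * \<bar>K\<bar>) * norm x"
        using K'(1) by (simp add: algebra_simps)
      finally show ?thesis .
    qed
    moreover have "K' + K' * \<bar>K\<bar> \<ge> 0" using K'(1) by simp
    ultimately show ?case by blast
  qed
  moreover obtain n where "a \<le> real n * d"
    using reals_Archimedean3[OF d] by (meson less_imp_le)
  ultimately show ?thesis by (meson atLeastAtMost_iff order_trans)
qed

text \<open>For \<open>a \<le> b\<close> the increment is \<open>T a (T (b - a) x - x)\<close>. Thus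
  both one-sided limits reduce to right continuity at 0 and a bound on \<open>T a\<close> that is
  uniform over \<open>{0..t+1}\<close>.\<close>

lemma continuous:
  assumes x: "x \<in> Z"
  shows "continuous_on {0..} (\<lambda>t. T t x)"
proof (rule continuous_onI)
  fix t e :: real assume t: "t \<in> {0..}" and e: "e > 0"
  obtain K where K: "K \<ge> 0" "\<And>s y. s \<in> {0..t+1} \<Longrightarrow> y \<in> Z \<Longrightarrow> norm (T s y) \<le> K * norm y"
    using bounded_on_compact by blast
  have "e / (K + 1) > 0" using e K by simp
  then obtain d where d: "d > 0" "\<And>h. 0 < h \<Longrightarrow> h < d \<Longrightarrow> dist (T h x) x < e / (K + 1)"
    using right_continuous[OF x] unfolding tendsto_iff eventually_at_right_field by auto
  have main: "norm (T b x - T a x) \<le> e" if "0 \<le> a" "a \<le> b" "b \<le> t + 1" "b - a < d" for a b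
  proof (cases "a = b")
    case False
    then have "T b x - T a x = T a (T (b - a) x - x)"
      using T_plus[of a "b - a" x] that x by (simp add: T_diff in_Z)
    then have "norm (T b x - T a x) \<le> K * norm (T (b - a) x - x)"
      using that x by (auto intro!: K simp: in_Z subspace_diff[OF subspace])
    also have "\<dots> \<le> K * (e / (K + 1))"
      using d(2)[of "b - a"] False that K by (intro mult_left_mono) (auto simp: dist_norm)
    also have "\<dots> \<le> e" using K e by (simp add: field_simps)
    finally show ?thesis .
  qed (use e in simp)
  have "norm (T s x - T t x) \<le> e" if "s \<in> {0..}" "dist s t < min d 1" for s
  proof (cases "s \<le> t")
    case True
    then have "norm (T t x - T s x) \<le> e"
      using that by (intro main) (auto simp: dist_real_def)
    then show ?thesis by (simp add: norm_minus_commute)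
  next
    case False
    then show ?thesis
      using that t by (intro main) (auto simp: dist_real_def)
  qed
  then show "\<exists>d>0. \<forall>s\<in>{0..}. dist s t < d \<longrightarrow> dist (T s x) (T t x) \<le> e"
    using d(1) by (intro exI[of _ "min d 1"]) (auto simp: dist_norm)
qed

end

lemma has_vector_derivative_iff_quotient:
  fixes f :: "real \<Rightarrow> 'a::real_normed_vector"
  shows "(f has_vector_derivative D) (at t within S) \<longleftrightarrow>
    ((\<lambda>s. (1 / (s - t)) *\<^sub>R (f s - f t)) \<longlongrightarrow> D) (at t within S)"
proof -
  have "norm (f s - f t - (s - t) *\<^sub>R D) / norm (s - t) = norm ((1 / (s - t)) *\<^sub>R (f s - f t) - D)"
    if "s \<noteq> t" for s
  proof -
    have "(1 / (s - t)) *\<^sub>R (f s - f t) - D = (1 / (s - t)) *\<^sub>R (f s - f t - (s - t) *\<^sub>R D)"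
      using that by (simp add: scaleR_diff_right)
    then show ?thesis by simp
  qed
  then have "((\<lambda>s. norm (f s - f t - (s - t) *\<^sub>R D) / norm (s - t)) \<longlongrightarrow> 0) (at t within S) \<longleftrightarrow>
      ((\<lambda>s. norm ((1 / (s - t)) *\<^sub>R (f s - f t) - D)) \<longlongrightarrow> 0) (at t within S)"
    by (intro filterlim_cong refl) (auto simp: eventually_at_filter)
  then show ?thesis
    by (simp add: has_vector_derivative_def has_derivative_iff_norm bounded_linear_scaleR_left
        tendsto_norm_zero_iff LIM_zero_iff)
qed

section \<open>The generator: a dense, closed and invariant graph\<close>

context c0_semigroup
begin

abbreviation "gen \<equiv> generator_on Z T"

lemma genD:
  assumes "(x, y) \<in> gen"
  shows "x \<in> Z" "y \<in> Z" "((\<lambda>h. (1 / h) *\<^sub>R (T h x - x)) \<longlongrightarrow> y) (at_right 0)"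
  using assms by (auto simp: generator_on_def)

lemma gen_unique: "(x, y) \<in> gen \<Longrightarrow> (x, y') \<in> gen \<Longrightarrow> y = y'"
  by (rule tendsto_unique[OF _ genD(3) genD(3)]) auto

lemma subspace_gen: "subspace gen"
proof (rule subspaceI)
  show "0 \<in> gen"
    using linear_on_subspace_scaleR[OF linear, of _ 0 0] subspace_0[OF subspace]
    by (auto simp: generator_on_def zero_prod_def subspace_0[OF subspace] eventually_at_right_field
        intro!: tendsto_eventually exI[of _ 1])
next
  fix p q assume "p \<in> gen" "q \<in> gen"
  then obtain x y x' y' where eq: "p = (x, y)" "q = (x', y')" and xy: "(x, y) \<in> gen" "(x', y') \<in> gen"
    by (cases p, cases q) auto
  note Z = genD(1,2)[OF xy(1)] genD(1,2)[OF xy(2)]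
  have "((\<lambda>h. (1 / h) *\<^sub>R (T h (x + x') - (x + x'))) \<longlongrightarrow> y + y') (at_right 0)"
  proof (rule Lim_transform_eventually[OF tendsto_add[OF genD(3)[OF xy(1)] genD(3)[OF xy(2)]]])
    show "\<forall>\<^sub>F h in at_right 0. (1 / h) *\<^sub>R (T h x - x) + (1 / h) *\<^sub>R (T h x' - x')
        = (1 / h) *\<^sub>R (T h (x + x') - (x + x'))"
      using eventually_at_right_less[of "0::real"]
      by eventually_elim (use Z in \<open>simp add: T_add algebra_simps\<close>)
  qed
  then show "p + q \<in> gen"
    using Z by (auto simp: generator_on_def eq subspace_add[OF subspace])
next
  fix c p assume "p \<in> gen"
  then obtain x y where eq: "p = (x, y)" and xy: "(x, y) \<in> gen" by (cases p) auto
  note Z = genD(1,2)[OF xy]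
  have "((\<lambda>h. (1 / h) *\<^sub>R (T h (c *\<^sub>R x) - c *\<^sub>R x)) \<longlongrightarrow> c *\<^sub>R y) (at_right 0)"
  proof (rule Lim_transform_eventually[OF tendsto_scaleR[OF tendsto_const genD(3)[OF xy]]])
    show "\<forall>\<^sub>F h in at_right 0. c *\<^sub>R ((1 / h) *\<^sub>R (T h x - x))
        = (1 / h) *\<^sub>R (T h (c *\<^sub>R x) - c *\<^sub>R x)"
      using eventually_at_right_less[of "0::real"]
      by eventually_elim (use Z in \<open>simp add: T_scaleR algebra_simps\<close>)
  qed
  then show "c *\<^sub>R p \<in> gen"
    using Z by (auto simp: generator_on_def eq subspace_scale[OF subspace])
qed

text \<open>\<open>T t\<close> commutes with \<open>T h\<close>, hence with the difference
  quotients, and being bounded it passes through their limit.\<close>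

lemma gen_invariant:
  assumes xy: "(x, y) \<in> gen" and t: "t \<ge> 0"
  shows "(T t x, T t y) \<in> gen"
proof -
  note Z = genD(1,2)[OF xy]
  obtain K where K: "\<And>x. x \<in> Z \<Longrightarrow> norm (T t x) \<le> K * norm x"
    using bounded[OF t] by blast
  have "((\<lambda>h. (1 / h) *\<^sub>R (T h (T t x) - T t x)) \<longlongrightarrow> T t y) (at_right 0)"
  proof (rule LIM_zero_cancel, rule Lim_null_comparison)
    show "\<forall>\<^sub>F h in at_right 0. norm ((1 / h) *\<^sub>R (T h (T t x) - T t x) - T t y)
        \<le> K * norm ((1 / h) *\<^sub>R (T h x - x) - y)"
      using eventually_at_right_less[of "0::real"]
    proof eventually_elim
      case (elim h)
      have "T h (T t x) = T t (T h x)"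
        using T_plus[of h t x] T_plus[of t h x] elim t Z by (simp add: add.commute)
      then have "(1 / h) *\<^sub>R (T h (T t x) - T t x) - T t y = T t ((1 / h) *\<^sub>R (T h x - x) - y)"
        using elim t Z
        by (simp add: T_diff T_scaleR in_Z subspace_diff[OF subspace] subspace_scale[OF subspace])
      then show ?case
        using elim t Z
        by (simp add: K in_Z subspace_diff[OF subspace] subspace_scale[OF subspace])
    qed
    show "((\<lambda>h. K * norm ((1 / h) *\<^sub>R (T h x - x) - y)) \<longlongrightarrow> 0) (at_right 0)"
      by (intro tendsto_mult_right_zero tendsto_norm_zero LIM_zero genD(3)[OF xy])
  qed
  then show ?thesis using Z t by (auto simp: generator_on_def in_Z)
qed

text \<open>The generator provides only a right derivative at 0. For a left quotient the operator
  pulled out is \<open>T s\<close>, which varies with \<open>s < t\<close>; the remainder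
  \<open>q\<close> is then handled by a bound uniform on \<open>{0..t}\<close>, and the main term by
  continuity of the orbit of \<open>y\<close>.\<close>

lemma has_vector_derivative_T:
  assumes xy: "(x, y) \<in> gen" and t: "t \<ge> 0"
  shows "((\<lambda>t. T t x) has_vector_derivative T t y) (at t within {0..})"
proof -
  note Z = genD(1,2)[OF xy]
  obtain K where K: "K \<ge> 0" "\<And>s z. s \<in> {0..t} \<Longrightarrow> z \<in> Z \<Longrightarrow> norm (T s z) \<le> K * norm z"
    using bounded_on_compact by blast
  define q where "q h = (1 / h) *\<^sub>R (T h x - x) - y" for h
  have q: "(q \<longlongrightarrow> 0) (at_right 0)" unfolding q_def by (intro LIM_zero genD(3)[OF xy])
  have qZ: "q h \<in> Z" if "h > 0" for h
    using that Z by (simp add: q_def in_Z subspace_diff[OF subspace] subspace_scale[OF subspace])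
  have cont: "((\<lambda>s. T s y) \<longlongrightarrow> T t y) (at t within {0..})"
    using continuous[OF Z(2)] t by (auto simp: continuous_on_def)
  have bound: "norm ((1 / (s - t)) *\<^sub>R (T s x - T t x) - T t y) \<le> K * norm (q \<bar>s - t\<bar>) + norm (T s y - T t y)"
    if "s \<ge> 0" "s \<noteq> t" for s
  proof (cases "s > t")
    case True
    have "(1 / (s - t)) *\<^sub>R (T s x - T t x) - T t y = T t (q (s - t))"
      using T_plus[of t "s - t" x] True t Z
      by (simp add: q_def T_diff T_scaleR in_Z subspace_diff[OF subspace] subspace_scale[OF subspace])
    moreover have "norm (T t (q (s - t))) \<le> K * norm (q (s - t))"
      using True t by (intro K qZ) auto
    ultimately show ?thesis using True by (simp add: add_increasing2)
  next
    case False
    then have less: "s < t" using that by simp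
    have "(1 / (s - t)) *\<^sub>R (T s x - T t x) - T s y = T s (q (t - s))"
    proof -
      have "T s (q (t - s)) = (1 / (t - s)) *\<^sub>R (T t x - T s x) - T s y"
        using T_plus[of s "t - s" x] less that Z
        by (simp add: q_def T_diff T_scaleR in_Z subspace_diff[OF subspace] subspace_scale[OF subspace])
      also have "(1 / (t - s)) *\<^sub>R (T t x - T s x) = (1 / (s - t)) *\<^sub>R (T s x - T t x)"
        using scaleR_minus_left[of "1 / (s - t)" "T t x - T s x"]
        by (simp add: minus_divide_right flip: scaleR_minus_right)
      finally show ?thesis by simp
    qed
    moreover have "norm (T s (q (t - s))) \<le> K * norm (q (t - s))"
      using less that by (intro K qZ) auto
    ultimately have "norm ((1 / (s - t)) *\<^sub>R (T s x - T t x) - T s y) \<le> K * norm (q \<bar>s - t\<bar>)"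
      using less by simp
    then show ?thesis
      using norm_triangle_ineq[of "(1 / (s - t)) *\<^sub>R (T s x - T t x) - T s y" "T s y - T t y"] by simp
  qed
  have "((\<lambda>s. (1 / (s - t)) *\<^sub>R (T s x - T t x)) \<longlongrightarrow> T t y) (at t within {0..})"
  proof (rule LIM_zero_cancel, rule Lim_null_comparison)
    show "\<forall>\<^sub>F s in at t within {0..}. norm ((1 / (s - t)) *\<^sub>R (T s x - T t x) - T t y)
        \<le> K * norm (q \<bar>s - t\<bar>) + norm (T s y - T t y)"
      unfolding eventually_at_filter by (intro always_eventually allI impI bound) auto
    have "filterlim (\<lambda>s. \<bar>s - t\<bar>) (at_right 0) (at t within {0..})"
      unfolding filterlim_at
    proof
      show "\<forall>\<^sub>F s in at t within {0..}. \<bar>s - t\<bar> \<in> {0<..} \<and> \<bar>s - t\<bar> \<noteq> 0"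
        unfolding eventually_at_filter by (intro always_eventually) auto
      show "((\<lambda>s. \<bar>s - t\<bar>) \<longlongrightarrow> 0) (at t within {0..})"
        by (auto intro!: tendsto_eq_intros)
    qed
    then have "((\<lambda>s. q \<bar>s - t\<bar>) \<longlongrightarrow> 0) (at t within {0..})"
      by (rule filterlim_compose[OF q])
    then show "((\<lambda>s. K * norm (q \<bar>s - t\<bar>) + norm (T s y - T t y)) \<longlongrightarrow> 0) (at t within {0..})"
      by (intro tendsto_add_zero tendsto_mult_right_zero tendsto_norm_zero LIM_zero cont)
  qed
  then show ?thesis
    by (simp add: has_vector_derivative_iff_quotient)
qed

lemma T_eq_integral:
  assumes xy: "(x, y) \<in> gen" and t: "t \<ge> 0"
  shows "((\<lambda>s. T s y) has_integral T t x - x) {0..t}"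
proof -
  have "((\<lambda>s. T s y) has_integral T t x - T 0 x) {0..t}"
    using t
    by (intro fundamental_theorem_of_calculus has_vector_derivative_within_subset[OF has_vector_derivative_T[OF xy]]) auto
  then show ?thesis using genD(1)[OF xy] by (simp add: T_zero)
qed

lemma continuous_on_T: "x \<in> Z \<Longrightarrow> a \<ge> 0 \<Longrightarrow> continuous_on {a..b} (\<lambda>t. T t x)"
  by (rule continuous_on_subset[OF continuous]) auto

lemma integral_has_derivative_T:
  assumes x: "x \<in> Z" and t: "t \<ge> 0"
  shows "((\<lambda>h. (1 / h) *\<^sub>R (integral {0..t + h} (\<lambda>s. T s x) - integral {0..t} (\<lambda>s. T s x))) \<longlongrightarrow> T t x) (at_right 0)"
proof -
  have "((\<lambda>u. integral {0..u} (\<lambda>s. T s x)) has_vector_derivative T t x) (at t within {0..t+1})"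
    using t by (intro integral_has_vector_derivative continuous_on_T x) auto
  then have "((\<lambda>u. (1 / (u - t)) *\<^sub>R (integral {0..u} (\<lambda>s. T s x) - integral {0..t} (\<lambda>s. T s x))) \<longlongrightarrow> T t x)
      (at t within {0..t+1})"
    by (simp add: has_vector_derivative_iff_quotient)
  moreover have "filterlim (\<lambda>h. t + h) (at t within {0..t+1}) (at_right 0)"
    unfolding filterlim_at
  proof
    show "\<forall>\<^sub>F h in at_right 0. t + h \<in> {0..t + 1} \<and> t + h \<noteq> t"
      using t by (auto simp: eventually_at_right_field intro!: exI[of _ 1])
    show "((\<lambda>h. t + h) \<longlongrightarrow> t) (at_right 0)"
      by (auto intro!: tendsto_eq_intros)
  qed
  ultimately show ?thesis
    using filterlim_compose by fastforce
qed

text \<open>Applying \<open>T h\<close> shifts the window of integration by \<open>h\<close>. After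
  cancellation the difference quotient is the mean of the orbit over \<open>{d..d + h}\<close> minus
  that over \<open>{0..h}\<close>, which tends to \<open>T d x - x\<close>.\<close>

lemma integral_in_gen:
  assumes x: "x \<in> Z" and d: "d > 0"
  shows "(integral {0..d} (\<lambda>s. T s x), T d x - x) \<in> gen"
proof -
  define I where "I u = integral {0..u} (\<lambda>s. T s x)" for u
  \<comment> \<open>Off \<open>{0..}\<close>, \<open>T\<close> is arbitrary, so \<open>s\<close> is truncated to have an integrand with values in \<open>Z\<close>.\<close>
  define g where "g s = T (max 0 s) x" for s
  have gZ: "g s \<in> Z" for s using x by (simp add: g_def in_Z)
  have int: "((\<lambda>s. T s x) has_integral I b - I a) {a..b}" if "0 \<le> a" "a \<le> b" for a b
  proof -
    have "(\<lambda>s. T s x) integrable_on {0..b}"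
      by (intro integrable_continuous_real continuous_on_T x) auto
    from Henstock_Kurzweil_Integration.integral_combine[OF that this] have "integral {a..b} (\<lambda>s. T s x) = I b - I a"
      by (simp add: I_def algebra_simps)
    moreover have "(\<lambda>s. T s x) integrable_on {a..b}"
      using that by (intro integrable_continuous_real continuous_on_T x) auto
    ultimately show ?thesis using integrable_integral by metis
  qed
  have I: "(g has_integral I d) {0..d}"
    using int[of 0 d] d by (subst has_integral_cong[where g="\<lambda>s. T s x"]) (auto simp: g_def I_def)
  have IZ: "I d \<in> Z"
    by (rule has_integral_linear_on_subspace(1)[OF I subspace closed gZ, of "\<lambda>x. x" 1])
       (auto simp: linear_on_subspace_def)
  have I0: "I 0 = 0" by (simp add: I_def)
  have T_I: "T h (I d) = I (d + h) - I h" if h: "h > 0" for h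
  proof -
    obtain K where K: "\<And>x. x \<in> Z \<Longrightarrow> norm (T h x) \<le> K * norm x"
      using bounded[of h] h by auto
    have "((\<lambda>s. T h (g s)) has_integral T h (I d)) {0..d}"
      using h by (intro has_integral_linear_on_subspace(2)[OF I subspace closed gZ linear K]) auto
    moreover have "((\<lambda>s. T h (g s)) has_integral I (d + h) - I h) {0..d}"
    proof -
      have "((\<lambda>s. T s x) \<circ> (+) h has_integral I (d + h) - I h) {0..d}"
        using has_integral_shift_cbox_iff[of "\<lambda>s. T s x" h "I (d + h) - I h" 0 d] int[of h "d + h"] h d
        by (simp add: box_real)
      then show ?thesis
        using h x by (subst has_integral_cong[where g="(\<lambda>s. T s x) \<circ> (+) h"]) (auto simp: g_def T_plus)
    qed
    ultimately show ?thesis by (rule has_integral_unique)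
  qed
  have "((\<lambda>h. (1 / h) *\<^sub>R (I (d + h) - I d) - (1 / h) *\<^sub>R (I (0 + h) - I 0)) \<longlongrightarrow> T d x - T 0 x) (at_right 0)"
    unfolding I_def using d x by (intro tendsto_diff integral_has_derivative_T) auto
  from this[unfolded T_zero[OF x]]
  have "((\<lambda>h. (1 / h) *\<^sub>R (T h (I d) - I d)) \<longlongrightarrow> T d x - x) (at_right 0)"
  proof (rule Lim_transform_eventually)
    show "\<forall>\<^sub>F h in at_right 0. (1 / h) *\<^sub>R (I (d + h) - I d) - (1 / h) *\<^sub>R (I (0 + h) - I 0)
        = (1 / h) *\<^sub>R (T h (I d) - I d)"
      using eventually_at_right_less[of "0::real"]
      by eventually_elim (simp add: T_I I0 algebra_simps)
  qed
  then show ?thesis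
    using IZ x d by (auto simp: generator_on_def I_def in_Z subspace_diff[OF subspace])
qed

text \<open>The standard smoothing: the mean lies in the domain, tends to \<open>x\<close> as
  \<open>d\<close> shrinks, and the generator maps it to the difference quotient of the orbit of
  \<open>x\<close>. The first two facts give density, the last one gives
  \<open>Lipschitz_at_0_in_gen\<close>.\<close>

definition orbit_mean :: "real \<Rightarrow> 'a \<Rightarrow> 'a" where
  "orbit_mean d x = (1 / d) *\<^sub>R integral {0..d} (\<lambda>s. T s x)"

lemma orbit_mean_gen: "x \<in> Z \<Longrightarrow> d > 0 \<Longrightarrow> (orbit_mean d x, (1 / d) *\<^sub>R (T d x - x)) \<in> gen"
  using subspace_scale[OF subspace_gen integral_in_gen, of x d "1 / d"] by (simp add: orbit_mean_def)

lemma orbit_mean_tendsto: "x \<in> Z \<Longrightarrow> ((\<lambda>d. orbit_mean d x) \<longlongrightarrow> x) (at_right 0)"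
  using integral_has_derivative_T[of x 0] by (simp add: orbit_mean_def T_zero)

lemma gen_dense:
  assumes "x \<in> Z"
  obtains X Y where "\<And>n::nat. (X n, Y n) \<in> gen" "X \<longlonglongrightarrow> x"
proof
  show "(orbit_mean (1 / real (Suc n)) x, (real (Suc n)) *\<^sub>R (T (1 / real (Suc n)) x - x)) \<in> gen" for n
    using orbit_mean_gen[OF assms, of "1 / real (Suc n)"] by simp
  have "filterlim (\<lambda>n. 1 / real (Suc n)) (at_right 0) sequentially"
    using LIMSEQ_inverse_real_of_nat by (simp add: filterlim_at inverse_eq_divide)
  from filterlim_compose[OF orbit_mean_tendsto[OF assms] this]
  show "(\<lambda>n. orbit_mean (1 / real (Suc n)) x) \<longlonglongrightarrow> x" .
qed

text \<open>The integral identity between \<open>T t x - x\<close> and the orbit of \<open>y\<close>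
  is stable under norm limits of \<open>(x, y)\<close>, unlike the limit that defines the generator;
  differentiating the identity at 0 recovers membership.\<close>

lemma closed_gen: "closed gen"
  unfolding closed_sequential_limits
proof (intro allI impI, elim conjE)
  fix p l assume p: "\<forall>n. p n \<in> gen" and lim: "p \<longlonglongrightarrow> l"
  define x y where "x n = fst (p n)" and "y n = snd (p n)" for n
  have xy: "(x n, y n) \<in> gen" for n using p by (simp add: x_def y_def)
  have x: "x \<longlonglongrightarrow> fst l" and y: "y \<longlonglongrightarrow> snd l"
    unfolding x_def y_def by (intro tendsto_intros lim)+
  have Z: "fst l \<in> Z" "snd l \<in> Z"
    using Lim_in_closed_set[OF closed _ _ x] Lim_in_closed_set[OF closed _ _ y] genD(1,2)[OF xy] by auto
  have eq: "((\<lambda>s. T s (snd l)) has_integral T t (fst l) - fst l) {0..t}" if t: "t \<ge> 0" for t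
  proof -
    obtain K where K: "K \<ge> 0" "\<And>s z. s \<in> {0..t} \<Longrightarrow> z \<in> Z \<Longrightarrow> norm (T s z) \<le> K * norm z"
      using bounded_on_compact by blast
    have ii: "(\<lambda>s. T s (snd l)) integrable_on {0..t}"
      by (intro integrable_continuous_real continuous_on_T Z) auto
    then obtain J where J: "((\<lambda>s. T s (snd l)) has_integral J) {0..t}" by blast
    have "norm ((T t (x n) - x n) - J) \<le> (K * norm (y n - snd l)) * t" for n
    proof -
      have "((\<lambda>s. T s (y n) - T s (snd l)) has_integral (T t (x n) - x n) - J) (cbox 0 t)"
        using has_integral_diff[OF T_eq_integral[OF xy t, of n] J] by (simp add: box_real)
      from has_integral_bound[OF _ this, of "K * norm (y n - snd l)"] show ?thesis
        using t K genD(2)[OF xy, of n] Z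
        by (auto simp: subspace_diff[OF subspace] simp flip: T_diff)
    qed
    moreover have "(\<lambda>n. (K * norm (y n - snd l)) * t) \<longlonglongrightarrow> 0"
      by (intro tendsto_mult_left_zero tendsto_mult_right_zero tendsto_norm_zero LIM_zero y)
    ultimately have "(\<lambda>n. (T t (x n) - x n) - J) \<longlonglongrightarrow> 0"
      by (intro Lim_null_comparison[of "\<lambda>n. (T t (x n) - x n) - J"]) auto
    then have "(\<lambda>n. T t (x n) - x n) \<longlonglongrightarrow> J" by (rule LIM_zero_cancel)
    moreover have "(\<lambda>n. T t (x n)) \<longlonglongrightarrow> T t (fst l)"
    proof (rule LIM_zero_cancel, rule Lim_null_comparison)
      show "\<forall>\<^sub>F n in sequentially. norm (T t (x n) - T t (fst l)) \<le> K * norm (x n - fst l)"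
        using t K genD(1)[OF xy] Z by (auto simp: subspace_diff[OF subspace] simp flip: T_diff)
      show "(\<lambda>n. K * norm (x n - fst l)) \<longlonglongrightarrow> 0"
        by (intro tendsto_mult_right_zero tendsto_norm_zero LIM_zero x)
    qed
    then have "(\<lambda>n. T t (x n) - x n) \<longlonglongrightarrow> T t (fst l) - fst l"
      by (intro tendsto_diff x)
    ultimately have "J = T t (fst l) - fst l" by (rule LIMSEQ_unique)
    with J show ?thesis by simp
  qed
  have "((\<lambda>h. (1 / h) *\<^sub>R (integral {0..0 + h} (\<lambda>s. T s (snd l)) - integral {0..0} (\<lambda>s. T s (snd l)))) \<longlongrightarrow> T 0 (snd l)) (at_right 0)"
    by (intro integral_has_derivative_T Z) auto
  from this[unfolded T_zero[OF Z(2)]]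
  have "((\<lambda>h. (1 / h) *\<^sub>R (T h (fst l) - fst l)) \<longlongrightarrow> snd l) (at_right 0)"
  proof (rule Lim_transform_eventually)
    show "\<forall>\<^sub>F h in at_right 0. (1 / h) *\<^sub>R (integral {0..0 + h} (\<lambda>s. T s (snd l)) - integral {0..0} (\<lambda>s. T s (snd l)))
        = (1 / h) *\<^sub>R (T h (fst l) - fst l)"
      using eventually_at_right_less[of "0::real"]
      by eventually_elim (use integral_unique[OF eq] in simp)
  qed
  then show "l \<in> gen" using Z by (cases l) (auto simp: generator_on_def)
qed

end

section \<open>Closed graphs and bounded sequences in a Hilbert space\<close>

lemma norm_diff_square_le_of_midpoint:
  fixes x y :: "'a::real_inner"
  assumes "norm x \<le> a" "norm y \<le> a" "b \<le> norm ((1/2) *\<^sub>R (x + y))" "0 \<le> b"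
  shows "(norm (x - y))\<^sup>2 \<le> 4 * (a\<^sup>2 - b\<^sup>2)"
proof -
  have "(norm (x - y))\<^sup>2 = 2 * (norm x)\<^sup>2 + 2 * (norm y)\<^sup>2 - (norm (x + y))\<^sup>2"
    by (simp add: power2_norm_eq_inner inner_add inner_diff inner_commute)
  moreover have "(norm x)\<^sup>2 \<le> a\<^sup>2" "(norm y)\<^sup>2 \<le> a\<^sup>2" using assms by (auto intro: power_mono)
  moreover have "b\<^sup>2 \<le> (norm ((1/2) *\<^sub>R (x + y)))\<^sup>2" using assms by (intro power_mono) auto
  ultimately show ?thesis by (simp add: power_divide)
qed

text \<open>
  A substitute for weak compactness: elements of nearly minimal norm in the convex hulls of the
  tails form a Cauchy sequence, by the parallelogram law.
\<close>

lemma bounded_limit_in_closed_graph: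
  fixes G :: "('a::real_normed_vector \<times> 'b::{banach, real_inner}) set"
  assumes G: "subspace G" "closed G" and mem: "\<And>n::nat. (X n, Y n) \<in> G"
    and X: "X \<longlonglongrightarrow> x" and Y: "\<And>n. norm (Y n) \<le> K"
  shows "\<exists>y. (x, y) \<in> G \<and> norm y \<le> K"
proof -
  define C where "C n = convex hull ((\<lambda>k. (X k, Y k)) ` {n..})" for n
  have C_G: "C n \<subseteq> G" for n
    unfolding C_def using mem by (intro hull_minimal subspace_imp_convex G) auto
  have C_K: "norm (snd p) \<le> K" if "p \<in> C n" for p n
  proof -
    have "C n \<subseteq> UNIV \<times> cball 0 K"
      unfolding C_def using Y by (intro hull_minimal convex_Times convex_UNIV convex_cball) auto
    then show ?thesis using that by (auto simp: mem_Times_iff)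
  qed
  have C_antimono: "C m \<subseteq> C n" if "n \<le> m" for n m
    unfolding C_def using that by (intro hull_mono image_mono) auto
  have C_ne: "C n \<noteq> {}" for n by (auto simp: C_def)
  define m where "m n = Inf ((\<lambda>p. norm (snd p)) ` C n)" for n
  have bb: "bdd_below ((\<lambda>p. norm (snd p)) ` C n)" for n by (intro bdd_belowI2[of _ 0]) auto
  have m_le: "m n \<le> norm (snd p)" if "p \<in> C n" for p n
    unfolding m_def using that bb by (intro cINF_lower)
  have m_nonneg: "0 \<le> m n" for n unfolding m_def using C_ne by (intro cINF_greatest) auto
  have m_K: "m n \<le> K" for n using m_le C_K C_ne[of n] by (meson ex_in_conv order_trans)
  have m_mono: "incseq m"
    unfolding m_def by (intro monoI cINF_superset_mono C_ne bb C_antimono) auto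
  obtain L where L: "m \<longlonglongrightarrow> L" "\<And>n. m n \<le> L"
    using incseq_convergent[OF m_mono, of K] m_K by auto
  have "\<exists>p\<in>C n. norm (snd p) < m n + 1 / real (Suc n)" for n
    using cInf_lessD[of "(\<lambda>p. norm (snd p)) ` C n" "m n + 1 / real (Suc n)"] C_ne[of n]
    by (auto simp: m_def)
  then obtain p where p: "\<And>n. p n \<in> C n" "\<And>n. norm (snd (p n)) < m n + 1 / real (Suc n)"
    by metis
  \<comment> \<open>For \<open>n \<le> k\<close> both \<open>p n\<close> and \<open>p k\<close> lie
    in \<open>C n\<close> and have second components of norm at most
    \<open>L + 1 / real (Suc n)\<close>, while that of their midpoint, again in \<open>C n\<close>,
    has norm at least \<open>m n\<close>. So \<open>e n\<close> is the parallelogram bound, and it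
    vanishes in the limit because \<open>m\<close> tends to \<open>L\<close>.\<close>
  define e where "e n = 4 * ((L + 1 / real (Suc n))\<^sup>2 - (m n)\<^sup>2)" for n
  have e: "e \<longlonglongrightarrow> 0"
    unfolding e_def
    by (rule tendsto_eq_rhs, (rule tendsto_intros L LIMSEQ_inverse_real_of_nat[unfolded inverse_eq_divide])+) simp
  have close: "(norm (snd (p n) - snd (p k)))\<^sup>2 \<le> e n" if "n \<le> k" for n k
    unfolding e_def
  proof (rule norm_diff_square_le_of_midpoint)
    show "norm (snd (p n)) \<le> L + 1 / real (Suc n)" using p(2)[of n] L(2)[of n] by simp
    have "1 / real (Suc k) \<le> 1 / real (Suc n)" using that by (simp add: frac_le)
    then show "norm (snd (p k)) \<le> L + 1 / real (Suc n)" using p(2)[of k] L(2)[of k] by linarith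
    have "(1/2) *\<^sub>R p n + (1/2) *\<^sub>R p k \<in> C n"
      using p(1)[of n] p(1)[of k] C_antimono[OF that]
      by (intro convexD) (auto simp: C_def convex_convex_hull)
    from m_le[OF this] show "m n \<le> norm ((1/2) *\<^sub>R (snd (p n) + snd (p k)))"
      by (simp add: scaleR_add_right)
  qed (rule m_nonneg)
  have "Cauchy (\<lambda>n. snd (p n))"
  proof (rule CauchyI')
    fix r :: real assume r: "r > 0"
    then have "\<forall>\<^sub>F n in sequentially. e n < r\<^sup>2"
      by (intro order_tendstoD(2)[OF e]) auto
    then obtain N where N: "\<And>n. n \<ge> N \<Longrightarrow> e n < r\<^sup>2" by (auto simp: eventually_sequentially)
    have "norm (snd (p n) - snd (p k)) < r" if "n \<ge> N" "n < k" for n k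
      using close[of n k] N[OF that(1)] that r by (intro power2_less_imp_less[of _ r]) auto
    then show "\<exists>M. \<forall>m\<ge>M. \<forall>n>m. dist (snd (p m)) (snd (p n)) < r"
      by (auto simp: dist_norm)
  qed
  then obtain y where y: "(\<lambda>n. snd (p n)) \<longlonglongrightarrow> y"
    by (auto simp: Cauchy_convergent_iff convergent_def)
  \<comment> \<open>Balls are convex, so convex combinations of a tail of \<open>X\<close> stay in
    every ball around \<open>x\<close> that contains the tail.\<close>
  have "(\<lambda>n. fst (p n)) \<longlonglongrightarrow> x"
  proof (rule LIMSEQ_I)
    fix r :: real assume r: "r > 0"
    then obtain N where N: "\<And>n. n \<ge> N \<Longrightarrow> norm (X n - x) < r" using LIMSEQ_D[OF X] by blast
    have "norm (fst (p n) - x) < r" if "n \<ge> N" for n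
    proof -
      have "C n \<subseteq> ball x r \<times> UNIV"
        unfolding C_def using N that
        by (intro hull_minimal convex_Times convex_UNIV convex_ball) (auto simp: dist_norm norm_minus_commute)
      then show ?thesis using p(1)[of n] by (auto simp: mem_Times_iff dist_norm norm_minus_commute)
    qed
    then show "\<exists>N. \<forall>n\<ge>N. norm (fst (p n) - x) < r" by blast
  qed
  from tendsto_Pair[OF this y] have "p \<longlonglongrightarrow> (x, y)" by simp
  then have "(x, y) \<in> G" using closed_sequentially[OF G(2)] p(1) C_G by blast
  moreover have "norm y \<le> K"
    using C_K[OF p(1)] by (intro LIMSEQ_le_const2[OF tendsto_norm[OF y]] exI[of _ 0]) auto
  ultimately show ?thesis by blast
qed

locale hilbert_c0_semigroup = c0_semigroup Z T
  for Z :: "'a::{banach, real_inner} set" and T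
begin

text \<open>Along orbit means converging to \<open>x\<close> the generator takes the values of the
  difference quotients, which \<open>lip\<close> bounds by \<open>K\<close>; in a Hilbert space
  bounded images suffice to stay in a closed graph. In a non-reflexive space this conclusion can
  fail.\<close>

lemma Lipschitz_at_0_in_gen:
  assumes x: "x \<in> Z" and lip: "\<And>d. 0 < d \<Longrightarrow> d \<le> 1 \<Longrightarrow> norm (T d x - x) \<le> K * d"
  shows "\<exists>y. (x, y) \<in> gen \<and> norm y \<le> K"
proof (rule bounded_limit_in_closed_graph[OF subspace_gen closed_gen])
  let ?d = "\<lambda>n. 1 / real (Suc n)"
  show "(orbit_mean (?d n) x, (1 / ?d n) *\<^sub>R (T (?d n) x - x)) \<in> gen" for n
    by (intro orbit_mean_gen x) simp
  have "filterlim ?d (at_right 0) sequentially"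
    using LIMSEQ_inverse_real_of_nat by (simp add: filterlim_at inverse_eq_divide)
  from filterlim_compose[OF orbit_mean_tendsto[OF x] this]
  show "(\<lambda>n. orbit_mean (?d n) x) \<longlonglongrightarrow> x" .
  show "norm ((1 / ?d n) *\<^sub>R (T (?d n) x - x)) \<le> K" for n
  proof -
    have "norm ((1 / ?d n) *\<^sub>R (T (?d n) x - x)) = (1 / ?d n) * norm (T (?d n) x - x)" by simp
    also have "\<dots> \<le> (1 / ?d n) * (K * ?d n)" by (intro mult_left_mono lip) auto
    also have "\<dots> = K" by simp
    finally show ?thesis .
  qed
qed

end

section \<open>Exponential decay from a Lyapunov form\<close>

context c0_semigroup
begin

text \<open>On the domain, \<open>exp (2 * \<omega> * s) * Q (T s x) (T s x)\<close> has nonpositive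
  derivative by \<open>dissipative\<close>. Coercivity and boundedness of \<open>Q\<close> turn its
  decrease into the norm estimate, and density extends the estimate to \<open>Z\<close>.\<close>

lemma exponential_decay:
  fixes Q :: "'a \<Rightarrow> 'a \<Rightarrow> real"
  assumes add: "\<And>x y z. x \<in> Z \<Longrightarrow> y \<in> Z \<Longrightarrow> z \<in> Z \<Longrightarrow> Q (x + y) z = Q x z + Q y z"
    and scale: "\<And>c x y. x \<in> Z \<Longrightarrow> y \<in> Z \<Longrightarrow> Q (c *\<^sub>R x) y = c * Q x y"
    and sym: "\<And>x y. x \<in> Z \<Longrightarrow> y \<in> Z \<Longrightarrow> Q x y = Q y x"
    and bdd: "\<And>x y. x \<in> Z \<Longrightarrow> y \<in> Z \<Longrightarrow> \<bar>Q x y\<bar> \<le> K * norm x * norm y"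
    and coercive: "c > 0" "\<And>x. x \<in> Z \<Longrightarrow> c * (norm x)\<^sup>2 \<le> Q x x"
    and dissipative: "\<And>x y. (x, y) \<in> gen \<Longrightarrow> Q x y \<le> - \<omega> * Q x x"
    and x: "x \<in> Z" and t: "t \<ge> 0"
  shows "norm (T t x) \<le> sqrt (\<bar>K\<bar> / c) * exp (- \<omega> * t) * norm x"
proof -
  note sub = subspace_diff[OF subspace] subspace_scale[OF subspace]
  have diff: "Q (x - y) z = Q x z - Q y z" if "x \<in> Z" "y \<in> Z" "z \<in> Z" for x y z
    using add[of "x - y" y z] that by (simp add: sub)
  have lim: "((\<lambda>s. Q (f s) (g s)) \<longlongrightarrow> Q a b) F"
    if f: "(f \<longlongrightarrow> a) F" and g: "(g \<longlongrightarrow> b) F" and Z: "\<forall>\<^sub>F s in F. f s \<in> Z \<and> g s \<in> Z" "a \<in> Z" "b \<in> Z"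
    for f g a b and F :: "real filter"
  proof (rule LIM_zero_cancel, rule Lim_null_comparison)
    show "\<forall>\<^sub>F s in F. norm (Q (f s) (g s) - Q a b) \<le> \<bar>K\<bar> * norm (f s - a) * norm (g s) + \<bar>K\<bar> * norm (g s - b) * norm a"
      using Z(1)
    proof eventually_elim
      case (elim s)
      have "Q (f s) (g s) - Q a b = Q (f s - a) (g s) + Q (g s - b) a"
        using elim Z by (simp add: diff sym[of a])
      moreover have "\<bar>Q (f s - a) (g s)\<bar> \<le> \<bar>K\<bar> * norm (f s - a) * norm (g s)"
        using bdd[of "f s - a" "g s"] elim Z
        by (simp add: sub) (meson abs_ge_self mult_right_mono norm_ge_zero order_trans)
      moreover have "\<bar>Q (g s - b) a\<bar> \<le> \<bar>K\<bar> * norm (g s - b) * norm a"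
        using bdd[of "g s - b" a] elim Z
        by (simp add: sub) (meson abs_ge_self mult_right_mono norm_ge_zero order_trans)
      ultimately show ?case by simp
    qed
    show "((\<lambda>s. \<bar>K\<bar> * norm (f s - a) * norm (g s) + \<bar>K\<bar> * norm (g s - b) * norm a) \<longlongrightarrow> 0) F"
      by (rule tendsto_eq_rhs, (rule tendsto_intros f g)+) simp
  qed
  have on_gen: "norm (T t x) \<le> sqrt (\<bar>K\<bar> / c) * exp (- \<omega> * t) * norm x" if xy: "(x, y) \<in> gen" for x y
  proof -
    note xyZ = genD(1,2)[OF xy]
    define \<phi> where "\<phi> s = exp (2 * \<omega> * s) * Q (T s x) (T s x)" for s
    have der: "(\<phi> has_real_derivative
        exp (2 * \<omega> * s) * (2 * \<omega>) * Q (T s x) (T s x) + exp (2 * \<omega> * s) * (2 * Q (T s x) (T s y))) (at s within {0..})"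
      if s: "s \<ge> 0" for s
    proof -
      have Ts: "T s x \<in> Z" "T s y \<in> Z" using s xyZ by (auto simp: in_Z)
      have quot: "((\<lambda>r. (1 / (r - s)) *\<^sub>R (T r x - T s x)) \<longlongrightarrow> T s y) (at s within {0..})"
        using has_vector_derivative_T[OF xy s] by (simp add: has_vector_derivative_iff_quotient)
      have cont: "((\<lambda>r. T r x) \<longlongrightarrow> T s x) (at s within {0..})"
        using continuous[OF xyZ(1)] s by (auto simp: continuous_on_def)
      have ev: "\<forall>\<^sub>F r in at s within {0..}. r \<ge> 0 \<and> r \<noteq> s"
        by (simp add: eventually_at_filter)
      \<comment> \<open>By symmetry \<open>Q (a - b) a + Q (a - b) b = Q a a - Q b b\<close>, so
        this sum is the difference quotient of the quadratic form along the orbit.\<close>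
      have "((\<lambda>r. Q ((1 / (r - s)) *\<^sub>R (T r x - T s x)) (T r x) + Q ((1 / (r - s)) *\<^sub>R (T r x - T s x)) (T s x))
          \<longlongrightarrow> Q (T s y) (T s x) + Q (T s y) (T s x)) (at s within {0..})"
        by (intro tendsto_add lim quot cont tendsto_const Ts)
           (use ev in eventually_elim, use xyZ Ts in \<open>simp add: in_Z sub\<close>)+
      then have "((\<lambda>r. (Q (T r x) (T r x) - Q (T s x) (T s x)) / (r - s)) \<longlongrightarrow> 2 * Q (T s x) (T s y)) (at s within {0..})"
      proof (rule Lim_transform_eventually[THEN tendsto_eq_rhs])
        show "\<forall>\<^sub>F r in at s within {0..}. Q ((1 / (r - s)) *\<^sub>R (T r x - T s x)) (T r x) + Q ((1 / (r - s)) *\<^sub>R (T r x - T s x)) (T s x)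
            = (Q (T r x) (T r x) - Q (T s x) (T s x)) / (r - s)"
          using ev
        proof eventually_elim
          case (elim r)
          then have "T r x \<in> Z" using xyZ by (simp add: in_Z)
          then show ?case
            using Ts elim by (simp add: scale sub diff sym[of "T r x" "T s x"] diff_divide_distrib)
        qed
        show "Q (T s y) (T s x) + Q (T s y) (T s x) = 2 * Q (T s x) (T s y)"
          using Ts sym[of "T s y" "T s x"] by simp
      qed
      then have "((\<lambda>r. Q (T r x) (T r x)) has_real_derivative 2 * Q (T s x) (T s y)) (at s within {0..})"
        by (simp add: has_field_derivative_iff)
      moreover have "((\<lambda>s. exp (2 * \<omega> * s)) has_real_derivative exp (2 * \<omega> * s) * (2 * \<omega>)) (at s within {0..})"
        by (auto intro!: derivative_eq_intros)
      ultimately show ?thesis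
        unfolding \<phi>_def by (auto intro: DERIV_cong[OF DERIV_mult])
    qed
    have "\<phi> t \<le> \<phi> 0"
    proof (cases "t = 0")
      case False
      then have t0: "t > 0" using t by simp
      have "continuous_on {0..t} \<phi>"
        by (rule DERIV_continuous_on) (rule DERIV_subset[OF der], auto)
      then obtain z where z: "0 < z" "z < t" and
        eq: "\<phi> t - \<phi> 0 = (exp (2 * \<omega> * z) * (2 * \<omega>) * Q (T z x) (T z x) + exp (2 * \<omega> * z) * (2 * Q (T z x) (T z y))) * (t - 0)"
      proof (rule mvt[OF t0])
        fix s assume s: "0 < s" "s < t"
        have "(\<phi> has_real_derivative
            exp (2 * \<omega> * s) * (2 * \<omega>) * Q (T s x) (T s x) + exp (2 * \<omega> * s) * (2 * Q (T s x) (T s y))) (at s)"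
          using der[of s] s at_within_interior[of s "{0..}"] by (simp add: interior_real_atLeast)
        then show "(\<phi> has_derivative (\<lambda>h. (exp (2 * \<omega> * s) * (2 * \<omega>) * Q (T s x) (T s x) + exp (2 * \<omega> * s) * (2 * Q (T s x) (T s y))) * h)) (at s)"
          by (simp add: has_field_derivative_def)
      qed auto
      have "Q (T z x) (T z y) \<le> - \<omega> * Q (T z x) (T z x)"
        using z by (intro dissipative gen_invariant xy) auto
      then have "exp (2 * \<omega> * z) * (2 * (\<omega> * Q (T z x) (T z x) + Q (T z x) (T z y))) \<le> 0"
        by (intro mult_nonneg_nonpos) auto
      then have "(exp (2 * \<omega> * z) * (2 * \<omega>) * Q (T z x) (T z x) + exp (2 * \<omega> * z) * (2 * Q (T z x) (T z y))) * (t - 0) \<le> 0"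
        using t0 by (intro mult_nonpos_nonneg) (auto simp: algebra_simps)
      then show ?thesis using eq by simp
    qed simp
    then have "exp (2 * \<omega> * t) * Q (T t x) (T t x) \<le> Q x x"
      using xyZ by (simp add: \<phi>_def T_zero)
    moreover have "exp (2 * \<omega> * t) * (c * (norm (T t x))\<^sup>2) \<le> exp (2 * \<omega> * t) * Q (T t x) (T t x)"
      using xyZ t by (intro mult_left_mono coercive) (auto simp: in_Z)
    moreover have "Q x x \<le> \<bar>K\<bar> * (norm x)\<^sup>2"
    proof -
      have "Q x x \<le> K * (norm x)\<^sup>2"
        using bdd[of x x] xyZ by (simp add: power2_eq_square mult.assoc)
      also have "\<dots> \<le> \<bar>K\<bar> * (norm x)\<^sup>2" by (intro mult_right_mono) auto
      finally show ?thesis .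
    qed
    ultimately have "exp (2 * \<omega> * t) * (c * (norm (T t x))\<^sup>2) \<le> \<bar>K\<bar> * (norm x)\<^sup>2" by linarith
    then have "(norm (T t x))\<^sup>2 \<le> \<bar>K\<bar> / c * (exp (- 2 * \<omega> * t)) * (norm x)\<^sup>2"
      using coercive(1) by (simp add: field_simps exp_minus)
    also have "\<dots> = (sqrt (\<bar>K\<bar> / c) * exp (- \<omega> * t) * norm x)\<^sup>2"
      using coercive(1) by (simp add: power_mult_distrib mult.assoc flip: exp_of_nat_mult)
    finally show ?thesis
      by (rule power2_le_imp_le) (use coercive(1) in simp)
  qed
  obtain X Y where XY: "\<And>n::nat. (X n, Y n) \<in> gen" "X \<longlonglongrightarrow> x"
    using gen_dense[OF x] by blast
  obtain M where M: "\<And>x. x \<in> Z \<Longrightarrow> norm (T t x) \<le> M * norm x" using bounded[OF t] by blast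
  have "(\<lambda>n. T t (X n)) \<longlonglongrightarrow> T t x"
  proof (rule LIM_zero_cancel, rule Lim_null_comparison)
    show "\<forall>\<^sub>F n in sequentially. norm (T t (X n) - T t x) \<le> M * norm (X n - x)"
      using M t x genD(1)[OF XY(1)] by (auto simp: subspace_diff[OF subspace] simp flip: T_diff)
    show "(\<lambda>n. M * norm (X n - x)) \<longlonglongrightarrow> 0"
      by (intro tendsto_mult_right_zero tendsto_norm_zero LIM_zero XY)
  qed
  then show ?thesis
    by (intro LIMSEQ_le[OF tendsto_norm tendsto_mult[OF tendsto_const tendsto_norm[OF XY(2)]]])
       (use on_gen[OF XY(1)] in auto)
qed

end

section \<open>Bounded mild solutions on the whole time line\<close>

context c0_semigroup
begin

text \<open>For \<open>(x, y)\<close> in the generator, \<open>T s y\<close> is the image of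
  \<open>T s x\<close>, so \<open>P_gen\<close> bounds the integrand \<open>P (T s y)\<close> by
  \<open>norm x\<close> alone. With \<open>y\<close> gone from the estimate, density carries it to
  every \<open>x\<close> in \<open>Z\<close>. For the wave equation \<open>P\<close> extracts
  \<open>u\<close> as an \<open>L\<^sup>2\<close> class, and the lemma says that it moves with the
  bounded velocity \<open>v\<close>.\<close>

lemma norm_linear_image_increment_le:
  fixes P :: "'a \<Rightarrow> 'b::real_normed_vector"
  assumes P: "bounded_linear P" and P_gen: "\<And>x y. (x, y) \<in> gen \<Longrightarrow> norm (P y) \<le> B * norm x" and B: "B \<ge> 0"
    and T_le: "\<And>t x. t \<ge> 0 \<Longrightarrow> x \<in> Z \<Longrightarrow> norm (T t x) \<le> M * norm x"
    and x: "x \<in> Z" and h: "h \<ge> 0"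
  shows "norm (P (T h x - x)) \<le> B * M * h * norm x"
proof -
  have on_gen: "norm (P (T h x - x)) \<le> B * M * h * norm x" if xy: "(x, y) \<in> gen" for x y
  proof -
    have "norm (P (T h x - x)) \<le> (B * (M * norm x)) * measure lborel (cbox 0 h)"
    proof (rule has_integral_bound)
      show "(P \<circ> (\<lambda>s. T s y) has_integral P (T h x - x)) (cbox 0 h)"
        using has_integral_linear[OF T_eq_integral[OF xy h] P] by (simp add: box_real)
      show *: "norm ((P \<circ> (\<lambda>s. T s y)) s) \<le> B * (M * norm x)" if s: "s \<in> cbox 0 h" for s
      proof -
        have "norm (P (T s y)) \<le> B * norm (T s x)"
          using s by (intro P_gen gen_invariant xy) (auto simp: box_real)
        also have "\<dots> \<le> B * (M * norm x)"
          using s genD(1)[OF xy] by (intro mult_left_mono T_le B) (auto simp: box_real)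
        finally show ?thesis by simp
      qed
      show "0 \<le> B * (M * norm x)"
        using order_trans[OF norm_ge_zero *[of 0]] h by (simp add: box_real)
    qed
    then show ?thesis using h by (simp add: box_real mult_ac)
  qed
  obtain X Y where XY: "\<And>n::nat. (X n, Y n) \<in> gen" "X \<longlonglongrightarrow> x"
    using gen_dense[OF x] by blast
  have "(\<lambda>n. T h (X n)) \<longlonglongrightarrow> T h x"
  proof (rule LIM_zero_cancel, rule Lim_null_comparison)
    show "\<forall>\<^sub>F n in sequentially. norm (T h (X n) - T h x) \<le> M * norm (X n - x)"
      using T_le h x genD(1)[OF XY(1)] by (auto simp: subspace_diff[OF subspace] simp flip: T_diff)
    show "(\<lambda>n. M * norm (X n - x)) \<longlonglongrightarrow> 0"
      by (intro tendsto_mult_right_zero tendsto_norm_zero LIM_zero XY)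
  qed
  then have "(\<lambda>n. norm (P (T h (X n) - X n))) \<longlonglongrightarrow> norm (P (T h x - x))"
    by (intro tendsto_norm bounded_linear.tendsto[OF P] tendsto_diff XY)
  moreover have "(\<lambda>n. B * M * h * norm (X n)) \<longlonglongrightarrow> B * M * h * norm x"
    by (intro tendsto_intros XY)
  ultimately show ?thesis
    by (rule LIMSEQ_le) (use on_gen[OF XY(1)] in auto)
qed

end

lemma integral_exp_decay_le:
  fixes \<omega> :: real
  assumes "\<omega> > 0" "s \<le> t" "D \<ge> 0"
  shows "(\<lambda>p. D * exp (- \<omega> * (t - p))) integrable_on {s..t}"
    and "integral {s..t} (\<lambda>p. D * exp (- \<omega> * (t - p))) \<le> D / \<omega>"
proof -
  have "((\<lambda>p. D * exp (- \<omega> * (t - p))) has_integral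
      (D / \<omega> * exp (- \<omega> * (t - t)) - D / \<omega> * exp (- \<omega> * (t - s)))) {s..t}"
    using assms
    by (intro fundamental_theorem_of_calculus)
       (auto intro!: derivative_eq_intros simp flip: has_real_derivative_iff_has_vector_derivative)
  then show "(\<lambda>p. D * exp (- \<omega> * (t - p))) integrable_on {s..t}"
    and "integral {s..t} (\<lambda>p. D * exp (- \<omega> * (t - p))) \<le> D / \<omega>"
    using assms by (auto simp: has_integral_iff)
qed

text \<open>\<open>N\<close> is the inhomogeneity evaluated along \<open>U\<close>. Regarding it as
  a given forcing makes the problem linear; the dependence of \<open>N\<close> on \<open>U\<close>
  is brought in only by the bounds on its increments.\<close>

locale exp_stable_mild_solution = hilbert_c0_semigroup Z T
  for Z :: "'a::{banach, real_inner} set" and T +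
  fixes M \<omega> :: real and U N :: "real \<Rightarrow> 'a"
  assumes M: "M > 0" and \<omega>: "\<omega> > 0"
    and decay: "\<And>t x. t \<ge> 0 \<Longrightarrow> x \<in> Z \<Longrightarrow> norm (T t x) \<le> M * exp (- \<omega> * t) * norm x"
    and U_Z: "\<And>t. U t \<in> Z" and N_Z: "\<And>t. N t \<in> Z"
    and mild: "\<And>s t. s \<le> t \<Longrightarrow> ((\<lambda>p. T (t - p) (N p)) has_integral (U t - T (t - s) (U s))) {s..t}"
begin

lemma decay_bounded: "t \<ge> 0 \<Longrightarrow> x \<in> Z \<Longrightarrow> norm (T t x) \<le> M * norm x"
proof -
  assume t: "t \<ge> 0" and x: "x \<in> Z"
  have "norm (T t x) \<le> M * exp (- \<omega> * t) * norm x" by (rule decay[OF t x])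
  also have "\<dots> \<le> M * 1 * norm x"
    using M \<omega> t by (intro mult_right_mono mult_left_mono) auto
  finally show "norm (T t x) \<le> M * norm x" by simp
qed

lemma mild_increment_le:
  assumes N: "\<And>t. norm (N t) \<le> R" and h: "h \<ge> 0"
  shows "norm (U (t + h) - T h (U t)) \<le> M * R * h"
proof -
  have R: "R \<ge> 0" using N[of 0] norm_ge_zero order_trans by blast
  have "norm (U (t + h) - T h (U t)) \<le> (M * R) * measure lborel (cbox t (t + h))"
  proof (rule has_integral_bound)
    show "((\<lambda>p. T (t + h - p) (N p)) has_integral U (t + h) - T h (U t)) (cbox t (t + h))"
      using mild[of t "t + h"] h by (simp add: box_real)
    show "norm (T (t + h - p) (N p)) \<le> M * R" if "p \<in> cbox t (t + h)" for p
      using that order_trans[OF decay_bounded[OF _ N_Z] mult_left_mono[OF N], of "t + h - p" p] M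
      by (auto simp: box_real)
  qed (use M R in simp)
  then show ?thesis using h by (simp add: box_real)
qed

text \<open>
  The difference \<open>U (t + h) - U t\<close> solves a linear equation whose inhomogeneity is absorbed by the
  exponential decay, except for the part controlled by the weaker seminorm of \<open>P\<close>.
\<close>

lemma Lipschitz:
  fixes P :: "'a \<Rightarrow> 'b::real_normed_vector"
  assumes P: "bounded_linear P" and P_le: "\<And>x. norm (P x) \<le> norm x"
    and P_gen: "\<And>x y. (x, y) \<in> gen \<Longrightarrow> norm (P y) \<le> B * norm x" and B: "B \<ge> 0"
    and U_le: "\<And>t. norm (U t) \<le> R" and N_le: "\<And>t. norm (N t) \<le> R'"
    and N_lip: "\<And>p q. norm (N p - N q) \<le> \<delta> * norm (U p - U q) + L * norm (P (U p - U q))"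
    and L: "L \<ge> 0" and \<delta>: "\<delta> \<ge> 0" "M * \<delta> \<le> \<omega> / 2" and h: "h \<ge> 0"
  shows "norm (U (t + h) - U t) \<le> 2 * M * L * (B * M * R + M * R') / \<omega> * h"
proof -
  have R: "R \<ge> 0" "R' \<ge> 0" using U_le[of 0] N_le[of 0] norm_ge_zero order_trans by blast+
  \<comment> \<open>The Lipschitz constant of \<open>P\<close> along \<open>U\<close>: the free
    evolution contributes \<open>B * M * R\<close>, the forcing \<open>M * R'\<close>.\<close>
  define B' where "B' = B * M * R + M * R'"
  have B': "B' \<ge> 0" using B M R by (simp add: B'_def)
  have P_U: "norm (P (U (t + h) - U t)) \<le> B' * h" if h: "h \<ge> 0" for t h
  proof -
    have "P (U (t + h) - U t) = P (T h (U t) - U t) + P (U (t + h) - T h (U t))"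
      by (simp add: bounded_linear.linear[OF P] linear_diff)
    moreover have "norm (P (T h (U t) - U t)) \<le> B * M * h * norm (U t)"
      by (rule norm_linear_image_increment_le[OF P P_gen B decay_bounded U_Z h])
    moreover have "B * M * h * norm (U t) \<le> B * M * h * R"
      using B M h by (intro mult_left_mono U_le) auto
    moreover have "norm (P (U (t + h) - T h (U t))) \<le> M * R' * h"
      by (rule order_trans[OF P_le mild_increment_le[OF N_le h]])
    ultimately show ?thesis
      using norm_triangle_ineq[of "P (T h (U t) - U t)" "P (U (t + h) - T h (U t))"]
      by (simp add: B'_def algebra_simps)
  qed
  define K where "K = 2 * M * L * B' / \<omega>"
  have "norm (U (t + h) - U t) \<le> K * h" for t
  proof -
    define S where "S = (SUP t. norm (U (t + h) - U t))"
    have U2: "norm (U (t + h) - U t) \<le> 2 * R" for t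
      using norm_triangle_ineq4[of "U (t + h)" "U t"] U_le[of t] U_le[of "t + h"] by linarith
    \<comment> \<open>Finiteness of \<open>S\<close> before any estimate is what later allows the
      term containing \<open>S\<close> to be absorbed.\<close>
    have "bdd_above (range (\<lambda>t. norm (U (t + h) - U t)))"
      using U2 by (intro bdd_aboveI[of _ "2 * R"]) auto
    then have S: "norm (U (t + h) - U t) \<le> S" for t
      unfolding S_def by (intro cSUP_upper) auto
    define D where "D = \<delta> * S + L * (B' * h)"
    have S0: "S \<ge> 0" using S[of 0] norm_ge_zero order_trans by blast
    have D0: "D \<ge> 0" using \<delta> L B' h S0 by (simp add: D_def)
    have N_D: "norm (N (p + h) - N p) \<le> D" for p
    proof -
      have "norm (N (p + h) - N p) \<le> \<delta> * norm (U (p + h) - U p) + L * norm (P (U (p + h) - U p))"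
        by (rule N_lip)
      also have "\<dots> \<le> D"
        unfolding D_def by (intro add_mono mult_left_mono S P_U h \<delta> L)
      finally show ?thesis .
    qed
    have "norm (U (t + h) - U t) \<le> M * exp (- \<omega> * r) * (2 * R) + M * D / \<omega>" if r: "r \<ge> 0" for t r
    proof -
      let ?s = "t - r"
      \<comment> \<open>The mild identity over \<open>{?s + h..t + h}\<close>, shifted back by
        \<open>h\<close> so that it can be subtracted from the one over
        \<open>{?s..t}\<close>.\<close>
      have "((\<lambda>p. T (t + h - p) (N p)) has_integral (U (t + h) - T r (U (?s + h)))) (cbox (?s + h) (t + h))"
        using mild[of "?s + h" "t + h"] r by (simp add: box_real)
      then have "((\<lambda>p. T (t + h - p) (N p)) \<circ> (+) h has_integral (U (t + h) - T r (U (?s + h)))) (cbox ?s t)"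
        using has_integral_shift_cbox_iff[of _ h _ ?s t] by blast
      then have 1: "((\<lambda>p. T (t - p) (N (p + h))) has_integral (U (t + h) - T r (U (?s + h)))) {?s..t}"
        by (simp add: comp_def box_real add.commute)
      have 2: "((\<lambda>p. T (t - p) (N p)) has_integral (U t - T r (U ?s))) {?s..t}"
        using mild[of ?s t] r by simp
      let ?g = "\<lambda>p. T (t - p) (N (p + h)) - T (t - p) (N p)"
      note int = has_integral_diff[OF 1 2]
      have "norm (integral {?s..t} ?g) \<le> integral {?s..t} (\<lambda>p. M * D * exp (- \<omega> * (t - p)))"
      proof (rule integral_norm_bound_integral)
        fix p assume p: "p \<in> {?s..t}"
        have "norm (?g p) = norm (T (t - p) (N (p + h) - N p))"
          using p by (simp add: T_diff N_Z)
        also have "\<dots> \<le> M * exp (- \<omega> * (t - p)) * norm (N (p + h) - N p)"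
          using p by (intro decay subspace_diff[OF subspace] N_Z) auto
        also have "\<dots> \<le> M * exp (- \<omega> * (t - p)) * D"
          using M by (intro mult_left_mono N_D) auto
        finally show "norm (?g p) \<le> M * D * exp (- \<omega> * (t - p))" by (simp add: mult_ac)
      qed (use int integral_exp_decay_le(1)[OF \<omega>, of ?s t "M * D"] M D0 r in \<open>auto simp: has_integral_iff\<close>)
      also have "\<dots> \<le> M * D / \<omega>"
        using integral_exp_decay_le(2)[OF \<omega>, of ?s t "M * D"] M D0 r by simp
      finally have "norm (integral {?s..t} ?g) \<le> M * D / \<omega>" .
      moreover have "U (t + h) - U t = T r (U (?s + h) - U ?s) + integral {?s..t} ?g"
        using integral_unique[OF int] r by (simp add: T_diff U_Z)
      moreover have "norm (T r (U (?s + h) - U ?s)) \<le> M * exp (- \<omega> * r) * norm (U (?s + h) - U ?s)"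
        using r by (intro decay subspace_diff[OF subspace] U_Z) auto
      moreover have "M * exp (- \<omega> * r) * norm (U (?s + h) - U ?s) \<le> M * exp (- \<omega> * r) * (2 * R)"
        using M by (intro mult_left_mono U2) auto
      ultimately show ?thesis
        using norm_triangle_ineq[of "T r (U (?s + h) - U ?s)" "integral {?s..t} ?g"] by simp
    qed
    note est = this
    \<comment> \<open>Letting \<open>r\<close> tend to infinity along the integers removes the
      contribution of the distant past, which is possible because \<open>U\<close> is defined at all
      negative times.\<close>
    have "norm (U (t + h) - U t) \<le> M * D / \<omega>" for t
    proof (rule LIMSEQ_le_const)
      have "(\<lambda>n. exp (- \<omega>) ^ n) \<longlonglongrightarrow> 0"
        using \<omega> by (intro LIMSEQ_power_zero) simp
      then have "(\<lambda>n. exp (- \<omega> * real n)) \<longlonglongrightarrow> 0"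
        by (simp add: exp_of_nat_mult mult.commute flip: exp_of_nat_mult)
      then have "(\<lambda>n. M * exp (- \<omega> * real n) * (2 * R) + M * D / \<omega>) \<longlonglongrightarrow> M * 0 * (2 * R) + M * D / \<omega>"
        by (intro tendsto_intros)
      then show "(\<lambda>n. M * exp (- \<omega> * real n) * (2 * R) + M * D / \<omega>) \<longlonglongrightarrow> M * D / \<omega>"
        by simp
      show "\<exists>N. \<forall>n\<ge>N. norm (U (t + h) - U t) \<le> M * exp (- \<omega> * real n) * (2 * R) + M * D / \<omega>"
        using est by (intro exI[of _ 0]) auto
    qed
    \<comment> \<open>\<open>D\<close> contains \<open>\<delta> * S\<close>, whose share is at most
      \<open>S / 2\<close> because \<open>M * \<delta> \<le> \<omega> / 2\<close>. Moving it to the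
      left doubles the rest, hence the factor 2 in \<open>K\<close>.\<close>
    then have "S \<le> M * D / \<omega>" unfolding S_def by (intro cSUP_least) auto
    also have "\<dots> = (M * \<delta>) * S / \<omega> + M * L * B' * h / \<omega>"
      by (simp add: D_def algebra_simps add_divide_distrib)
    also have "(M * \<delta>) * S / \<omega> \<le> (\<omega> / 2) * S / \<omega>"
      using \<omega> S0 \<delta> by (intro divide_right_mono mult_right_mono) auto
    also have "(\<omega> / 2) * S / \<omega> = S / 2" using \<omega> by simp
    finally have "S \<le> K * h" by (simp add: K_def)
    then show ?thesis using S[of t] by linarith
  qed
  then show ?thesis by (simp add: K_def B'_def)
qed

text \<open>\<open>T d (U t) - U t\<close> differs from \<open>U (t + d) - U t\<close> only by the
  Duhamel term, which is of order \<open>d\<close>. So Lipschitz continuity in time becomes the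
  criterion for membership in the domain, with one constant for all \<open>t\<close>.\<close>

lemma bounded_in_gen:
  fixes P :: "'a \<Rightarrow> 'b::real_normed_vector"
  assumes P: "bounded_linear P" and P_le: "\<And>x. norm (P x) \<le> norm x"
    and P_gen: "\<And>x y. (x, y) \<in> gen \<Longrightarrow> norm (P y) \<le> B * norm x" and B: "B \<ge> 0"
    and U_le: "\<And>t. norm (U t) \<le> R" and N_le: "\<And>t. norm (N t) \<le> R'"
    and N_lip: "\<And>p q. norm (N p - N q) \<le> \<delta> * norm (U p - U q) + L * norm (P (U p - U q))"
    and L: "L \<ge> 0" and \<delta>: "\<delta> \<ge> 0" "M * \<delta> \<le> \<omega> / 2"
  shows "\<exists>y. (U t, y) \<in> gen \<and> norm y \<le> 2 * M * L * (B * M * R + M * R') / \<omega> + M * R'"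
proof -
  define K where "K = 2 * M * L * (B * M * R + M * R') / \<omega>"
  have K: "norm (U (t + h) - U t) \<le> K * h" if "h \<ge> 0" for t h
    unfolding K_def by (rule Lipschitz[OF assms that])
  have "\<exists>y. (U t, y) \<in> gen \<and> norm y \<le> K + M * R'"
  proof (rule Lipschitz_at_0_in_gen[OF U_Z])
    fix d :: real assume d: "0 < d" "d \<le> 1"
    have "norm (T d (U t) - U t) \<le> norm (U (t + d) - U t) + norm (U (t + d) - T d (U t))"
      using norm_triangle_ineq4[of "U (t + d) - U t" "U (t + d) - T d (U t)"] by simp
    then show "norm (T d (U t) - U t) \<le> (K + M * R') * d"
      using K[of d t] mild_increment_le[OF N_le, of d t] d by (simp add: algebra_simps)
  qed
  then show ?thesis by (simp add: K_def)
qed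

end

section \<open>The Sobolev inequality in three dimensions\<close>

definition vec3 :: "real \<Rightarrow> real \<Rightarrow> real \<Rightarrow> real^3" where
  "vec3 x y z = x *\<^sub>R axis 1 1 + y *\<^sub>R axis 2 1 + z *\<^sub>R axis 3 1"

lemma vec3_nth [simp]: "vec3 x y z $ 1 = x" "vec3 x y z $ 2 = y" "vec3 x y z $ 3 = z"
  by (auto simp: vec3_def axis_def)

abbreviation vec3p :: "real \<times> real \<times> real \<Rightarrow> real^3" where
  "vec3p p \<equiv> vec3 (fst p) (fst (snd p)) (snd (snd p))"

lemma vec3_borel [measurable]: "(\<lambda>p. vec3p p) \<in> borel_measurable borel"
  unfolding vec3_def by (intro borel_measurable_continuous_onI continuous_intros)

text \<open>Both measures assign to a box the product of its side lengths, which determines Lebesgue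
  measure. This opens the way to iterated one-dimensional integrals.\<close>

lemma lborel_vec3: "lborel = distr lborel borel (\<lambda>p. vec3p p)"
proof (rule lborel_eqI)
  fix l u :: "real^3" assume lu: "\<And>b. b \<in> Basis \<Longrightarrow> l \<bullet> b \<le> u \<bullet> b"
  have le: "l $ i \<le> u $ i" for i
    using lu[of "axis i 1"] by (simp add: inner_axis)
  have box_Pair_eq: "box (a, b) (c, d) = box a c \<times> box b d"
    for a c :: "'b::euclidean_space" and b d :: "'c::euclidean_space"
    by (auto simp: Basis_prod_def ball_Un box_def)
  have vim: "(\<lambda>p. vec3p p) -` box l u
      = box (l $ 1, l $ 2, l $ 3) (u $ 1, u $ 2, u $ 3)"
    by (auto simp: mem_box_cart forall_3 box_Pair_eq)
  have "(\<Prod>b\<in>Basis. (u - l) \<bullet> b) = (\<Prod>i\<in>UNIV. u $ i - l $ i)"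
  proof -
    have B: "(Basis :: (real^3) set) = range (\<lambda>i. axis i 1)" by (auto simp: Basis_vec_def)
    show ?thesis
      unfolding B by (subst prod.reindex) (auto simp: inj_on_def axis_eq_axis inner_axis)
  qed
  also have "\<dots> = (u $ 1 - l $ 1) * ((u $ 2 - l $ 2) * (u $ 3 - l $ 3))"
    unfolding UNIV_3 by simp
  finally have "(\<Prod>b\<in>Basis. (u - l) \<bullet> b) = (u $ 1 - l $ 1) * ((u $ 2 - l $ 2) * (u $ 3 - l $ 3))" .
  moreover have "emeasure (distr lborel borel (\<lambda>p. vec3p p)) (box l u)
      = emeasure (lborel \<Otimes>\<^sub>M (lborel \<Otimes>\<^sub>M lborel)) (box (l $ 1, l $ 2, l $ 3) (u $ 1, u $ 2, u $ 3))"
    by (subst emeasure_distr) (simp_all add: vim lborel_prod)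
  moreover have "\<dots> = ennreal ((u $ 1 - l $ 1) * ((u $ 2 - l $ 2) * (u $ 3 - l $ 3)))"
    using le
    by (simp add: box_Pair_eq lborel.emeasure_pair_measure_Times lborel_pair.emeasure_pair_measure_Times
        sigma_finite_measure.emeasure_pair_measure_Times[OF lborel_pair.sigma_finite_measure_axioms] ennreal_mult)
  ultimately show "emeasure (distr lborel borel (\<lambda>p. vec3p p)) (box l u)
      = (\<Prod>b\<in>Basis. (u - l) \<bullet> b)"
    by simp
qed simp

lemma nn_integral_vec3:
  assumes [measurable]: "f \<in> borel_measurable borel"
  shows "(\<integral>\<^sup>+x. f x \<partial>lborel) = (\<integral>\<^sup>+x. \<integral>\<^sup>+y. \<integral>\<^sup>+z. f (vec3 x y z) \<partial>lborel \<partial>lborel \<partial>lborel)"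
proof -
  have "(\<integral>\<^sup>+x. f x \<partial>lborel) = (\<integral>\<^sup>+p. f (vec3p p) \<partial>lborel)"
    by (subst lborel_vec3) (simp add: nn_integral_distr)
  also have "\<dots> = (\<integral>\<^sup>+p. f (vec3p p) \<partial>(lborel \<Otimes>\<^sub>M (lborel \<Otimes>\<^sub>M lborel)))"
    by (simp add: lborel_prod)
  also have "\<dots> = (\<integral>\<^sup>+x. \<integral>\<^sup>+q. f (vec3 x (fst q) (snd q)) \<partial>(lborel \<Otimes>\<^sub>M lborel) \<partial>lborel)"
    by (subst lborel_prod, subst lborel.nn_integral_fst[symmetric]) (simp_all add: lborel_prod)
  also have "\<dots> = (\<integral>\<^sup>+x. \<integral>\<^sup>+y. \<integral>\<^sup>+z. f (vec3 x y z) \<partial>lborel \<partial>lborel \<partial>lborel)"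
    by (intro nn_integral_cong, subst lborel.nn_integral_fst[symmetric]) (simp_all add: vec3_def)
  finally show ?thesis .
qed

text \<open>With \<open>esqrt \<infinity> = \<infinity>\<close>, Cauchy-Schwarz can be chained
  through iterated integrals without checking finiteness at the intermediate stages.\<close>

definition esqrt :: "ennreal \<Rightarrow> ennreal" where
  "esqrt x = (if x = \<infinity> then \<infinity> else ennreal (sqrt (enn2real x)))"

lemma esqrt_borel [measurable]: "esqrt \<in> borel_measurable borel"
  unfolding esqrt_def by measurable

lemma esqrt_square [simp]: "(esqrt x)\<^sup>2 = x"
proof (cases x)
  case (real r)
  then show ?thesis by (simp add: esqrt_def ennreal_power)
qed (simp add: esqrt_def)

lemma esqrt_ennreal: "x \<ge> 0 \<Longrightarrow> esqrt (ennreal x) = ennreal (sqrt x)"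
  by (simp add: esqrt_def)

lemma ennreal_power2_le_imp_le:
  assumes "(a::ennreal)\<^sup>2 \<le> b\<^sup>2"
  shows "a \<le> b"
proof (cases b)
  case (real s)
  then have "a\<^sup>2 \<le> ennreal (s\<^sup>2)" using assms by (simp add: ennreal_power)
  then show ?thesis
  proof (cases a)
    case (real r)
    then have "ennreal (r\<^sup>2) \<le> ennreal (s\<^sup>2)"
      using \<open>a\<^sup>2 \<le> ennreal (s\<^sup>2)\<close> by (simp add: ennreal_power)
    then have "r\<^sup>2 \<le> s\<^sup>2" by (simp add: ennreal_le_iff)
    then show ?thesis
      using real \<open>b = ennreal s\<close> \<open>0 \<le> s\<close> by (auto intro!: ennreal_leI power2_le_imp_le)
  qed (simp add: power2_eq_square ennreal_top_mult top_unique)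
qed simp

lemma Cauchy_Schwarz_esqrt:
  assumes "f \<in> borel_measurable M" "g \<in> borel_measurable M"
  shows "(\<integral>\<^sup>+x. f x * g x \<partial>M) \<le> esqrt (\<integral>\<^sup>+x. (f x)\<^sup>2 \<partial>M) * esqrt (\<integral>\<^sup>+x. (g x)\<^sup>2 \<partial>M)"
proof (rule ennreal_power2_le_imp_le)
  show "(\<integral>\<^sup>+x. f x * g x \<partial>M)\<^sup>2 \<le> (esqrt (\<integral>\<^sup>+x. (f x)\<^sup>2 \<partial>M) * esqrt (\<integral>\<^sup>+x. (g x)\<^sup>2 \<partial>M))\<^sup>2"
    unfolding power_mult_distrib esqrt_square by (rule Cauchy_Schwarz_nn_integral[OF assms])
qed

text \<open>Each factor is independent of one variable. Cauchy-Schwarz is applied in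
  \<open>z\<close>, then \<open>y\<close>, then \<open>x\<close>; each time exactly two of the
  remaining factors depend on the variable of integration, and the third is pulled out.\<close>

lemma Loomis_Whitney:
  fixes f g h :: "real \<Rightarrow> real \<Rightarrow> ennreal"
  assumes [measurable]: "case_prod f \<in> borel_measurable (lborel \<Otimes>\<^sub>M lborel)"
    "case_prod g \<in> borel_measurable (lborel \<Otimes>\<^sub>M lborel)" "case_prod h \<in> borel_measurable (lborel \<Otimes>\<^sub>M lborel)"
  shows "(\<integral>\<^sup>+x. \<integral>\<^sup>+y. \<integral>\<^sup>+z. esqrt (f x y) * esqrt (g x z) * esqrt (h y z) \<partial>lborel \<partial>lborel \<partial>lborel)
    \<le> esqrt (\<integral>\<^sup>+x. \<integral>\<^sup>+y. f x y \<partial>lborel \<partial>lborel) * esqrt (\<integral>\<^sup>+x. \<integral>\<^sup>+z. g x z \<partial>lborel \<partial>lborel)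
      * esqrt (\<integral>\<^sup>+y. \<integral>\<^sup>+z. h y z \<partial>lborel \<partial>lborel)"
proof -
  define a where "a x = (\<integral>\<^sup>+z. g x z \<partial>lborel)" for x
  define b where "b y = (\<integral>\<^sup>+z. h y z \<partial>lborel)" for y
  define c where "c x = (\<integral>\<^sup>+y. f x y \<partial>lborel)" for x
  have [measurable]: "a \<in> borel_measurable lborel" "b \<in> borel_measurable lborel" "c \<in> borel_measurable lborel"
    unfolding a_def b_def c_def by measurable
  have 1: "(\<integral>\<^sup>+z. esqrt (f x y) * esqrt (g x z) * esqrt (h y z) \<partial>lborel)
      \<le> esqrt (f x y) * (esqrt (a x) * esqrt (b y))" for x y
  proof -
    have "(\<integral>\<^sup>+z. esqrt (f x y) * esqrt (g x z) * esqrt (h y z) \<partial>lborel)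
        = esqrt (f x y) * (\<integral>\<^sup>+z. esqrt (g x z) * esqrt (h y z) \<partial>lborel)"
      by (simp add: nn_integral_cmult mult.assoc)
    also have "\<dots> \<le> esqrt (f x y) * (esqrt (a x) * esqrt (b y))"
      using Cauchy_Schwarz_esqrt[of "\<lambda>z. esqrt (g x z)" lborel "\<lambda>z. esqrt (h y z)"]
      by (intro mult_left_mono) (auto simp: a_def b_def)
    finally show ?thesis .
  qed
  have 2: "(\<integral>\<^sup>+y. \<integral>\<^sup>+z. esqrt (f x y) * esqrt (g x z) * esqrt (h y z) \<partial>lborel \<partial>lborel)
      \<le> esqrt (a x) * esqrt (c x) * esqrt (\<integral>\<^sup>+y. b y \<partial>lborel)" for x
  proof -
    have "(\<integral>\<^sup>+y. \<integral>\<^sup>+z. esqrt (f x y) * esqrt (g x z) * esqrt (h y z) \<partial>lborel \<partial>lborel)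
        \<le> (\<integral>\<^sup>+y. esqrt (a x) * (esqrt (f x y) * esqrt (b y)) \<partial>lborel)"
      using 1 by (intro nn_integral_mono) (simp add: mult_ac)
    also have "\<dots> = esqrt (a x) * (\<integral>\<^sup>+y. esqrt (f x y) * esqrt (b y) \<partial>lborel)"
      by (simp add: nn_integral_cmult)
    also have "\<dots> \<le> esqrt (a x) * (esqrt (c x) * esqrt (\<integral>\<^sup>+y. b y \<partial>lborel))"
      using Cauchy_Schwarz_esqrt[of "\<lambda>y. esqrt (f x y)" lborel "\<lambda>y. esqrt (b y)"]
      by (intro mult_left_mono) (auto simp: c_def)
    finally show ?thesis by (simp add: mult_ac)
  qed
  have "(\<integral>\<^sup>+x. \<integral>\<^sup>+y. \<integral>\<^sup>+z. esqrt (f x y) * esqrt (g x z) * esqrt (h y z) \<partial>lborel \<partial>lborel \<partial>lborel)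
      \<le> (\<integral>\<^sup>+x. esqrt (a x) * esqrt (c x) * esqrt (\<integral>\<^sup>+y. b y \<partial>lborel) \<partial>lborel)"
    by (intro nn_integral_mono 2)
  also have "\<dots> = (\<integral>\<^sup>+x. esqrt (a x) * esqrt (c x) \<partial>lborel) * esqrt (\<integral>\<^sup>+y. b y \<partial>lborel)"
    by (simp add: nn_integral_multc)
  also have "\<dots> \<le> (esqrt (\<integral>\<^sup>+x. a x \<partial>lborel) * esqrt (\<integral>\<^sup>+x. c x \<partial>lborel)) * esqrt (\<integral>\<^sup>+y. b y \<partial>lborel)"
    using Cauchy_Schwarz_esqrt[of "\<lambda>x. esqrt (a x)" lborel "\<lambda>x. esqrt (c x)"]
    by (intro mult_right_mono) auto
  finally show ?thesis by (simp add: a_def b_def c_def mult_ac)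
qed

lemma abs_le_nn_integral_deriv:
  fixes \<psi> \<psi>' :: "real \<Rightarrow> real"
  assumes der: "\<And>t. (\<psi> has_real_derivative \<psi>' t) (at t)" and cont: "continuous_on UNIV \<psi>'"
    and a: "a \<le> t" "\<psi> a = 0"
  shows "ennreal \<bar>\<psi> t\<bar> \<le> (\<integral>\<^sup>+s. ennreal \<bar>\<psi>' s\<bar> \<partial>lborel)"
proof -
  have c: "continuous_on {a..t} \<psi>'" using cont by (rule continuous_on_subset) simp
  have I: "(\<psi>' has_integral \<psi> t - \<psi> a) {a..t}"
    using a der
    by (intro fundamental_theorem_of_calculus)
       (auto simp: has_real_derivative_iff_has_vector_derivative[symmetric] intro: has_field_derivative_at_within)
  have J: "(\<lambda>s. \<bar>\<psi>' s\<bar>) integrable_on {a..t}"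
    by (intro integrable_continuous_real continuous_intros c)
  have "\<bar>\<psi> t\<bar> \<le> integral {a..t} (\<lambda>s. \<bar>\<psi>' s\<bar>)"
    using integral_norm_bound_integral[OF has_integral_integrable[OF I] J] integral_unique[OF I] a by simp
  moreover have "(\<integral>\<^sup>+s. ennreal (indicator {a..t} s * \<bar>\<psi>' s\<bar>) \<partial>lborel) = ennreal (integral {a..t} (\<lambda>s. \<bar>\<psi>' s\<bar>))"
  proof (rule nn_integral_has_integral_lborel)
    show "(\<lambda>s. indicator {a..t} s * \<bar>\<psi>' s\<bar>) \<in> borel_measurable borel"
      using borel_measurable_continuous_onI[OF cont] by measurable
    have "((\<lambda>s. if s \<in> {a..t} then \<bar>\<psi>' s\<bar> else 0) has_integral integral {a..t} (\<lambda>s. \<bar>\<psi>' s\<bar>)) UNIV"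
      using integrable_integral[OF J] by (subst has_integral_restrict_UNIV)
    moreover have "(\<lambda>s. if s \<in> {a..t} then \<bar>\<psi>' s\<bar> else 0) = (\<lambda>s. indicator {a..t} s * \<bar>\<psi>' s\<bar>)"
      by (auto simp: indicator_def)
    ultimately show "((\<lambda>s. indicator {a..t} s * \<bar>\<psi>' s\<bar>) has_integral integral {a..t} (\<lambda>s. \<bar>\<psi>' s\<bar>)) UNIV"
      by simp
  qed auto
  moreover have "(\<integral>\<^sup>+s. ennreal (indicator {a..t} s * \<bar>\<psi>' s\<bar>) \<partial>lborel) \<le> (\<integral>\<^sup>+s. ennreal \<bar>\<psi>' s\<bar> \<partial>lborel)"
    by (intro nn_integral_mono ennreal_leI) (auto simp: indicator_def)
  ultimately show ?thesis
    by (metis ennreal_leI order_trans)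
qed

lemma integrable_continuous_compact_support:
  fixes h :: "'a::euclidean_space \<Rightarrow> real"
  assumes "continuous_on UNIV h" "compact (closure {x. h x \<noteq> 0})"
  shows "integrable lborel h"
proof -
  let ?S = "closure {x. h x \<noteq> 0}"
  have "integrable lborel (\<lambda>x. indicator ?S x *\<^sub>R h x)"
    using assms by (intro borel_integrable_compact continuous_on_subset[OF assms(1)]) auto
  moreover have "(\<lambda>x. indicator ?S x *\<^sub>R h x) = h"
    using closure_subset[of "{x. h x \<noteq> 0}"] by (auto simp: indicator_def fun_eq_iff)
  ultimately show ?thesis by simp
qed

lemma compact_closure_of_subset:
  fixes K :: "'a::euclidean_space set"
  shows "compact K \<Longrightarrow> S \<subseteq> K \<Longrightarrow> compact (closure S)"
  using bounded_subset compact_closure compact_imp_bounded by blast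

lemma compact_support_subset:
  fixes h :: "'a::euclidean_space \<Rightarrow> 'b::zero" and g :: "'a \<Rightarrow> 'c::zero"
  assumes "compact (closure {x. h x \<noteq> 0})" "\<And>x. g x \<noteq> 0 \<Longrightarrow> h x \<noteq> 0"
  shows "compact (closure {x. g x \<noteq> 0})"
proof (rule compact_closure_of_subset[OF assms(1)])
  show "{x. g x \<noteq> 0} \<subseteq> closure {x. h x \<noteq> 0}"
    using assms(2) closure_subset[of "{x. h x \<noteq> 0}"] by auto
qed

lemma partial_deriv_support:
  assumes "partial_deriv i \<phi> x \<noteq> 0"
  shows "x \<in> closure {x. \<phi> x \<noteq> 0}"
proof (rule ccontr)
  assume x: "x \<notin> closure {x. \<phi> x \<noteq> 0}"
  have "(\<phi> has_derivative (\<lambda>_. 0)) (at x)"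
  proof (rule has_derivative_transform_within_open)
    show "((\<lambda>_. 0) has_derivative (\<lambda>_. 0)) (at x)" by simp
    show "open (- closure {x. \<phi> x \<noteq> 0})" by (simp add: open_closed)
    show "x \<in> - closure {x. \<phi> x \<noteq> 0}" using x by simp
    show "0 = \<phi> y" if "y \<in> - closure {x. \<phi> x \<noteq> 0}" for y
      using that closure_subset[of "{x. \<phi> x \<noteq> 0}"] by auto
  qed
  then have "frechet_derivative \<phi> (at x) = (\<lambda>_. 0)"
    using frechet_derivative_at by metis
  then show False using assms by (simp add: partial_deriv_def)
qed

lemma partial_deriv_line:
  assumes "\<And>x. \<phi> differentiable (at x)"
  shows "((\<lambda>t. \<phi> (p + t *\<^sub>R axis i 1)) has_real_derivative partial_deriv i \<phi> (p + t *\<^sub>R axis i 1)) (at t)"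
proof -
  have "(\<phi> has_derivative frechet_derivative \<phi> (at (p + t *\<^sub>R axis i 1))) (at (p + t *\<^sub>R axis i 1))"
    using assms frechet_derivative_works by blast
  moreover have "((\<lambda>t. p + t *\<^sub>R axis i 1) has_derivative (\<lambda>h. h *\<^sub>R axis i 1)) (at t)"
    by (auto intro!: derivative_eq_intros)
  ultimately have "((\<lambda>t. \<phi> (p + t *\<^sub>R axis i 1)) has_derivative
      (\<lambda>h. frechet_derivative \<phi> (at (p + t *\<^sub>R axis i 1)) (h *\<^sub>R axis i 1))) (at t)"
    using has_derivative_compose by blast
  moreover have "(\<lambda>h. frechet_derivative \<phi> (at (p + t *\<^sub>R axis i 1)) (h *\<^sub>R axis i 1))
      = (\<lambda>h. partial_deriv i \<phi> (p + t *\<^sub>R axis i 1) * h)"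
    using linear_cmul[OF linear_frechet_derivative[OF assms]]
    by (simp add: partial_deriv_def mult.commute)
  ultimately show ?thesis by (simp add: has_field_derivative_def)
qed

text \<open>The fourth power is chosen for its derivative: Cauchy-Schwarz splits
  \<open>\<phi> ^ 3 * partial_deriv i \<phi>\<close> into the integrals of \<open>\<phi> ^ 6\<close>
  and of the squared derivative, and the former is the quantity to be estimated in the Sobolev
  inequality.\<close>

lemma power4_le_nn_integral_line:
  assumes diff: "\<And>x. \<phi> differentiable (at x)" and cont: "continuous_on UNIV (partial_deriv i \<phi>)"
    and supp: "compact (closure {x. \<phi> x \<noteq> 0})"
  shows "ennreal (\<phi> (p + t *\<^sub>R axis i 1) ^ 4) \<le>
    (\<integral>\<^sup>+s. ennreal \<bar>4 * \<phi> (p + s *\<^sub>R axis i 1) ^ 3 * partial_deriv i \<phi> (p + s *\<^sub>R axis i 1)\<bar> \<partial>lborel)"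
proof -
  obtain R where "\<And>x. x \<in> closure {x. \<phi> x \<noteq> 0} \<Longrightarrow> norm x \<le> R"
    using compact_imp_bounded[OF supp] unfolding bounded_iff by blast
  then have R: "norm x \<le> R" if "\<phi> x \<noteq> 0" for x
    using closure_subset[of "{x. \<phi> x \<noteq> 0}"] that by auto
  \<comment> \<open>A parameter before \<open>t\<close> and so far out that
    \<open>p + a *\<^sub>R axis i 1\<close> has norm above \<open>R\<close>, whence
    \<open>\<phi>\<close> vanishes there.\<close>
  define a where "a = - (\<bar>t\<bar> + norm p + \<bar>R\<bar> + 1)"
  have "norm (a *\<^sub>R axis i 1 :: real^3) \<le> norm (p + a *\<^sub>R axis i 1) + norm p"
    using norm_triangle_ineq4[of "p + a *\<^sub>R axis i 1" p] by simp
  then have "norm (p + a *\<^sub>R axis i 1) > R" by (simp add: a_def norm_axis_1)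
  then have "\<phi> (p + a *\<^sub>R axis i 1) = 0" using R[of "p + a *\<^sub>R axis i 1"] by auto
  moreover have "a \<le> t" unfolding a_def using norm_ge_zero[of p] by linarith
  ultimately have a: "a \<le> t" "\<phi> (p + a *\<^sub>R axis i 1) = 0" by auto
  have cphi: "continuous_on UNIV \<phi>"
    by (intro differentiable_imp_continuous_on) (simp add: differentiable_on_def diff)
  have "ennreal \<bar>\<phi> (p + t *\<^sub>R axis i 1) ^ 4\<bar> \<le>
    (\<integral>\<^sup>+s. ennreal \<bar>4 * \<phi> (p + s *\<^sub>R axis i 1) ^ 3 * partial_deriv i \<phi> (p + s *\<^sub>R axis i 1)\<bar> \<partial>lborel)"
  proof (rule abs_le_nn_integral_deriv[OF _ _ a(1)])
    fix s
    show "((\<lambda>t. \<phi> (p + t *\<^sub>R axis i 1) ^ 4) has_real_derivative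
        4 * \<phi> (p + s *\<^sub>R axis i 1) ^ 3 * partial_deriv i \<phi> (p + s *\<^sub>R axis i 1)) (at s)"
      using DERIV_power[OF partial_deriv_line[OF diff], where n = 4] by (simp add: mult_ac)
    show "continuous_on UNIV (\<lambda>s. 4 * \<phi> (p + s *\<^sub>R axis i 1) ^ 3 * partial_deriv i \<phi> (p + s *\<^sub>R axis i 1))"
      by (intro continuous_intros continuous_on_compose2[OF cphi] continuous_on_compose2[OF cont]) auto
  qed (simp add: a(2))
  then show ?thesis by simp
qed

text \<open>With fourth roots \<open>q\<close> of \<open>r\<close> and \<open>e\<close> of
  \<open>d1 * d2 * d3\<close> the hypothesis reads \<open>q ^ 4 \<le> 8 * q ^ 3 * e\<close>. Since
  \<open>r\<close> is finite, \<open>q ^ 3\<close> cancels, and \<open>q \<le> 8 * e\<close> gives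
  \<open>8 ^ 4 = 4096\<close>.\<close>

lemma fourth_root_algebra:
  fixes r d1 d2 d3 :: real
  assumes nonneg: "r \<ge> 0" "d1 \<ge> 0" "d2 \<ge> 0" "d3 \<ge> 0"
    and le: "r \<le> sqrt (4 * (sqrt r * sqrt d1)) * sqrt (4 * (sqrt r * sqrt d2)) * sqrt (4 * (sqrt r * sqrt d3))"
  shows "r \<le> 4096 * (d1 * d2 * d3)"
proof -
  define q where "q = sqrt (sqrt r)"
  define e where "e = sqrt (sqrt (d1 * d2 * d3))"
  have r: "r = q ^ 4" and d: "d1 * d2 * d3 = e ^ 4"
    using nonneg power_mult[of q 2 2] power_mult[of e 2 2] by (simp_all add: q_def e_def)
  have q0: "q \<ge> 0" "e \<ge> 0" using nonneg by (auto simp: q_def e_def)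
  have "sqrt (4 * (sqrt r * sqrt d1)) * sqrt (4 * (sqrt r * sqrt d2)) * sqrt (4 * (sqrt r * sqrt d3)) = 8 * q ^ 3 * e"
    by (simp add: real_sqrt_mult q_def e_def power3_eq_cube)
  then have "r \<le> 8 * q ^ 3 * e" using le by simp
  then have "q ^ 3 * q \<le> q ^ 3 * (8 * e)"
    by (simp add: r power4_eq_xxxx power3_eq_cube mult_ac)
  then have "q \<le> 8 * e"
  proof (cases "q = 0")
    case False
    then have "q ^ 3 > 0" using q0 by simp
    with \<open>q ^ 3 * q \<le> q ^ 3 * (8 * e)\<close> show ?thesis by (simp add: mult_le_cancel_left_pos)
  qed (use q0 in simp)
  then have "q ^ 4 \<le> (8 * e) ^ 4" using q0 by (intro power_mono)
  then show ?thesis by (simp add: r d power_mult_distrib)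
qed

text \<open>Split \<open>\<phi> ^ 6\<close> into three copies of \<open>\<phi>\<^sup>2\<close> and
  bound each by the root of an integral along a different coordinate direction, hence by a function
  independent of that coordinate: this is the setting of \<open>Loomis_Whitney\<close>. The
  resulting bound contains the integral of \<open>\<phi> ^ 6\<close> again, but to the power 3/4,
  and \<open>fourth_root_algebra\<close> removes it.\<close>

lemma Gagliardo_Nirenberg_Sobolev:
  fixes \<phi> :: "real^3 \<Rightarrow> real"
  assumes diff: "\<And>x. \<phi> differentiable (at x)" and cont: "\<And>i. continuous_on UNIV (partial_deriv i \<phi>)"
    and supp: "compact (closure {x. \<phi> x \<noteq> 0})"
  shows "(\<integral>x. \<phi> x ^ 6 \<partial>lborel) \<le> 4096 * ((\<integral>x. (partial_deriv 1 \<phi> x)\<^sup>2 \<partial>lborel)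
      * (\<integral>x. (partial_deriv 2 \<phi> x)\<^sup>2 \<partial>lborel) * (\<integral>x. (partial_deriv 3 \<phi> x)\<^sup>2 \<partial>lborel))"
proof -
  have cphi: "continuous_on UNIV \<phi>"
    by (intro differentiable_imp_continuous_on) (simp add: differentiable_on_def diff)
  have [measurable]: "\<phi> \<in> borel_measurable borel" "\<And>i. partial_deriv i \<phi> \<in> borel_measurable borel"
    using cphi cont by (auto intro: borel_measurable_continuous_onI)
  define \<psi> where "\<psi> i x = \<bar>4 * \<phi> x ^ 3 * partial_deriv i \<phi> x\<bar>" for i x
  have [measurable]: "\<psi> i \<in> borel_measurable borel" for i unfolding \<psi>_def by measurable
  have [measurable]: "(\<lambda>p. vec3 (f p) (g p) (h p)) \<in> M \<rightarrow>\<^sub>M borel"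
    if [measurable]: "f \<in> borel_measurable M" "g \<in> borel_measurable M" "h \<in> borel_measurable M"
    for f g h and M :: "'m measure"
    unfolding vec3_def by measurable
  define f where "f x y = (\<integral>\<^sup>+z. ennreal (\<psi> 3 (vec3 x y z)) \<partial>lborel)" for x y
  define g where "g x z = (\<integral>\<^sup>+y. ennreal (\<psi> 2 (vec3 x y z)) \<partial>lborel)" for x z
  define h where "h y z = (\<integral>\<^sup>+x. ennreal (\<psi> 1 (vec3 x y z)) \<partial>lborel)" for y z
  have line: "ennreal (\<phi> (vec3 x y z) ^ 4) \<le> f x y" "ennreal (\<phi> (vec3 x y z) ^ 4) \<le> g x z"
    "ennreal (\<phi> (vec3 x y z) ^ 4) \<le> h y z" for x y z
    using power4_le_nn_integral_line[OF diff cont supp, of "vec3 x y 0" z 3]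
      power4_le_nn_integral_line[OF diff cont supp, of "vec3 x 0 z" y 2]
      power4_le_nn_integral_line[OF diff cont supp, of "vec3 0 y z" x 1]
    by (simp_all add: f_def g_def h_def \<psi>_def vec3_def add_ac)
  have root: "ennreal ((\<phi> p)\<^sup>2) \<le> esqrt k" if "ennreal (\<phi> p ^ 4) \<le> k" for p k
  proof (rule ennreal_power2_le_imp_le)
    have "(ennreal ((\<phi> p)\<^sup>2))\<^sup>2 = ennreal (\<phi> p ^ 4)"
      by (simp add: ennreal_power power_mult[symmetric])
    then show "(ennreal ((\<phi> p)\<^sup>2))\<^sup>2 \<le> (esqrt k)\<^sup>2" using that by simp
  qed
  have prod: "ennreal (\<phi> (vec3 x y z) ^ 6) \<le> esqrt (f x y) * esqrt (g x z) * esqrt (h y z)" for x y z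
  proof -
    let ?p = "vec3 x y z"
    have "\<phi> ?p ^ 6 = (\<phi> ?p)\<^sup>2 * (\<phi> ?p)\<^sup>2 * (\<phi> ?p)\<^sup>2" by (simp flip: power_add)
    then have "ennreal (\<phi> ?p ^ 6) = ennreal ((\<phi> ?p)\<^sup>2) * ennreal ((\<phi> ?p)\<^sup>2) * ennreal ((\<phi> ?p)\<^sup>2)"
      by (simp only: ennreal_mult mult_nonneg_nonneg zero_le_power2)
    also have "\<dots> \<le> esqrt (f x y) * esqrt (g x z) * esqrt (h y z)"
      by (intro mult_mono root line) auto
    finally show ?thesis .
  qed
  have meas [measurable]: "case_prod f \<in> borel_measurable (lborel \<Otimes>\<^sub>M lborel)"
    "case_prod g \<in> borel_measurable (lborel \<Otimes>\<^sub>M lborel)" "case_prod h \<in> borel_measurable (lborel \<Otimes>\<^sub>M lborel)"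
    unfolding f_def g_def h_def by measurable
  define G where "G i = (\<integral>\<^sup>+x. ennreal (\<psi> i x) \<partial>lborel)" for i
  have F: "(\<integral>\<^sup>+x. \<integral>\<^sup>+y. f x y \<partial>lborel \<partial>lborel) = G 3"
    unfolding f_def G_def by (rule nn_integral_vec3[symmetric]) measurable
  have Gg: "(\<integral>\<^sup>+x. \<integral>\<^sup>+z. g x z \<partial>lborel \<partial>lborel) = G 2"
  proof -
    have "(\<integral>\<^sup>+z. \<integral>\<^sup>+y. ennreal (\<psi> 2 (vec3 x y z)) \<partial>lborel \<partial>lborel)
        = (\<integral>\<^sup>+y. \<integral>\<^sup>+z. ennreal (\<psi> 2 (vec3 x y z)) \<partial>lborel \<partial>lborel)" for x
      by (rule lborel_pair.Fubini') measurable
    then show ?thesis unfolding g_def G_def by (subst nn_integral_vec3) auto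
  qed
  have H: "(\<integral>\<^sup>+y. \<integral>\<^sup>+z. h y z \<partial>lborel \<partial>lborel) = G 1"
  proof -
    have "(\<integral>\<^sup>+z. \<integral>\<^sup>+x. ennreal (\<psi> 1 (vec3 x y z)) \<partial>lborel \<partial>lborel)
        = (\<integral>\<^sup>+x. \<integral>\<^sup>+z. ennreal (\<psi> 1 (vec3 x y z)) \<partial>lborel \<partial>lborel)" for y
      by (rule lborel_pair.Fubini') measurable
    then have "(\<integral>\<^sup>+y. \<integral>\<^sup>+z. h y z \<partial>lborel \<partial>lborel)
        = (\<integral>\<^sup>+y. \<integral>\<^sup>+x. \<integral>\<^sup>+z. ennreal (\<psi> 1 (vec3 x y z)) \<partial>lborel \<partial>lborel \<partial>lborel)"
      by (simp add: h_def)
    also have "\<dots> = (\<integral>\<^sup>+x. \<integral>\<^sup>+y. \<integral>\<^sup>+z. ennreal (\<psi> 1 (vec3 x y z)) \<partial>lborel \<partial>lborel \<partial>lborel)"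
      by (rule lborel_pair.Fubini') measurable
    finally show ?thesis unfolding G_def by (subst nn_integral_vec3) auto
  qed
  define r where "r = (\<integral>x. \<phi> x ^ 6 \<partial>lborel)"
  define d where "d i = (\<integral>x. (partial_deriv i \<phi> x)\<^sup>2 \<partial>lborel)" for i
  have int_r: "integrable lborel (\<lambda>x. \<phi> x ^ 6)"
    by (intro integrable_continuous_compact_support continuous_intros cphi compact_support_subset[OF supp]) auto
  have int_d: "integrable lborel (\<lambda>x. (partial_deriv i \<phi> x)\<^sup>2)" for i
  proof (intro integrable_continuous_compact_support continuous_intros cont)
    show "compact (closure {x. (partial_deriv i \<phi> x)\<^sup>2 \<noteq> 0})"
      by (rule compact_closure_of_subset[OF supp]) (auto intro: partial_deriv_support)
  qed
  have nonneg: "r \<ge> 0" "d i \<ge> 0" for i by (auto simp: r_def d_def)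
  have r_nn: "(\<integral>\<^sup>+x. ennreal (\<phi> x ^ 6) \<partial>lborel) = ennreal r"
    unfolding r_def by (intro nn_integral_eq_integral int_r) auto
  have d_nn: "(\<integral>\<^sup>+x. ennreal ((partial_deriv i \<phi> x)\<^sup>2) \<partial>lborel) = ennreal (d i)" for i
    unfolding d_def by (intro nn_integral_eq_integral int_d) auto
  have G_le: "G i \<le> ennreal (4 * (sqrt r * sqrt (d i)))" for i
  proof -
    have "G i = 4 * (\<integral>\<^sup>+x. ennreal (\<bar>\<phi> x\<bar> ^ 3) * ennreal \<bar>partial_deriv i \<phi> x\<bar> \<partial>lborel)"
      unfolding G_def \<psi>_def
      by (subst nn_integral_cmult[symmetric]) (auto simp: abs_mult power_abs ennreal_mult mult.assoc)
    also have "\<dots> \<le> 4 * (esqrt (\<integral>\<^sup>+x. (ennreal (\<bar>\<phi> x\<bar> ^ 3))\<^sup>2 \<partial>lborel) * esqrt (\<integral>\<^sup>+x. (ennreal \<bar>partial_deriv i \<phi> x\<bar>)\<^sup>2 \<partial>lborel))"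
      by (intro mult_left_mono Cauchy_Schwarz_esqrt) auto
    also have "(\<integral>\<^sup>+x. (ennreal (\<bar>\<phi> x\<bar> ^ 3))\<^sup>2 \<partial>lborel) = ennreal r"
      unfolding r_nn[symmetric] by (intro nn_integral_cong) (simp add: ennreal_power power_mult[symmetric] flip: power_abs)
    also have "(\<integral>\<^sup>+x. (ennreal \<bar>partial_deriv i \<phi> x\<bar>)\<^sup>2 \<partial>lborel) = ennreal (d i)"
      unfolding d_nn[symmetric] by (intro nn_integral_cong) (simp add: ennreal_power)
    also have "4 * (esqrt (ennreal r) * esqrt (ennreal (d i))) = ennreal (4 * (sqrt r * sqrt (d i)))"
      using nonneg by (simp add: esqrt_ennreal ennreal_mult)
    finally show ?thesis .
  qed
  have esqrt_G: "esqrt (G i) \<le> ennreal (sqrt (4 * (sqrt r * sqrt (d i))))" for i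
  proof (rule ennreal_power2_le_imp_le)
    have "(ennreal (sqrt (4 * (sqrt r * sqrt (d i)))))\<^sup>2 = ennreal (4 * (sqrt r * sqrt (d i)))"
      using nonneg by (simp add: ennreal_power)
    then show "(esqrt (G i))\<^sup>2 \<le> (ennreal (sqrt (4 * (sqrt r * sqrt (d i)))))\<^sup>2"
      using G_le[of i] by simp
  qed
  have "ennreal r = (\<integral>\<^sup>+x. \<integral>\<^sup>+y. \<integral>\<^sup>+z. ennreal (\<phi> (vec3 x y z) ^ 6) \<partial>lborel \<partial>lborel \<partial>lborel)"
    unfolding r_nn[symmetric] by (rule nn_integral_vec3) measurable
  also have "\<dots> \<le> (\<integral>\<^sup>+x. \<integral>\<^sup>+y. \<integral>\<^sup>+z. esqrt (f x y) * esqrt (g x z) * esqrt (h y z) \<partial>lborel \<partial>lborel \<partial>lborel)"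
    by (intro nn_integral_mono prod)
  also have "\<dots> \<le> esqrt (G 3) * esqrt (G 2) * esqrt (G 1)"
    using Loomis_Whitney[OF meas] by (simp only: F Gg H)
  also have "\<dots> \<le> ennreal (sqrt (4 * (sqrt r * sqrt (d 3)))) * ennreal (sqrt (4 * (sqrt r * sqrt (d 2))))
      * ennreal (sqrt (4 * (sqrt r * sqrt (d 1))))"
    by (intro mult_mono esqrt_G) auto
  also have "\<dots> = ennreal (sqrt (4 * (sqrt r * sqrt (d 3))) * sqrt (4 * (sqrt r * sqrt (d 2)))
      * sqrt (4 * (sqrt r * sqrt (d 1))))"
    using nonneg by (simp add: ennreal_mult)
  finally have "r \<le> sqrt (4 * (sqrt r * sqrt (d 3))) * sqrt (4 * (sqrt r * sqrt (d 2))) * sqrt (4 * (sqrt r * sqrt (d 1)))"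
    using nonneg by (subst (asm) ennreal_le_iff) auto
  from fourth_root_algebra[OF nonneg(1) nonneg(2) nonneg(2) nonneg(2) this] show ?thesis
    by (simp add: r_def d_def mult_ac)
qed

section \<open>The space of weakly differentiable functions vanishing on the boundary\<close>

lemma partial_deriv_add:
  assumes "\<And>x. \<phi> differentiable (at x)" "\<And>x. \<psi> differentiable (at x)"
  shows "partial_deriv i (\<lambda>x. \<phi> x + \<psi> x) = (\<lambda>x. partial_deriv i \<phi> x + partial_deriv i \<psi> x)"
proof
  fix x
  have "((\<lambda>x. \<phi> x + \<psi> x) has_derivative
      (\<lambda>h. frechet_derivative \<phi> (at x) h + frechet_derivative \<psi> (at x) h)) (at x)"
    using assms by (intro has_derivative_add) (auto simp: frechet_derivative_works)
  from frechet_derivative_at[OF this]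
  show "partial_deriv i (\<lambda>x. \<phi> x + \<psi> x) x = partial_deriv i \<phi> x + partial_deriv i \<psi> x"
    by (simp add: partial_deriv_def fun_eq_iff)
qed

lemma partial_deriv_cmult:
  assumes "\<And>x. \<phi> differentiable (at x)"
  shows "partial_deriv i (\<lambda>x. c * \<phi> x) = (\<lambda>x. c * partial_deriv i \<phi> x)"
proof
  fix x
  have "((\<lambda>x. c * \<phi> x) has_derivative (\<lambda>h. c * frechet_derivative \<phi> (at x) h)) (at x)"
    using assms by (intro has_derivative_mult_right) (auto simp: frechet_derivative_works)
  from frechet_derivative_at[OF this]
  show "partial_deriv i (\<lambda>x. c * \<phi> x) x = c * partial_deriv i \<phi> x"
    by (simp add: partial_deriv_def fun_eq_iff)
qed

lemma times_differentiable_add: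
  "times_differentiable k \<phi> \<Longrightarrow> times_differentiable k \<psi> \<Longrightarrow> times_differentiable k (\<lambda>x. \<phi> x + \<psi> x)"
  by (induction k arbitrary: \<phi> \<psi>) (simp_all add: partial_deriv_add)

lemma times_differentiable_cmult:
  "times_differentiable k \<phi> \<Longrightarrow> times_differentiable k (\<lambda>x. c * \<phi> x)"
  by (induction k arbitrary: \<phi>) (simp_all add: partial_deriv_cmult)

lemma test_functionsD:
  assumes "\<phi> \<in> test_functions \<Omega>"
  shows "\<phi> differentiable (at x)" "continuous_on UNIV \<phi>" "continuous_on UNIV (partial_deriv i \<phi>)"
    "compact (closure {x. \<phi> x \<noteq> 0})" "closure {x. \<phi> x \<noteq> 0} \<subseteq> \<Omega>"
proof -
  have "times_differentiable (Suc (Suc 0)) \<phi>" using assms unfolding test_functions_def by blast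
  then have d: "\<And>x. \<phi> differentiable (at x)" "\<And>i x. partial_deriv i \<phi> differentiable (at x)" by auto
  then show "\<phi> differentiable (at x)" "continuous_on UNIV \<phi>" "continuous_on UNIV (partial_deriv i \<phi>)"
    by (auto intro!: differentiable_imp_continuous_on simp: differentiable_on_def)
  show "compact (closure {x. \<phi> x \<noteq> 0})" "closure {x. \<phi> x \<noteq> 0} \<subseteq> \<Omega>"
    using assms by (auto simp: test_functions_def)
qed

lemma square_integrable_continuous_compact_support:
  assumes "continuous_on UNIV h" "compact (closure {x. h x \<noteq> 0})"
  shows "square_integrable h"
proof -
  have "integrable lborel (\<lambda>x. (h x)\<^sup>2)"
    by (intro integrable_continuous_compact_support continuous_intros assms compact_support_subset[OF assms(2)]) auto
  moreover have [measurable]: "h \<in> borel_measurable borel"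
    using assms by (intro borel_measurable_continuous_onI)
  ultimately show ?thesis
    unfolding square_integrable_def by (auto simp: integrable_completion intro: measurable_completion)
qed

lemma square_integrable_test_function:
  assumes "\<phi> \<in> test_functions \<Omega>"
  shows "square_integrable \<phi>" "square_integrable (partial_deriv i \<phi>)"
proof -
  note D = test_functionsD[OF assms]
  show "square_integrable \<phi>" by (rule square_integrable_continuous_compact_support[OF D(2) D(4)])
  have "compact (closure {x. partial_deriv i \<phi> x \<noteq> 0})"
    by (rule compact_closure_of_subset[OF D(4)]) (auto intro: partial_deriv_support)
  then show "square_integrable (partial_deriv i \<phi>)"
    by (rule square_integrable_continuous_compact_support[OF D(3)])
qed

definition h1_embed :: "(real^3 \<Rightarrow> real) \<Rightarrow> h1" where
  "h1_embed \<phi> = (l2_class \<phi>, \<chi> i. l2_class (partial_deriv i \<phi>))"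

lemma H10_eq: "H10 \<Omega> = closure (h1_embed ` test_functions \<Omega>)"
  by (simp add: H10_def h1_embed_def[abs_def])

lemma subspace_closure:
  fixes S :: "'a::real_normed_vector set"
  assumes "subspace S"
  shows "subspace (closure S)"
proof (rule subspaceI)
  show "0 \<in> closure S" using subspace_0[OF assms] closure_subset by blast
next
  fix x y assume "x \<in> closure S" "y \<in> closure S"
  then obtain X Y where "\<And>n. X n \<in> S" "X \<longlonglongrightarrow> x" "\<And>n. Y n \<in> S" "Y \<longlonglongrightarrow> y"
    unfolding closure_sequential by blast
  then show "x + y \<in> closure S"
    unfolding closure_sequential
    by (intro exI[of _ "\<lambda>n. X n + Y n"] conjI allI subspace_add[OF assms] tendsto_add)
next
  fix c x assume "x \<in> closure S"
  then obtain X where "\<And>n. X n \<in> S" "X \<longlonglongrightarrow> x"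
    unfolding closure_sequential by blast
  then show "c *\<^sub>R x \<in> closure S"
    unfolding closure_sequential
    by (intro exI[of _ "\<lambda>n. c *\<^sub>R X n"] conjI allI subspace_scale[OF assms] tendsto_scaleR tendsto_const)
qed

lemma test_functions_add:
  assumes "\<phi> \<in> test_functions \<Omega>" "\<psi> \<in> test_functions \<Omega>"
  shows "(\<lambda>x. \<phi> x + \<psi> x) \<in> test_functions \<Omega>"
proof -
  have sub: "closure {x. \<phi> x + \<psi> x \<noteq> 0} \<subseteq> closure {x. \<phi> x \<noteq> 0} \<union> closure {x. \<psi> x \<noteq> 0}"
    unfolding closure_Un[symmetric] by (rule closure_mono) auto
  have "compact (closure {x. \<phi> x \<noteq> 0} \<union> closure {x. \<psi> x \<noteq> 0})"
    by (intro compact_Un test_functionsD[OF assms(1)] test_functionsD[OF assms(2)])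
  then have "compact (closure {x. \<phi> x + \<psi> x \<noteq> 0})"
    by (rule compact_closure_of_subset[OF _ order_trans[OF closure_subset sub]])
  moreover have "closure {x. \<phi> x + \<psi> x \<noteq> 0} \<subseteq> \<Omega>"
    using sub test_functionsD(5)[OF assms(1)] test_functionsD(5)[OF assms(2)] by blast
  ultimately show ?thesis
    using assms by (auto simp: test_functions_def intro: times_differentiable_add)
qed

lemma test_functions_cmult:
  assumes "\<phi> \<in> test_functions \<Omega>"
  shows "(\<lambda>x. c * \<phi> x) \<in> test_functions \<Omega>"
proof -
  have sub: "closure {x. c * \<phi> x \<noteq> 0} \<subseteq> closure {x. \<phi> x \<noteq> 0}" by (rule closure_mono) auto
  have "compact (closure {x. c * \<phi> x \<noteq> 0})"
    by (rule compact_support_subset[OF test_functionsD(4)[OF assms]]) auto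
  then show ?thesis
    using assms sub by (auto simp: test_functions_def intro: times_differentiable_cmult)
qed

lemma partial_deriv_zero: "partial_deriv i (\<lambda>x. 0) = (\<lambda>x. 0)"
  by (simp add: partial_deriv_def fun_eq_iff frechet_derivative_const)

lemma zero_test_function: "(\<lambda>x. 0) \<in> test_functions \<Omega>"
proof -
  have "times_differentiable k (\<lambda>x. 0)" for k
    by (induction k) (auto simp: partial_deriv_zero)
  then show ?thesis by (simp add: test_functions_def)
qed

lemma subspace_H10: "subspace (H10 \<Omega>)"
  unfolding H10_eq
proof (rule subspace_closure, rule subspaceI)
  have "h1_embed (\<lambda>x. 0) = 0"
    by (simp add: h1_embed_def partial_deriv_zero zero_prod_def vec_eq_iff zero_l2_def)
  then show "0 \<in> h1_embed ` test_functions \<Omega>" using zero_test_function by (metis image_eqI)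
next
  fix x y assume "x \<in> h1_embed ` test_functions \<Omega>" "y \<in> h1_embed ` test_functions \<Omega>"
  then obtain \<phi> \<psi> where \<phi>: "\<phi> \<in> test_functions \<Omega>" "x = h1_embed \<phi>" and \<psi>: "\<psi> \<in> test_functions \<Omega>" "y = h1_embed \<psi>"
    by blast
  have "x + y = h1_embed (\<lambda>x. \<phi> x + \<psi> x)"
    using \<phi> \<psi>
    by (simp add: h1_embed_def vec_eq_iff l2_class_add square_integrable_test_function
        partial_deriv_add test_functionsD(1))
  then show "x + y \<in> h1_embed ` test_functions \<Omega>" using test_functions_add[OF \<phi>(1) \<psi>(1)] by blast
next
  fix c x assume "x \<in> h1_embed ` test_functions \<Omega>"
  then obtain \<phi> where \<phi>: "\<phi> \<in> test_functions \<Omega>" "x = h1_embed \<phi>" by blast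
  have "c *\<^sub>R x = h1_embed (\<lambda>x. c * \<phi> x)"
    using \<phi>
    by (simp add: h1_embed_def vec_eq_iff l2_class_scaleR square_integrable_test_function
        partial_deriv_cmult test_functionsD(1))
  then show "c *\<^sub>R x \<in> h1_embed ` test_functions \<Omega>" using test_functions_cmult[OF \<phi>(1)] by blast
qed

lemma closed_H10: "closed (H10 \<Omega>)"
  by (simp add: H10_eq)

lemma subspace_L2: "subspace (L2 \<Omega>)"
proof (rule subspaceI)
  show "0 \<in> L2 \<Omega>" using fn_zero by (auto simp: L2_def elim: eventually_mono)
  show "u + v \<in> L2 \<Omega>" if "u \<in> L2 \<Omega>" "v \<in> L2 \<Omega>" for u v
  proof -
    have "AE x in lebesgue. x \<notin> \<Omega> \<longrightarrow> fn u x = 0" "AE x in lebesgue. x \<notin> \<Omega> \<longrightarrow> fn v x = 0"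
      using that by (auto simp: L2_def)
    then have "AE x in lebesgue. x \<notin> \<Omega> \<longrightarrow> fn (u + v) x = 0"
      using fn_add[of u v] by eventually_elim auto
    then show ?thesis by (simp add: L2_def)
  qed
  show "c *\<^sub>R u \<in> L2 \<Omega>" if "u \<in> L2 \<Omega>" for c u
  proof -
    have "AE x in lebesgue. x \<notin> \<Omega> \<longrightarrow> fn u x = 0" using that by (auto simp: L2_def)
    then have "AE x in lebesgue. x \<notin> \<Omega> \<longrightarrow> fn (c *\<^sub>R u) x = 0"
      using fn_scaleR[of c u] by eventually_elim auto
    then show ?thesis by (simp add: L2_def)
  qed
qed

lemma closed_L2: "closed (L2 \<Omega>)"
  unfolding closed_sequential_limits
proof (intro allI impI, elim conjE)
  fix X u assume X: "\<forall>n. X n \<in> L2 \<Omega>" and lim: "X \<longlonglongrightarrow> u"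
  obtain r :: "nat \<Rightarrow> nat" where "AE x in lebesgue. (\<lambda>n. fn (X (r n)) x) \<longlonglongrightarrow> fn u x"
    using l2_convergent_AE_subseq[OF lim] by blast
  moreover have "AE x in lebesgue. \<forall>n. x \<notin> \<Omega> \<longrightarrow> fn (X (r n)) x = 0"
    unfolding AE_all_countable using X by (simp add: L2_def)
  ultimately have "AE x in lebesgue. x \<notin> \<Omega> \<longrightarrow> fn u x = 0"
  proof eventually_elim
    case (elim x)
    show ?case
    proof
      assume "x \<notin> \<Omega>"
      then have "(\<lambda>n. 0) \<longlonglongrightarrow> fn u x" using elim by simp
      then show "fn u x = 0" by (simp add: LIMSEQ_const_iff)
    qed
  qed
  then show "u \<in> L2 \<Omega>" by (simp add: L2_def)
qed

lemma l2_class_in_L2: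
  assumes "square_integrable u" "\<And>x. u x \<noteq> 0 \<Longrightarrow> x \<in> \<Omega>"
  shows "l2_class u \<in> L2 \<Omega>"
proof -
  have "AE x in lebesgue. x \<notin> \<Omega> \<longrightarrow> fn (l2_class u) x = 0"
    using fn_l2_class[OF assms(1)] by eventually_elim (use assms(2) in auto)
  then show ?thesis by (simp add: L2_def)
qed

text \<open>Both properties are closed conditions, and they hold for test functions because
  derivatives vanish off the closed support.\<close>

lemma H10_in_L2:
  assumes "u \<in> H10 \<Omega>"
  shows "fst u \<in> L2 \<Omega>" "snd u $ i \<in> L2 \<Omega>"
proof -
  let ?C = "{u :: h1. fst u \<in> L2 \<Omega> \<and> (\<forall>i. snd u $ i \<in> L2 \<Omega>)}"
  have "closed ?C"
  proof -
    have "?C = fst -` L2 \<Omega> \<inter> (\<Inter>i. (\<lambda>u. snd u $ i) -` L2 \<Omega>)" by auto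
    also have "closed \<dots>"
      by (intro closed_Int closed_INT ballI closed_vimage closed_L2 continuous_intros)
    finally show ?thesis .
  qed
  moreover have "h1_embed ` test_functions \<Omega> \<subseteq> ?C"
  proof (intro image_subsetI CollectI conjI allI)
    fix \<phi> i assume \<phi>: "\<phi> \<in> test_functions \<Omega>"
    note D = test_functionsD(5)[OF \<phi>] closure_subset[of "{x. \<phi> x \<noteq> 0}"]
    show "fst (h1_embed \<phi>) \<in> L2 \<Omega>"
      unfolding h1_embed_def fst_conv
      by (rule l2_class_in_L2[OF square_integrable_test_function(1)[OF \<phi>]]) (use D in auto)
    show "snd (h1_embed \<phi>) $ i \<in> L2 \<Omega>"
      unfolding h1_embed_def snd_conv vec_lambda_beta
      by (rule l2_class_in_L2[OF square_integrable_test_function(2)[OF \<phi>]])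
         (use D partial_deriv_support in blast)
  qed
  ultimately have "H10 \<Omega> \<subseteq> ?C" unfolding H10_eq by (rule closure_minimal[rotated])
  then show "fst u \<in> L2 \<Omega>" "snd u $ i \<in> L2 \<Omega>" using assms by auto
qed

lemma subspace_Z0: "subspace (Z0 \<Omega>)"
  unfolding Z0_def by (intro subspace_Times subspace_H10 subspace_L2)

lemma closed_Z0: "closed (Z0 \<Omega>)"
  unfolding Z0_def by (intro closed_Times closed_H10 closed_L2)

lemma h1_embed_Sobolev:
  assumes \<phi>: "\<phi> \<in> test_functions \<Omega>"
  shows "(\<integral>\<^sup>+x. ennreal (\<phi> x ^ 6) \<partial>lebesgue) \<le> ennreal (4096 * norm (h1_embed \<phi>) ^ 6)"
proof -
  note D = test_functionsD[OF \<phi>]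
  have d: "(\<integral>x. (partial_deriv i \<phi> x)\<^sup>2 \<partial>lborel) \<le> (norm (h1_embed \<phi>))\<^sup>2" for i
  proof -
    have "(\<integral>x. (partial_deriv i \<phi> x)\<^sup>2 \<partial>lborel) = (\<integral>x. (partial_deriv i \<phi> x)\<^sup>2 \<partial>lebesgue)"
      by (rule integral_completion[symmetric])
         (auto intro!: borel_measurable_continuous_onI continuous_intros D)
    also have "\<dots> = (norm (snd (h1_embed \<phi>) $ i))\<^sup>2"
      by (simp add: norm_l2_class_square square_integrable_test_function[OF \<phi>] h1_embed_def)
    also have "\<dots> \<le> (norm (h1_embed \<phi>))\<^sup>2"
      using order_trans[OF Finite_Cartesian_Product.norm_nth_le norm_snd_le[of "snd (h1_embed \<phi>)" "fst (h1_embed \<phi>)"]]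
      by (intro power_mono) auto
    finally show ?thesis .
  qed
  have "(\<integral>\<^sup>+x. ennreal (\<phi> x ^ 6) \<partial>lebesgue) = (\<integral>\<^sup>+x. ennreal (\<phi> x ^ 6) \<partial>lborel)"
    by (rule nn_integral_completion)
  also have "\<dots> = ennreal (\<integral>x. \<phi> x ^ 6 \<partial>lborel)"
    by (intro nn_integral_eq_integral integrable_continuous_compact_support continuous_intros D
        compact_support_subset[OF D(4)]) auto
  also have "\<dots> \<le> ennreal (4096 * ((norm (h1_embed \<phi>))\<^sup>2 * (norm (h1_embed \<phi>))\<^sup>2 * (norm (h1_embed \<phi>))\<^sup>2))"
    by (rule ennreal_leI, rule order_trans[OF Gagliardo_Nirenberg_Sobolev[OF D(1,3,4)]])
       (intro mult_left_mono mult_mono d mult_nonneg_nonneg integral_nonneg_AE, auto)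
  also have "(norm (h1_embed \<phi>))\<^sup>2 * (norm (h1_embed \<phi>))\<^sup>2 * (norm (h1_embed \<phi>))\<^sup>2 = norm (h1_embed \<phi>) ^ 6"
    by (simp flip: power_add)
  finally show ?thesis .
qed

text \<open>Test functions approximate \<open>u\<close> in norm and, along a subsequence, a.e.;
  Fatou carries the sixth-power bound to the limit.\<close>

lemma H10_Sobolev:
  assumes "u \<in> H10 \<Omega>"
  shows "(\<integral>\<^sup>+x. ennreal (fn (fst u) x ^ 6) \<partial>lebesgue) \<le> ennreal (4096 * norm u ^ 6)"
proof -
  obtain e where e: "\<And>n. e n \<in> h1_embed ` test_functions \<Omega>" "e \<longlonglongrightarrow> u"
    using assms unfolding H10_eq closure_sequential by blast
  obtain r :: "nat \<Rightarrow> nat" where r: "strict_mono r"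
    and ae: "AE x in lebesgue. (\<lambda>n. fn (fst (e (r n))) x) \<longlonglongrightarrow> fn (fst u) x"
    using l2_convergent_AE_subseq[OF tendsto_fst[OF e(2)]] by blast
  have bound: "(\<integral>\<^sup>+x. ennreal (fn (fst (e n)) x ^ 6) \<partial>lebesgue) \<le> ennreal (4096 * norm (e n) ^ 6)" for n
  proof -
    obtain \<phi> where \<phi>: "\<phi> \<in> test_functions \<Omega>" "e n = h1_embed \<phi>" using e(1)[of n] by blast
    have "AE x in lebesgue. fn (fst (e n)) x = \<phi> x"
      using fn_l2_class[OF square_integrable_test_function(1)[OF \<phi>(1)]] by (simp add: \<phi>(2) h1_embed_def)
    then have "(\<integral>\<^sup>+x. ennreal (fn (fst (e n)) x ^ 6) \<partial>lebesgue) = (\<integral>\<^sup>+x. ennreal (\<phi> x ^ 6) \<partial>lebesgue)"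
      by (intro nn_integral_cong_AE) (auto elim: eventually_mono)
    then show ?thesis using h1_embed_Sobolev[OF \<phi>(1)] by (simp add: \<phi>(2))
  qed
  have "(\<integral>\<^sup>+x. ennreal (fn (fst u) x ^ 6) \<partial>lebesgue)
      = (\<integral>\<^sup>+x. liminf (\<lambda>n. ennreal (fn (fst (e (r n))) x ^ 6)) \<partial>lebesgue)"
  proof (rule nn_integral_cong_AE, use ae in eventually_elim)
    case (elim x)
    then have "(\<lambda>n. ennreal (fn (fst (e (r n))) x ^ 6)) \<longlonglongrightarrow> ennreal (fn (fst u) x ^ 6)"
      by (intro tendsto_intros)
    from lim_imp_Liminf[OF sequentially_bot this] show ?case by (rule sym)
  qed
  also have "\<dots> \<le> liminf (\<lambda>n. \<integral>\<^sup>+x. ennreal (fn (fst (e (r n))) x ^ 6) \<partial>lebesgue)"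
    by (rule nn_integral_liminf) simp
  also have "\<dots> \<le> liminf (\<lambda>n. ennreal (4096 * norm (e (r n)) ^ 6))"
    by (intro Liminf_mono always_eventually allI bound)
  also have "\<dots> = ennreal (4096 * norm u ^ 6)"
  proof (rule lim_imp_Liminf[OF sequentially_bot])
    have "(\<lambda>n. e (r n)) \<longlonglongrightarrow> u"
      using LIMSEQ_subseq_LIMSEQ[OF e(2) r] by (simp add: comp_def)
    then show "(\<lambda>n. ennreal (4096 * norm (e (r n)) ^ 6)) \<longlonglongrightarrow> ennreal (4096 * norm u ^ 6)"
      by (intro tendsto_intros)
  qed
  finally show ?thesis .
qed

text \<open>After rescaling this is \<open>X\<^sup>2 * Y \<le> X ^ 3 + Y ^ 3\<close>, where the
  larger of \<open>X\<close> and \<open>Y\<close> dominates. It takes the place of Hoelder with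
  exponents 3/2 and 3: if the sixth powers of \<open>s\<close> and \<open>t\<close> integrate to
  multiples of \<open>a ^ 6\<close> and \<open>b ^ 6\<close>, both terms become multiples of
  \<open>a ^ 4 * b\<^sup>2\<close>.\<close>

lemma Young_4_2:
  fixes s t a b :: real
  assumes "a > 0" "b > 0"
  shows "s ^ 4 * t\<^sup>2 \<le> b\<^sup>2 / a\<^sup>2 * s ^ 6 + a ^ 4 / b ^ 4 * t ^ 6"
proof -
  define X where "X = (s / a)\<^sup>2"
  define Y where "Y = (t / b)\<^sup>2"
  have nonneg: "X \<ge> 0" "Y \<ge> 0" by (auto simp: X_def Y_def)
  have "X\<^sup>2 * Y \<le> X ^ 3 + Y ^ 3"
  proof (cases "X \<le> Y")
    case True
    then have "X\<^sup>2 * Y \<le> Y\<^sup>2 * Y" using nonneg by (intro mult_right_mono power_mono)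
    also have "\<dots> = Y ^ 3" by (simp add: power3_eq_cube power2_eq_square)
    finally show ?thesis using zero_le_power[OF nonneg(1), of 3] zero_le_power[OF nonneg(2), of 3] by linarith
  next
    case False
    then have "X\<^sup>2 * Y \<le> X\<^sup>2 * X" using nonneg by (intro mult_left_mono) auto
    also have "\<dots> = X ^ 3" by (simp add: power3_eq_cube power2_eq_square)
    finally show ?thesis using zero_le_power[OF nonneg(1), of 3] zero_le_power[OF nonneg(2), of 3] by linarith
  qed
  then have "(a ^ 4 * b\<^sup>2) * (X\<^sup>2 * Y) \<le> (a ^ 4 * b\<^sup>2) * (X ^ 3 + Y ^ 3)"
    by (intro mult_left_mono) auto
  moreover have "(a ^ 4 * b\<^sup>2) * (X\<^sup>2 * Y) = s ^ 4 * t\<^sup>2"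
    using assms by (simp add: X_def Y_def power_divide flip: power_mult)
  moreover have "(a ^ 4 * b\<^sup>2) * (X ^ 3 + Y ^ 3) = b\<^sup>2 / a\<^sup>2 * s ^ 6 + a ^ 4 / b ^ 4 * t ^ 6"
  proof -
    have XY: "X ^ 3 = s ^ 6 / a ^ 6" "Y ^ 3 = t ^ 6 / b ^ 6"
      by (simp_all add: X_def Y_def power_divide flip: power_mult)
    have "(a ^ 4 * b\<^sup>2) * X ^ 3 = b\<^sup>2 / a\<^sup>2 * s ^ 6" "(a ^ 4 * b\<^sup>2) * Y ^ 3 = a ^ 4 / b ^ 4 * t ^ 6"
      using assms unfolding XY by (simp_all add: divide_simps eval_nat_numeral)
    then show ?thesis by (simp only: distrib_left)
  qed
  ultimately show ?thesis by simp
qed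

text \<open>The critical term: cubic growth bounds the squared difference of the nonlinearity at
  \<open>u1\<close> and \<open>u2\<close> by a multiple of
  \<open>(1 + u1 ^ 4 + u2 ^ 4) * w\<^sup>2\<close>, where \<open>w\<close> is
  \<open>u1 - u2\<close>.\<close>

abbreviation quartic_int :: "h1 \<Rightarrow> h1 \<Rightarrow> ennreal" where
  "quartic_int u w \<equiv> \<integral>\<^sup>+x. ennreal (fn (fst u) x ^ 4 * (fn (fst w) x)\<^sup>2) \<partial>lebesgue"

lemma H10_quartic_bound:
  assumes u: "u \<in> H10 \<Omega>" and w: "w \<in> H10 \<Omega>"
  shows "quartic_int u w \<le> ennreal (8192 * norm u ^ 4 * (norm w)\<^sup>2)"
proof (cases "u = 0 \<or> w = 0")
  case True
  have "AE x in lebesgue. fn (fst u) x ^ 4 * (fn (fst w) x)\<^sup>2 = 0"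
    using True fn_zero by (auto elim: eventually_mono)
  then have "quartic_int u w = 0"
    by (subst nn_integral_0_iff_AE) (auto elim: eventually_mono)
  then show ?thesis by simp
next
  case False
  \<comment> \<open>Taking the norms as the weights of \<open>Young_4_2\<close> balances the two
    terms: each contributes \<open>4096 * a ^ 4 * b\<^sup>2\<close>, which explains 8192.\<close>
  define a where "a = norm u"
  define b where "b = norm w"
  have ab: "a > 0" "b > 0" using False by (auto simp: a_def b_def)
  have "quartic_int u w
      \<le> (\<integral>\<^sup>+x. ennreal (b\<^sup>2 / a\<^sup>2) * ennreal (fn (fst u) x ^ 6) + ennreal (a ^ 4 / b ^ 4) * ennreal (fn (fst w) x ^ 6) \<partial>lebesgue)"
  proof (intro nn_integral_mono)
    fix x
    have "ennreal (fn (fst u) x ^ 4 * (fn (fst w) x)\<^sup>2)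
        \<le> ennreal (b\<^sup>2 / a\<^sup>2 * fn (fst u) x ^ 6 + a ^ 4 / b ^ 4 * fn (fst w) x ^ 6)"
      by (intro ennreal_leI Young_4_2 ab)
    also have "\<dots> = ennreal (b\<^sup>2 / a\<^sup>2) * ennreal (fn (fst u) x ^ 6) + ennreal (a ^ 4 / b ^ 4) * ennreal (fn (fst w) x ^ 6)"
      by (subst ennreal_plus) (simp_all flip: ennreal_mult)
    finally show "ennreal (fn (fst u) x ^ 4 * (fn (fst w) x)\<^sup>2)
        \<le> ennreal (b\<^sup>2 / a\<^sup>2) * ennreal (fn (fst u) x ^ 6) + ennreal (a ^ 4 / b ^ 4) * ennreal (fn (fst w) x ^ 6)" .
  qed
  also have "\<dots> = ennreal (b\<^sup>2 / a\<^sup>2) * (\<integral>\<^sup>+x. ennreal (fn (fst u) x ^ 6) \<partial>lebesgue)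
      + ennreal (a ^ 4 / b ^ 4) * (\<integral>\<^sup>+x. ennreal (fn (fst w) x ^ 6) \<partial>lebesgue)"
    by (subst nn_integral_add) (auto simp: nn_integral_cmult)
  also have "\<dots> \<le> ennreal (b\<^sup>2 / a\<^sup>2) * ennreal (4096 * a ^ 6) + ennreal (a ^ 4 / b ^ 4) * ennreal (4096 * b ^ 6)"
    unfolding a_def b_def by (intro add_mono mult_left_mono H10_Sobolev[OF u] H10_Sobolev[OF w]) auto
  also have "\<dots> = ennreal (b\<^sup>2 / a\<^sup>2 * (4096 * a ^ 6) + a ^ 4 / b ^ 4 * (4096 * b ^ 6))"
    using ab by (subst ennreal_plus) (simp_all flip: ennreal_mult)
  also have "b\<^sup>2 / a\<^sup>2 * (4096 * a ^ 6) + a ^ 4 / b ^ 4 * (4096 * b ^ 6) = 8192 * a ^ 4 * b\<^sup>2"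
  proof -
    have "b\<^sup>2 / a\<^sup>2 * (4096 * a ^ 6) = 4096 * a ^ 4 * b\<^sup>2" "a ^ 4 / b ^ 4 * (4096 * b ^ 6) = 4096 * a ^ 4 * b\<^sup>2"
      using ab by (simp_all add: divide_simps eval_nat_numeral)
    then show ?thesis by simp
  qed
  finally show ?thesis by (simp add: a_def b_def)
qed

section \<open>The elliptic form\<close>

lemma integrable_lebesgue_on:
  fixes f :: "'a::euclidean_space \<Rightarrow> real"
  assumes "\<Omega> \<in> sets lebesgue" "integrable lebesgue f"
  shows "integrable (lebesgue_on \<Omega>) f"
  using integrable_mult_indicator[OF assms] assms(1) by (simp add: integrable_restrict_space)

lemma AE_lebesgue_on:
  assumes "\<Omega> \<in> sets lebesgue" "AE x in lebesgue. P x"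
  shows "AE x in lebesgue_on \<Omega>. P x"
  using assms(2) by (subst AE_restrict_space_iff) (use assms(1) in \<open>auto elim: eventually_mono\<close>)

lemma integral_L2_square:
  assumes "\<Omega> \<in> sets lebesgue" "v \<in> L2 \<Omega>"
  shows "(\<integral>x. (fn v x)\<^sup>2 \<partial>lebesgue_on \<Omega>) = (norm v)\<^sup>2"
proof -
  have "(\<integral>x. (fn v x)\<^sup>2 \<partial>lebesgue_on \<Omega>) = (\<integral>x. indicator \<Omega> x *\<^sub>R (fn v x)\<^sup>2 \<partial>lebesgue)"
    using assms by (intro integral_restrict_space) simp
  also have "\<dots> = (\<integral>x. (fn v x)\<^sup>2 \<partial>lebesgue)"
  proof (rule integral_cong_AE)
    show "(\<lambda>x. indicator \<Omega> x *\<^sub>R (fn v x)\<^sup>2) \<in> borel_measurable lebesgue"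
      using assms(1) by measurable
    have "AE x in lebesgue. x \<notin> \<Omega> \<longrightarrow> fn v x = 0" using assms(2) by (simp add: L2_def)
    then show "AE x in lebesgue. indicator \<Omega> x *\<^sub>R (fn v x)\<^sup>2 = (fn v x)\<^sup>2"
      by eventually_elim (auto simp: indicator_def)
  qed simp
  finally show ?thesis by (simp add: norm_l2_square)
qed

lemma norm_h1_square:
  fixes u :: h1
  shows "(norm u)\<^sup>2 = (norm (fst u))\<^sup>2 + (\<Sum>i\<in>UNIV. (norm (snd u $ i))\<^sup>2)"
proof -
  have "(norm u)\<^sup>2 = (norm (fst u))\<^sup>2 + (norm (snd u))\<^sup>2"
    by (cases u) (simp add: norm_Pair)
  moreover have "(norm (snd u))\<^sup>2 = (\<Sum>i\<in>UNIV. (norm (snd u $ i))\<^sup>2)"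
    by (simp add: norm_vec_def L2_set_def sum_nonneg)
  ultimately show ?thesis by simp
qed

text \<open>Homogeneity in each argument permits normalising both to length 1, where the quadratic
  bound is \<open>2 * K\<close>.\<close>

lemma bilinear_bound_of_quadratic_bound:
  fixes b :: "'a::real_normed_vector \<Rightarrow> 'a \<Rightarrow> real"
  assumes S: "subspace S"
    and scale: "\<And>c u v. u \<in> S \<Longrightarrow> v \<in> S \<Longrightarrow> b (c *\<^sub>R u) v = c * b u v"
      "\<And>c u v. u \<in> S \<Longrightarrow> v \<in> S \<Longrightarrow> b u (c *\<^sub>R v) = c * b u v"
    and bound: "\<And>u v. u \<in> S \<Longrightarrow> v \<in> S \<Longrightarrow> \<bar>b u v\<bar> \<le> K * ((norm u)\<^sup>2 + (norm v)\<^sup>2)"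
    and uv: "u \<in> S" "v \<in> S"
  shows "\<bar>b u v\<bar> \<le> 2 * K * norm u * norm v"
proof (cases "u = 0 \<or> v = 0")
  case True
  then have "b u v = 0" using scale(1)[of u v 0] scale(2)[of u v 0] uv by auto
  then show ?thesis using True by auto
next
  case False
  define u' v' where "u' = (1 / norm u) *\<^sub>R u" and "v' = (1 / norm v) *\<^sub>R v"
  have S': "u' \<in> S" "v' \<in> S" using uv S by (auto simp: u'_def v'_def subspace_scale)
  have n: "norm u' = 1" "norm v' = 1" using False by (auto simp: u'_def v'_def)
  have "u = norm u *\<^sub>R u'" "v = norm v *\<^sub>R v'" using False by (auto simp: u'_def v'_def)
  then have "b u v = norm u * (norm v * b u' v')"
    using scale(1)[OF S'(1) uv(2), of "norm u"] scale(2)[OF S', of "norm v"] by metis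
  then have "\<bar>b u v\<bar> = norm u * norm v * \<bar>b u' v'\<bar>" by (simp add: abs_mult mult.assoc)
  also have "\<dots> \<le> norm u * norm v * (2 * K)"
    using bound[OF S'] n by (intro mult_left_mono) auto
  finally show ?thesis by (simp add: mult_ac)
qed

locale elliptic_form =
  fixes \<Omega> :: "(real^3) set" and A :: "real^3 \<Rightarrow> real^3^3" and \<beta> :: "real^3 \<Rightarrow> real" and a0 a1 lam1 :: real
  assumes open_\<Omega>: "open \<Omega>" and a0: "0 < a0"
    and A_Linfty: "\<And>i j. Linfty \<Omega> (\<lambda>x. A x $ i $ j)"
    and A_sym: "\<And>i j. AE x in lebesgue_on \<Omega>. A x $ i $ j = A x $ j $ i"
    and A_elliptic: "AE x in lebesgue_on \<Omega>. \<forall>\<xi>::real^3.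
           a0 * (norm \<xi>)\<^sup>2 \<le> (\<Sum>i\<in>UNIV. \<Sum>j\<in>UNIV. A x $ i $ j * \<xi> $ i * \<xi> $ j) \<and>
           (\<Sum>i\<in>UNIV. \<Sum>j\<in>UNIV. A x $ i $ j * \<xi> $ i * \<xi> $ j) \<le> a1 * (norm \<xi>)\<^sup>2"
    and \<beta>_meas: "\<beta> \<in> borel_measurable (lebesgue_on \<Omega>)"
    and \<beta>_form: "\<forall>\<nu>>0. \<exists>C\<nu>>0. \<forall>u\<in>H10 \<Omega>.
           (\<integral>\<^sup>+ x. ennreal (\<bar>\<beta> x\<bar> * (fn (fst u) x)\<^sup>2) \<partial>lebesgue_on \<Omega>)
             \<le> ennreal (\<nu> * (\<integral>x. (\<Sum>i\<in>UNIV. (grad u i x)\<^sup>2) \<partial>lebesgue_on \<Omega>)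
                        + C\<nu> * (\<integral>x. (fn (fst u) x)\<^sup>2 \<partial>lebesgue_on \<Omega>))"
    and lam1: "0 < lam1"
    and E_lower: "\<forall>u\<in>H10 \<Omega>. energy_form \<Omega> A \<beta> u u
           \<ge> lam1 * (\<integral>x. (fn (fst u) x)\<^sup>2 \<partial>lebesgue_on \<Omega>)"
begin

abbreviation "\<mu> \<equiv> lebesgue_on \<Omega>"

abbreviation a_form :: "h1 \<Rightarrow> h1 \<Rightarrow> real^3 \<Rightarrow> real" where
  "a_form u v x \<equiv> \<Sum>i\<in>UNIV. \<Sum>j\<in>UNIV. A x $ i $ j * grad u j x * grad v i x"

abbreviation "E \<equiv> energy_form \<Omega> A \<beta>"

lemma \<Omega>_sets: "\<Omega> \<in> sets lebesgue"
  using open_\<Omega> by (simp add: lmeasurable_iff_integrable borel_open)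

lemma fn_borel_on [measurable]: "fn u \<in> borel_measurable \<mu>"
  by (rule measurable_restrict_space1) (rule fn_borel)

lemma AE_\<mu>: "AE x in lebesgue. P x \<Longrightarrow> AE x in \<mu>. P x"
  by (rule AE_lebesgue_on[OF \<Omega>_sets])

lemma integrable_fn_mult: "integrable \<mu> (\<lambda>x. fn p x * fn q x)"
  by (intro integrable_lebesgue_on[OF \<Omega>_sets] integrable_mult_l2 square_integrable_fn)

lemma integrable_fn_square_on: "integrable \<mu> (\<lambda>x. (fn p x)\<^sup>2)"
  using integrable_fn_mult[of p p] by (simp add: power2_eq_square)

lemma integrable_A: "integrable \<mu> (\<lambda>x. A x $ i $ j * fn p x * fn q x)"
proof -
  obtain K where K: "AE x in \<mu>. \<bar>A x $ i $ j\<bar> \<le> K" and [measurable]: "(\<lambda>x. A x $ i $ j) \<in> borel_measurable \<mu>"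
    using A_Linfty[of i j] by (auto simp: Linfty_def)
  show ?thesis
  proof (rule Bochner_Integration.integrable_bound)
    show "integrable \<mu> (\<lambda>x. K * (fn p x * fn q x))"
      by (intro integrable_mult_right integrable_fn_mult)
    show "AE x in \<mu>. norm (A x $ i $ j * fn p x * fn q x) \<le> norm (K * (fn p x * fn q x))"
      using K
    proof eventually_elim
      case (elim x)
      then have "\<bar>A x $ i $ j\<bar> * (\<bar>fn p x\<bar> * \<bar>fn q x\<bar>) \<le> \<bar>K\<bar> * (\<bar>fn p x\<bar> * \<bar>fn q x\<bar>)"
        by (intro mult_right_mono) auto
      then show ?case by (simp add: abs_mult mult.assoc)
    qed
  qed measurable
qed

lemma norm_grad_square:
  assumes "u \<in> H10 \<Omega>"
  shows "(\<integral>x. (\<Sum>i\<in>UNIV. (grad u i x)\<^sup>2) \<partial>\<mu>) = (\<Sum>i\<in>UNIV. (norm (snd u $ i))\<^sup>2)"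
  by (subst Bochner_Integration.integral_sum)
     (simp_all add: integrable_fn_square_on integral_L2_square[OF \<Omega>_sets] H10_in_L2[OF assms])

lemma norm_fst_square:
  assumes "u \<in> H10 \<Omega>"
  shows "(\<integral>x. (fn (fst u) x)\<^sup>2 \<partial>\<mu>) = (norm (fst u))\<^sup>2"
  by (simp add: integral_L2_square[OF \<Omega>_sets] H10_in_L2[OF assms])

lemma integrable_\<beta>_square:
  assumes u: "u \<in> H10 \<Omega>"
  shows "integrable \<mu> (\<lambda>x. \<bar>\<beta> x\<bar> * (fn (fst u) x)\<^sup>2)"
proof (rule integrableI_nonneg)
  show "(\<lambda>x. \<bar>\<beta> x\<bar> * (fn (fst u) x)\<^sup>2) \<in> borel_measurable \<mu>"
    using \<beta>_meas by measurable
  \<comment> \<open>Any one value of \<open>\<nu>\<close> yields finiteness; here it is 1.\<close>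
  obtain c where "\<forall>u\<in>H10 \<Omega>. (\<integral>\<^sup>+ x. ennreal (\<bar>\<beta> x\<bar> * (fn (fst u) x)\<^sup>2) \<partial>\<mu>)
             \<le> ennreal (1 * (\<integral>x. (\<Sum>i\<in>UNIV. (grad u i x)\<^sup>2) \<partial>\<mu>) + c * (\<integral>x. (fn (fst u) x)\<^sup>2 \<partial>\<mu>))"
    using \<beta>_form[rule_format, of 1] by auto
  from bspec[OF this u] show "(\<integral>\<^sup>+ x. ennreal (\<bar>\<beta> x\<bar> * (fn (fst u) x)\<^sup>2) \<partial>\<mu>) < \<infinity>"
    by (rule le_less_trans) simp
qed simp

lemma \<beta>_bound:
  assumes "\<nu> > 0"
  obtains c where "c > 0" "\<And>u. u \<in> H10 \<Omega> \<Longrightarrow> (\<integral>x. \<bar>\<beta> x\<bar> * (fn (fst u) x)\<^sup>2 \<partial>\<mu>)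
      \<le> \<nu> * (\<Sum>i\<in>UNIV. (norm (snd u $ i))\<^sup>2) + c * (norm (fst u))\<^sup>2"
proof -
  obtain c where c: "c > 0" "\<forall>u\<in>H10 \<Omega>. (\<integral>\<^sup>+ x. ennreal (\<bar>\<beta> x\<bar> * (fn (fst u) x)\<^sup>2) \<partial>\<mu>)
             \<le> ennreal (\<nu> * (\<integral>x. (\<Sum>i\<in>UNIV. (grad u i x)\<^sup>2) \<partial>\<mu>) + c * (\<integral>x. (fn (fst u) x)\<^sup>2 \<partial>\<mu>))"
    using \<beta>_form[rule_format, OF assms] by blast
  have "(\<integral>x. \<bar>\<beta> x\<bar> * (fn (fst u) x)\<^sup>2 \<partial>\<mu>) \<le> \<nu> * (\<Sum>i\<in>UNIV. (norm (snd u $ i))\<^sup>2) + c * (norm (fst u))\<^sup>2"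
    if u: "u \<in> H10 \<Omega>" for u
  proof -
    have "(\<integral>\<^sup>+ x. ennreal (\<bar>\<beta> x\<bar> * (fn (fst u) x)\<^sup>2) \<partial>\<mu>) = ennreal (\<integral>x. \<bar>\<beta> x\<bar> * (fn (fst u) x)\<^sup>2 \<partial>\<mu>)"
      by (intro nn_integral_eq_integral integrable_\<beta>_square u) auto
    then have "ennreal (\<integral>x. \<bar>\<beta> x\<bar> * (fn (fst u) x)\<^sup>2 \<partial>\<mu>)
        \<le> ennreal (\<nu> * (\<Sum>i\<in>UNIV. (norm (snd u $ i))\<^sup>2) + c * (norm (fst u))\<^sup>2)"
      using bspec[OF c(2) u] by (simp add: norm_grad_square[OF u] norm_fst_square[OF u])
    moreover have "0 \<le> \<nu> * (\<Sum>i\<in>UNIV. (norm (snd u $ i))\<^sup>2) + c * (norm (fst u))\<^sup>2"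
      using assms c(1) by (intro add_nonneg_nonneg mult_nonneg_nonneg sum_nonneg) auto
    ultimately show ?thesis by (simp add: ennreal_le_iff)
  qed
  with c(1) that show ?thesis by blast
qed

lemma integrable_\<beta>:
  assumes "u \<in> H10 \<Omega>" "v \<in> H10 \<Omega>"
  shows "integrable \<mu> (\<lambda>x. \<beta> x * fn (fst u) x * fn (fst v) x)"
proof (rule Bochner_Integration.integrable_bound)
  show "integrable \<mu> (\<lambda>x. \<bar>\<beta> x\<bar> * (fn (fst u) x)\<^sup>2 + \<bar>\<beta> x\<bar> * (fn (fst v) x)\<^sup>2)"
    by (intro Bochner_Integration.integrable_add integrable_\<beta>_square assms)
  show "(\<lambda>x. \<beta> x * fn (fst u) x * fn (fst v) x) \<in> borel_measurable \<mu>"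
    using \<beta>_meas by measurable
  have "\<bar>s * t\<bar> \<le> s\<^sup>2 + t\<^sup>2" for s t :: real
    using sum_squares_bound[of "\<bar>s\<bar>" "\<bar>t\<bar>"] abs_ge_zero[of "s * t"]
    unfolding abs_mult power2_abs by linarith
  then have "\<bar>\<beta> x\<bar> * \<bar>fn (fst u) x * fn (fst v) x\<bar> \<le> \<bar>\<beta> x\<bar> * ((fn (fst u) x)\<^sup>2 + (fn (fst v) x)\<^sup>2)" for x
    by (intro mult_left_mono) auto
  then show "AE x in \<mu>. norm (\<beta> x * fn (fst u) x * fn (fst v) x)
      \<le> norm (\<bar>\<beta> x\<bar> * (fn (fst u) x)\<^sup>2 + \<bar>\<beta> x\<bar> * (fn (fst v) x)\<^sup>2)"
    by (simp add: abs_mult distrib_left mult.assoc)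
qed

lemma E_add:
  assumes "u \<in> H10 \<Omega>" "u' \<in> H10 \<Omega>" "v \<in> H10 \<Omega>"
  shows "E (u + u') v = E u v + E u' v"
proof -
  have 1: "(\<integral>x. a_form (u + u') v x \<partial>\<mu>) = (\<integral>x. a_form u v x + a_form u' v x \<partial>\<mu>)"
  proof (rule integral_cong_AE)
    have "AE x in \<mu>. \<forall>j. grad (u + u') j x = grad u j x + grad u' j x"
      unfolding AE_all_countable using AE_\<mu>[OF fn_add] by simp
    then show "AE x in \<mu>. a_form (u + u') v x = a_form u v x + a_form u' v x"
      by eventually_elim (simp add: distrib_left distrib_right sum.distrib)
  qed (intro borel_measurable_integrable Bochner_Integration.integrable_add Bochner_Integration.integrable_sum integrable_A)+
  have 2: "(\<integral>x. \<beta> x * fn (fst (u + u')) x * fn (fst v) x \<partial>\<mu>)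
      = (\<integral>x. \<beta> x * fn (fst u) x * fn (fst v) x + \<beta> x * fn (fst u') x * fn (fst v) x \<partial>\<mu>)"
  proof (rule integral_cong_AE)
    show "AE x in \<mu>. \<beta> x * fn (fst (u + u')) x * fn (fst v) x
        = \<beta> x * fn (fst u) x * fn (fst v) x + \<beta> x * fn (fst u') x * fn (fst v) x"
      using AE_\<mu>[OF fn_add[of "fst u" "fst u'"]] by eventually_elim (simp add: distrib_left distrib_right)
  qed (use \<beta>_meas in measurable)
  show ?thesis
    unfolding energy_form_def 1 2
    by (subst Bochner_Integration.integral_add
          Bochner_Integration.integral_add[OF integrable_\<beta>[OF assms(1,3)] integrable_\<beta>[OF assms(2,3)]];
        (intro Bochner_Integration.integrable_sum integrable_A)?; simp?)+
qed

lemma E_scaleR: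
  "E (c *\<^sub>R u) v = c * E u v"
proof -
  have 1: "(\<integral>x. a_form (c *\<^sub>R u) v x \<partial>\<mu>) = (\<integral>x. c * a_form u v x \<partial>\<mu>)"
  proof (rule integral_cong_AE)
    have "AE x in \<mu>. \<forall>j. grad (c *\<^sub>R u) j x = c * grad u j x"
      unfolding AE_all_countable using AE_\<mu>[OF fn_scaleR] by simp
    then show "AE x in \<mu>. a_form (c *\<^sub>R u) v x = c * a_form u v x"
      by eventually_elim (simp add: sum_distrib_left mult_ac)
  qed (intro borel_measurable_integrable integrable_mult_right Bochner_Integration.integrable_sum integrable_A)+
  have 2: "(\<integral>x. \<beta> x * fn (fst (c *\<^sub>R u)) x * fn (fst v) x \<partial>\<mu>)
      = (\<integral>x. c * (\<beta> x * fn (fst u) x * fn (fst v) x) \<partial>\<mu>)"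
  proof (rule integral_cong_AE)
    show "AE x in \<mu>. \<beta> x * fn (fst (c *\<^sub>R u)) x * fn (fst v) x = c * (\<beta> x * fn (fst u) x * fn (fst v) x)"
      using AE_\<mu>[OF fn_scaleR[of c "fst u"]] by eventually_elim simp
  qed (use \<beta>_meas in measurable)
  show ?thesis
    unfolding energy_form_def 1 2 by (simp add: distrib_left)
qed

lemma E_sym: "E u v = E v u"
proof -
  have "(\<integral>x. a_form u v x \<partial>\<mu>) = (\<integral>x. a_form v u x \<partial>\<mu>)"
  proof (rule integral_cong_AE)
    have "AE x in \<mu>. \<forall>i j. A x $ i $ j = A x $ j $ i"
      unfolding AE_all_countable using A_sym by simp
    then show "AE x in \<mu>. a_form u v x = a_form v u x"
    proof eventually_elim
      case (elim x)
      have "a_form u v x = (\<Sum>j\<in>UNIV. \<Sum>i\<in>UNIV. A x $ i $ j * grad u j x * grad v i x)"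
        by (rule sum.swap)
      also have "\<dots> = a_form v u x"
      proof (intro sum.cong refl)
        fix i j
        show "A x $ j $ i * grad u i x * grad v j x = A x $ i $ j * grad v j x * grad u i x"
          using spec[OF spec[OF elim], of i j] by simp
      qed
      finally show ?case .
    qed
  qed (intro borel_measurable_integrable Bochner_Integration.integrable_sum integrable_A)+
  then show ?thesis by (simp add: energy_form_def mult_ac)
qed

text \<open>With \<open>\<nu> = a0 / 2\<close> the potential consumes at most half of the
  ellipticity, and its \<open>L\<^sup>2\<close> remainder is paid for by \<open>E_lower\<close>. The
  energy norm is thus equivalent to the norm of the product type.\<close>

lemma E_diagonal_bounds:
  obtains c K where "c > 0" "K \<ge> 0" "\<And>u. u \<in> H10 \<Omega> \<Longrightarrow> c * (norm u)\<^sup>2 \<le> E u u"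
    "\<And>u. u \<in> H10 \<Omega> \<Longrightarrow> E u u \<le> K * (norm u)\<^sup>2"
proof -
  obtain C where C: "C > 0" "\<And>u. u \<in> H10 \<Omega> \<Longrightarrow> (\<integral>x. \<bar>\<beta> x\<bar> * (fn (fst u) x)\<^sup>2 \<partial>\<mu>)
      \<le> a0 / 2 * (\<Sum>i\<in>UNIV. (norm (snd u $ i))\<^sup>2) + C * (norm (fst u))\<^sup>2"
    using \<beta>_bound[of "a0 / 2"] a0 by auto
  \<comment> \<open>The squared norm is \<open>m + g\<close>, where \<open>m\<close> is at most
    \<open>E u u / lam1\<close> and \<open>g\<close> at most
    \<open>(2 / a0) * (1 + C / lam1) * E u u\<close>; \<open>c\<close> is the reciprocal of the sum
    of the two factors.\<close>
  define c where "c = 1 / (1 / lam1 + (2 / a0) * (1 + C / lam1))"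
  have c: "c > 0" unfolding c_def using lam1 a0 C by (intro divide_pos_pos add_pos_pos mult_pos_pos) auto
  define K where "K = max a1 0 + a0 / 2 + C"
  have main: "c * (norm u)\<^sup>2 \<le> E u u \<and> E u u \<le> K * (norm u)\<^sup>2" if u: "u \<in> H10 \<Omega>" for u
  proof -
    define g where "g = (\<Sum>i\<in>UNIV. (norm (snd u $ i))\<^sup>2)"
    define m where "m = (norm (fst u))\<^sup>2"
    have gm: "g \<ge> 0" "m \<ge> 0" "(norm u)\<^sup>2 = m + g"
      by (auto simp: g_def m_def norm_h1_square sum_nonneg)
    define P where "P = (\<integral>x. a_form u u x \<partial>\<mu>)"
    define b where "b = (\<integral>x. \<beta> x * fn (fst u) x * fn (fst u) x \<partial>\<mu>)"
    have E: "E u u = P + b" by (simp add: energy_form_def P_def b_def)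
    have int_grad: "integrable \<mu> (\<lambda>x. \<Sum>i\<in>UNIV. (grad u i x)\<^sup>2)"
      by (intro Bochner_Integration.integrable_sum integrable_fn_square_on)
    have g_int: "(\<integral>x. (\<Sum>i\<in>UNIV. (grad u i x)\<^sup>2) \<partial>\<mu>) = g"
      by (simp add: g_def norm_grad_square[OF u])
    have ell: "AE x in \<mu>. a0 * (\<Sum>i\<in>UNIV. (grad u i x)\<^sup>2) \<le> a_form u u x
        \<and> a_form u u x \<le> a1 * (\<Sum>i\<in>UNIV. (grad u i x)\<^sup>2)"
      using A_elliptic
    proof eventually_elim
      case (elim x)
      have "(norm (\<chi> i. grad u i x))\<^sup>2 = (\<Sum>i\<in>UNIV. (grad u i x)\<^sup>2)"
        by (simp add: norm_vec_def L2_set_def sum_nonneg)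
      moreover have "(\<Sum>i\<in>UNIV. \<Sum>j\<in>UNIV. A x $ i $ j * grad u i x * grad u j x)
          = a_form u u x"
        by (simp add: mult_ac)
      ultimately show ?case using spec[OF elim, of "\<chi> i. grad u i x"] by simp
    qed
    have int_P: "integrable \<mu> (\<lambda>x. a_form u u x)"
      by (intro Bochner_Integration.integrable_sum integrable_A)
    have "(\<integral>x. a0 * (\<Sum>i\<in>UNIV. (grad u i x)\<^sup>2) \<partial>\<mu>) \<le> P"
      unfolding P_def using ell
      by (intro integral_mono_AE integrable_mult_right int_grad int_P) (auto elim: eventually_mono)
    then have P1: "a0 * g \<le> P" by (simp add: g_int)
    have "P \<le> (\<integral>x. a1 * (\<Sum>i\<in>UNIV. (grad u i x)\<^sup>2) \<partial>\<mu>)"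
      unfolding P_def using ell
      by (intro integral_mono_AE integrable_mult_right int_grad int_P) (auto elim: eventually_mono)
    then have P2: "P \<le> a1 * g" by (simp add: g_int)
    have "\<bar>b\<bar> \<le> (\<integral>x. \<bar>\<beta> x\<bar> * (fn (fst u) x)\<^sup>2 \<partial>\<mu>)"
      unfolding b_def using integral_norm_bound[of \<mu> "\<lambda>x. \<beta> x * fn (fst u) x * fn (fst u) x"]
      by (simp add: abs_mult power2_eq_square mult.assoc abs_mult_self_eq)
    also have "\<dots> \<le> a0 / 2 * g + C * m" unfolding g_def m_def by (rule C(2)[OF u])
    finally have b: "\<bar>b\<bar> \<le> a0 / 2 * g + C * m" .
    have "lam1 * m \<le> E u u" using E_lower u by (simp add: m_def norm_fst_square)
    then have m: "m \<le> E u u / lam1" using lam1 by (simp add: field_simps)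
    have "a0 / 2 * g \<le> E u u + C * m" using P1 b E by (simp add: abs_le_iff)
    also have "\<dots> \<le> E u u + C * (E u u / lam1)" using m C by (intro add_left_mono mult_left_mono) auto
    finally have "g \<le> (2 / a0) * (1 + C / lam1) * E u u" using a0 by (simp add: field_simps)
    with m have "(norm u)\<^sup>2 \<le> (1 / lam1 + (2 / a0) * (1 + C / lam1)) * E u u"
      by (simp add: gm distrib_right)
    also have "\<dots> = E u u / c" by (simp add: c_def)
    finally have lower: "c * (norm u)\<^sup>2 \<le> E u u" using c by (simp add: field_simps)
    have "E u u \<le> max a1 0 * g + a0 / 2 * g + C * m"
      using P2 b E gm mult_right_mono[of a1 "max a1 0" g] by (simp add: abs_le_iff)
    also have "\<dots> \<le> max a1 0 * (m + g) + a0 / 2 * (m + g) + C * (m + g)"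
      using a0 C gm by (intro add_mono mult_left_mono) auto
    finally have "E u u \<le> K * (norm u)\<^sup>2" by (simp add: K_def gm algebra_simps)
    with lower show ?thesis by blast
  qed
  moreover have "K \<ge> 0" using a0 C by (simp add: K_def)
  ultimately show ?thesis using that c by blast
qed

text \<open>Positivity of the form at \<open>u + v\<close> and at \<open>u - v\<close> bounds twice
  the modulus of \<open>E u v\<close> by \<open>E u u + E v v\<close>; homogeneity then turns the
  sum of squares into a product.\<close>

lemma E_bounded:
  obtains K where "K \<ge> 0" "\<And>u v. u \<in> H10 \<Omega> \<Longrightarrow> v \<in> H10 \<Omega> \<Longrightarrow> \<bar>E u v\<bar> \<le> K * norm u * norm v"
proof -
  obtain c K where cK: "c > 0" "K \<ge> 0" "\<And>u. u \<in> H10 \<Omega> \<Longrightarrow> c * (norm u)\<^sup>2 \<le> E u u"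
    "\<And>u. u \<in> H10 \<Omega> \<Longrightarrow> E u u \<le> K * (norm u)\<^sup>2"
    using E_diagonal_bounds by blast
  note sub = subspace_add[OF subspace_H10] subspace_scale[OF subspace_H10]
  have 1: "\<bar>E u v\<bar> \<le> K * ((norm u)\<^sup>2 + (norm v)\<^sup>2)" if uv: "u \<in> H10 \<Omega>" "v \<in> H10 \<Omega>" for u v
  proof -
    have sq: "0 \<le> E u u + 2 * s * E u v + s\<^sup>2 * E v v" for s
    proof -
      have w: "u + s *\<^sub>R v \<in> H10 \<Omega>" using uv by (simp add: sub)
      have "0 \<le> c * (norm (u + s *\<^sub>R v))\<^sup>2" using cK by simp
      also have "\<dots> \<le> E (u + s *\<^sub>R v) (u + s *\<^sub>R v)" by (rule cK(3)[OF w])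
      also have "\<dots> = E u (u + s *\<^sub>R v) + s * E v (u + s *\<^sub>R v)"
        using uv w by (simp add: E_add E_scaleR sub)
      also have "\<dots> = E u u + 2 * s * E u v + s\<^sup>2 * E v v"
        using uv w by (simp add: E_sym[of u "u + _"] E_sym[of v "u + _"] E_add E_scaleR sub E_sym[of v u]
            power2_eq_square algebra_simps)
      finally show ?thesis .
    qed
    have "2 * \<bar>E u v\<bar> \<le> E u u + E v v" using sq[of 1] sq[of "-1"] by (simp add: abs_if)
    also have "\<dots> \<le> K * ((norm u)\<^sup>2 + (norm v)\<^sup>2)" using cK(4)[OF uv(1)] cK(4)[OF uv(2)] by (simp add: distrib_left)
    finally show ?thesis by simp
  qed
  have "\<bar>E u v\<bar> \<le> 2 * K * norm u * norm v" if uv: "u \<in> H10 \<Omega>" "v \<in> H10 \<Omega>" for u v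
    by (rule bilinear_bound_of_quadratic_bound[OF subspace_H10 _ _ 1 uv])
       (simp_all add: E_scaleR E_sym[of _ "_ *\<^sub>R _"], simp add: E_sym)
  then show ?thesis using that[of "2 * K"] cK(2) by simp
qed

end

section \<open>The Nemytskii operator\<close>

lemma C1_differentiable_has_deriv:
  assumes "h C1_differentiable_on UNIV"
  shows "(h has_real_derivative deriv h s) (at s)"
proof -
  obtain D where "(h has_vector_derivative D) (at s)"
    using assms by (auto simp: C1_differentiable_on_def)
  then have "(h has_real_derivative D) (at s)"
    by (simp add: has_real_derivative_iff_has_vector_derivative)
  with DERIV_imp_deriv[OF this] show ?thesis by simp
qed

text \<open>Comparing the derivative at \<open>s\<close> with that at 0 and using
  \<open>\<alpha> + \<gamma> = 2\<close> shows quadratic growth of the derivative. The mean value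
  theorem evaluates it between \<open>a\<close> and \<open>b\<close>, at a point whose square is at
  most \<open>a\<^sup>2 + b\<^sup>2\<close>.\<close>

lemma growth_of_Hoelder_derivative:
  fixes h :: "real \<Rightarrow> real"
  assumes h: "h C1_differentiable_on UNIV" and K: "\<bar>deriv h 0\<bar> \<le> K"
    and exps: "0 < \<gamma>" "\<gamma> \<le> 1" "1 \<le> \<alpha>" "\<alpha> + \<gamma> = 2" and C: "0 < C"
    and Hoelder: "\<And>s t. \<bar>deriv h s - deriv h t\<bar> \<le> C * (1 + \<bar>s\<bar> powr \<alpha> + \<bar>t\<bar> powr \<alpha>) * \<bar>s - t\<bar> powr \<gamma>"
  shows "\<bar>h a - h b\<bar> \<le> (K + 2 * C) * (1 + a\<^sup>2 + b\<^sup>2) * \<bar>a - b\<bar>"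
proof -
  have K0: "K \<ge> 0" using K by linarith
  have deriv_le: "\<bar>deriv h s\<bar> \<le> (K + 2 * C) * (1 + s\<^sup>2)" for s
  proof (cases "s = 0")
    case True
    then show ?thesis using K C by simp
  next
    case False
    have "\<bar>s\<bar> powr \<alpha> * \<bar>s\<bar> powr \<gamma> = s\<^sup>2"
      using False exps by (simp flip: powr_add)
    moreover have "\<bar>s\<bar> powr \<gamma> \<le> 1 + s\<^sup>2"
    proof (cases "\<bar>s\<bar> \<le> 1")
      case True
      then have "\<bar>s\<bar> powr \<gamma> \<le> 1" using exps powr_le1 by auto
      then show ?thesis by (simp add: add_increasing2)
    next
      case False
      then have "\<bar>s\<bar> powr \<gamma> \<le> \<bar>s\<bar> powr 2" using exps by (intro powr_mono) auto
      also have "\<bar>s\<bar> powr 2 = s\<^sup>2" using False by simp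
      finally show ?thesis by simp
    qed
    ultimately have "(1 + \<bar>s\<bar> powr \<alpha>) * \<bar>s\<bar> powr \<gamma> \<le> 2 * (1 + s\<^sup>2)" by (simp add: distrib_right)
    then have "C * ((1 + \<bar>s\<bar> powr \<alpha>) * \<bar>s\<bar> powr \<gamma>) \<le> C * (2 * (1 + s\<^sup>2))"
      using C by (intro mult_left_mono) auto
    moreover have "\<bar>deriv h s\<bar> \<le> K + C * ((1 + \<bar>s\<bar> powr \<alpha>) * \<bar>s\<bar> powr \<gamma>)"
      using Hoelder[of s 0] K exps by (simp add: mult.assoc)
    moreover have "K \<le> K * (1 + s\<^sup>2)" using K0 by (simp add: distrib_left)
    ultimately show ?thesis by (simp add: algebra_simps)
  qed
  have main: "\<bar>h y - h x\<bar> \<le> (K + 2 * C) * (1 + x\<^sup>2 + y\<^sup>2) * \<bar>y - x\<bar>" if xy: "x < y" for x y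
  proof -
    obtain z where z: "x < z" "z < y" "h y - h x = (y - x) * deriv h z"
      using MVT2[OF xy, of h "deriv h"] C1_differentiable_has_deriv[OF h] by blast
    have "z\<^sup>2 \<le> x\<^sup>2 + y\<^sup>2"
    proof (cases "z \<ge> 0")
      case True
      then have "z\<^sup>2 \<le> y\<^sup>2" using z by (intro power_mono) auto
      then show ?thesis by (simp add: add_increasing)
    next
      case False
      then have "(- z)\<^sup>2 \<le> (- x)\<^sup>2" using z by (intro power_mono) auto
      then show ?thesis by (simp add: add_increasing2)
    qed
    then have "(K + 2 * C) * (1 + z\<^sup>2) \<le> (K + 2 * C) * (1 + x\<^sup>2 + y\<^sup>2)"
      using K0 C by (intro mult_left_mono) auto
    with deriv_le[of z] have "\<bar>deriv h z\<bar> \<le> (K + 2 * C) * (1 + x\<^sup>2 + y\<^sup>2)" by linarith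
    then have "\<bar>deriv h z\<bar> * \<bar>y - x\<bar> \<le> (K + 2 * C) * (1 + x\<^sup>2 + y\<^sup>2) * \<bar>y - x\<bar>"
      by (intro mult_right_mono) auto
    then show ?thesis by (simp add: z(3) abs_mult mult.commute)
  qed
  show ?thesis
  proof (cases a b rule: linorder_cases)
    case less
    then show ?thesis using main[of a b] by (simp add: abs_minus_commute)
  next
    case greater
    then show ?thesis using main[of b a] by (simp add: add_ac)
  qed simp
qed

text \<open>\<open>g\<close> is the limit of the countably valued functions \<open>s n\<close>, for
  which the composition is measurable piece by piece. Continuity in the second argument gives the
  limit a.e., and completeness of Lebesgue measure does the rest.\<close>

lemma Caratheodory_measurable:
  fixes G :: "real^3 \<Rightarrow> real \<Rightarrow> real"
  assumes meas: "\<And>s. (\<lambda>x. G x s) \<in> borel_measurable lebesgue"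
    and cont: "AE x in lebesgue. continuous_on UNIV (G x)"
    and [measurable]: "g \<in> borel_measurable lebesgue"
  shows "(\<lambda>x. G x (g x)) \<in> borel_measurable lebesgue"
proof -
  define s where "s n x = real_of_int \<lfloor>real (Suc n) * g x\<rfloor> / real (Suc n)" for n x
  have s_lim: "(\<lambda>n. s n x) \<longlonglongrightarrow> g x" for x
  proof (rule LIM_zero_cancel, rule Lim_null_comparison)
    show "(\<lambda>n. 1 / real (Suc n)) \<longlonglongrightarrow> 0"
      using LIMSEQ_inverse_real_of_nat by (simp add: inverse_eq_divide)
    have "\<bar>s n x - g x\<bar> \<le> 1 / real (Suc n)" for n
    proof -
      have "s n x - g x = (real_of_int \<lfloor>real (Suc n) * g x\<rfloor> - real (Suc n) * g x) / real (Suc n)"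
        by (simp add: s_def diff_divide_distrib)
      moreover have "\<bar>real_of_int \<lfloor>real (Suc n) * g x\<rfloor> - real (Suc n) * g x\<bar> \<le> 1" by linarith
      ultimately show ?thesis by (simp add: divide_right_mono)
    qed
    then show "\<forall>\<^sub>F n in sequentially. norm (s n x - g x) \<le> 1 / real (Suc n)" by simp
  qed
  have [measurable]: "(\<lambda>x. G x (s n x)) \<in> borel_measurable lebesgue" for n
    unfolding s_def
    by (rule measurable_compose_countable[where f = "\<lambda>i x. G x (real_of_int i / real (Suc n))"
          and g = "\<lambda>x. \<lfloor>real (Suc n) * g x\<rfloor>"])
       (use meas in measurable)
  have "(\<lambda>x. lim (\<lambda>n. G x (s n x))) \<in> borel_measurable lebesgue"
    by (rule borel_measurable_lim_metric) simp
  then show ?thesis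
  proof (rule borel_measurable_AE)
    show "AE x in lebesgue. lim (\<lambda>n. G x (s n x)) = G x (g x)"
      using cont
    proof eventually_elim
      case (elim x)
      have "isCont (G x) (g x)" using elim by (simp add: continuous_on_eq_continuous_at)
      from isCont_tendsto_compose[OF this s_lim] show ?case by (rule limI)
    qed
  qed
qed

text \<open>Split \<open>u\<close> into the bounded \<open>e\<close>, which costs only the
  \<open>L\<^sup>2\<close> norm of \<open>w\<close>, and the small \<open>u - e\<close>, for which
  the Sobolev bound has a small constant. The factor 8 is that of
  \<open>(p + q) ^ 4 \<le> 8 * p ^ 4 + 8 * q ^ 4\<close>, and 65536 is 8 times 8192.\<close>

lemma H10_quartic_approx:
  assumes u: "u \<in> H10 \<Omega>" and w: "w \<in> H10 \<Omega>" and e: "e \<in> H10 \<Omega>"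
    and B: "AE x in lebesgue. \<bar>fn (fst e) x\<bar> \<le> B" and \<eta>: "norm (u - e) \<le> \<eta>"
  shows "quartic_int u w \<le> ennreal (8 * B ^ 4 * (norm (fst w))\<^sup>2 + 65536 * \<eta> ^ 4 * (norm w)\<^sup>2)"
proof -
  let ?r = "u - e"
  have pw: "(p + q) ^ 4 \<le> 8 * p ^ 4 + 8 * q ^ 4" for p q :: real
  proof -
    have sq: "(x + y)\<^sup>2 \<le> 2 * x\<^sup>2 + 2 * y\<^sup>2" for x y :: real
      using sum_squares_bound[of x y] by (simp add: power2_sum)
    have "((p + q)\<^sup>2)\<^sup>2 \<le> (2 * p\<^sup>2 + 2 * q\<^sup>2)\<^sup>2" by (intro power_mono sq) auto
    also have "\<dots> \<le> 2 * (2 * p\<^sup>2)\<^sup>2 + 2 * (2 * q\<^sup>2)\<^sup>2" by (rule sq)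
    finally show ?thesis by (simp add: power_mult_distrib flip: power_mult)
  qed
  have "quartic_int u w
      \<le> (\<integral>\<^sup>+x. ennreal (8 * B ^ 4) * ennreal ((fn (fst w) x)\<^sup>2) + 8 * ennreal (fn (fst ?r) x ^ 4 * (fn (fst w) x)\<^sup>2) \<partial>lebesgue)"
  proof (rule nn_integral_mono_AE)
    show "AE x in lebesgue. ennreal (fn (fst u) x ^ 4 * (fn (fst w) x)\<^sup>2)
        \<le> ennreal (8 * B ^ 4) * ennreal ((fn (fst w) x)\<^sup>2) + 8 * ennreal (fn (fst ?r) x ^ 4 * (fn (fst w) x)\<^sup>2)"
      using B fn_diff[of "fst u" "fst e"]
    proof eventually_elim
      case (elim x)
      have "fn (fst e) x ^ 4 = \<bar>fn (fst e) x\<bar> ^ 4" by simp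
      also have "\<dots> \<le> B ^ 4" using elim by (intro power_mono) auto
      finally have "fn (fst u) x ^ 4 \<le> 8 * B ^ 4 + 8 * fn (fst ?r) x ^ 4"
        using pw[of "fn (fst e) x" "fn (fst ?r) x"] elim by simp
      then have "fn (fst u) x ^ 4 * (fn (fst w) x)\<^sup>2 \<le> (8 * B ^ 4 + 8 * fn (fst ?r) x ^ 4) * (fn (fst w) x)\<^sup>2"
        by (intro mult_right_mono) auto
      then have "ennreal (fn (fst u) x ^ 4 * (fn (fst w) x)\<^sup>2)
          \<le> ennreal (8 * B ^ 4 * (fn (fst w) x)\<^sup>2 + 8 * (fn (fst ?r) x ^ 4 * (fn (fst w) x)\<^sup>2))"
        by (intro ennreal_leI) (simp add: algebra_simps)
      also have "\<dots> = ennreal (8 * B ^ 4) * ennreal ((fn (fst w) x)\<^sup>2) + 8 * ennreal (fn (fst ?r) x ^ 4 * (fn (fst w) x)\<^sup>2)"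
        by (subst ennreal_plus) (auto simp: ennreal_mult)
      finally show ?case .
    qed
  qed
  also have "\<dots> = ennreal (8 * B ^ 4) * (\<integral>\<^sup>+x. ennreal ((fn (fst w) x)\<^sup>2) \<partial>lebesgue)
      + 8 * quartic_int ?r w"
    by (subst nn_integral_add) (auto simp: nn_integral_cmult)
  also have "\<dots> \<le> ennreal (8 * B ^ 4) * ennreal ((norm (fst w))\<^sup>2) + 8 * ennreal (8192 * \<eta> ^ 4 * (norm w)\<^sup>2)"
  proof (intro add_mono mult_left_mono)
    have "quartic_int ?r w \<le> ennreal (8192 * norm ?r ^ 4 * (norm w)\<^sup>2)"
      using u e w by (intro H10_quartic_bound[of _ \<Omega>] subspace_diff[OF subspace_H10])
    also have "\<dots> \<le> ennreal (8192 * \<eta> ^ 4 * (norm w)\<^sup>2)"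
      using \<eta> by (intro ennreal_leI mult_right_mono mult_left_mono power_mono) auto
    finally show "quartic_int ?r w \<le> ennreal (8192 * \<eta> ^ 4 * (norm w)\<^sup>2)" .
  qed (auto simp: nn_integral_fn_square)
  also have "\<dots> = ennreal (8 * B ^ 4 * (norm (fst w))\<^sup>2 + 65536 * \<eta> ^ 4 * (norm w)\<^sup>2)"
  proof -
    have "8 * ennreal (8192 * \<eta> ^ 4 * (norm w)\<^sup>2) = ennreal (65536 * \<eta> ^ 4 * (norm w)\<^sup>2)"
      using ennreal_mult[of 8 "8192 * \<eta> ^ 4 * (norm w)\<^sup>2"] by (simp add: mult.assoc)
    then show ?thesis by (simp add: ennreal_mult)
  qed
  finally show ?thesis .
qed

text \<open>Test functions are dense and each is bounded; compactness selects finitely many whose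
  \<open>\<eta>\<close>-balls cover \<open>K\<close>, so that one \<open>B\<close> serves all of
  \<open>K\<close>.\<close>

lemma H10_compact_approx:
  assumes K: "compact K" "K \<subseteq> H10 \<Omega>" and \<eta>: "\<eta> > 0"
  shows "\<exists>B\<ge>0. \<forall>u\<in>K. \<exists>e\<in>H10 \<Omega>. (AE x in lebesgue. \<bar>fn (fst e) x\<bar> \<le> B) \<and> norm (u - e) \<le> \<eta>"
proof -
  have cover: "K \<subseteq> (\<Union>\<phi>\<in>test_functions \<Omega>. ball (h1_embed \<phi>) \<eta>)"
  proof
    fix u assume "u \<in> K"
    then have "u \<in> closure (h1_embed ` test_functions \<Omega>)" using K(2) by (auto simp: H10_eq)
    then show "u \<in> (\<Union>\<phi>\<in>test_functions \<Omega>. ball (h1_embed \<phi>) \<eta>)"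
      using \<eta> unfolding closure_approachable by auto
  qed
  obtain F where F: "F \<subseteq> test_functions \<Omega>" "finite F" "K \<subseteq> (\<Union>\<phi>\<in>F. ball (h1_embed \<phi>) \<eta>)"
    by (rule compactE_image[OF K(1) _ cover]) auto
  have "\<exists>b. \<forall>x. \<bar>\<phi> x\<bar> \<le> b" if "\<phi> \<in> F" for \<phi>
  proof -
    have \<phi>: "\<phi> \<in> test_functions \<Omega>" using that F by blast
    have "bounded (\<phi> ` closure {x. \<phi> x \<noteq> 0})"
      by (intro compact_imp_bounded compact_continuous_image test_functionsD(4)[OF \<phi>]
          continuous_on_subset[OF test_functionsD(2)[OF \<phi>]]) simp
    then obtain b where b: "\<And>x. x \<in> closure {x. \<phi> x \<noteq> 0} \<Longrightarrow> \<bar>\<phi> x\<bar> \<le> b"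
      by (auto simp: bounded_iff)
    have "\<bar>\<phi> x\<bar> \<le> max b 0" for x
      using b[of x] closure_subset[of "{x. \<phi> x \<noteq> 0}"] by (cases "\<phi> x = 0") (auto simp: le_max_iff_disj)
    then show ?thesis by blast
  qed
  then obtain b where b: "\<And>\<phi> x. \<phi> \<in> F \<Longrightarrow> \<bar>\<phi> x\<bar> \<le> b \<phi>" by metis
  define B where "B = (\<Sum>\<phi>\<in>F. \<bar>b \<phi>\<bar>)"
  have B: "\<bar>\<phi> x\<bar> \<le> B" if "\<phi> \<in> F" for \<phi> x
  proof -
    have "\<bar>b \<phi>\<bar> \<le> B" unfolding B_def using that F(2) by (intro member_le_sum) auto
    then show ?thesis using b[OF that, of x] by linarith
  qed
  have "\<exists>e\<in>H10 \<Omega>. (AE x in lebesgue. \<bar>fn (fst e) x\<bar> \<le> B) \<and> norm (u - e) \<le> \<eta>" if uK: "u \<in> K" for u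
  proof -
    obtain \<phi> where \<phi>: "\<phi> \<in> F" "dist (h1_embed \<phi>) u < \<eta>" using uK F(3) by auto
    then have \<phi>': "\<phi> \<in> test_functions \<Omega>" using F by blast
    have "h1_embed \<phi> \<in> H10 \<Omega>" unfolding H10_eq by (intro subsetD[OF closure_subset] imageI \<phi>')
    moreover have "AE x in lebesgue. \<bar>fn (fst (h1_embed \<phi>)) x\<bar> \<le> B"
      using fn_l2_class[OF square_integrable_test_function(1)[OF \<phi>']]
      by eventually_elim (use B[OF \<phi>(1)] in \<open>simp add: h1_embed_def\<close>)
    moreover have "norm (u - h1_embed \<phi>) \<le> \<eta>" using \<phi>(2) by (simp add: dist_norm norm_minus_commute)
    ultimately show ?thesis by blast
  qed
  moreover have "B \<ge> 0" by (simp add: B_def sum_nonneg)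
  ultimately show ?thesis by blast
qed

locale cubic_nonlinearity =
  fixes \<Omega> :: "(real^3) set" and f :: "real^3 \<Rightarrow> real \<Rightarrow> real" and c :: real
  assumes open_\<Omega>: "open \<Omega>"
    and f_meas: "\<And>u. (\<lambda>x. f x u) \<in> borel_measurable (lebesgue_on \<Omega>)"
    and f_0: "integrable (lebesgue_on \<Omega>) (\<lambda>x. (f x 0)\<^sup>2)"
    and f_cont: "AE x in lebesgue_on \<Omega>. continuous_on UNIV (f x)"
    and c: "c \<ge> 0"
    and growth: "AE x in lebesgue_on \<Omega>. \<forall>a b. \<bar>f x a - f x b\<bar> \<le> c * (1 + a\<^sup>2 + b\<^sup>2) * \<bar>a - b\<bar>"
begin

definition G :: "real^3 \<Rightarrow> real \<Rightarrow> real" where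
  "G x s = (if x \<in> \<Omega> then f x s else 0)"

lemma sets_\<Omega>: "\<Omega> \<in> sets lebesgue"
  using open_\<Omega> by (simp add: borel_open)

lemma nemytskii_G: "nemytskii \<Omega> f u = l2_class (\<lambda>x. G x (fn (fst u) x))"
  by (simp add: nemytskii_def G_def)

lemma G_growth: "AE x in lebesgue. \<forall>a b. \<bar>G x a - G x b\<bar> \<le> c * (1 + a\<^sup>2 + b\<^sup>2) * \<bar>a - b\<bar>"
proof -
  have "AE x in lebesgue. x \<in> \<Omega> \<longrightarrow> (\<forall>a b. \<bar>f x a - f x b\<bar> \<le> c * (1 + a\<^sup>2 + b\<^sup>2) * \<bar>a - b\<bar>)"
    using growth sets_\<Omega> by (simp add: AE_restrict_space_iff)
  then show ?thesis
    by eventually_elim (use c in \<open>auto simp: G_def\<close>)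
qed

lemma G_measurable [measurable]:
  assumes "g \<in> borel_measurable lebesgue"
  shows "(\<lambda>x. G x (g x)) \<in> borel_measurable lebesgue"
proof (rule Caratheodory_measurable[OF _ _ assms])
  show "(\<lambda>x. G x s) \<in> borel_measurable lebesgue" for s
    unfolding G_def by (rule borel_measurable_if_I[OF f_meas sets_\<Omega>])
  have "AE x in lebesgue. x \<in> \<Omega> \<longrightarrow> continuous_on UNIV (f x)"
    using f_cont sets_\<Omega> by (simp add: AE_restrict_space_iff)
  then show "AE x in lebesgue. continuous_on UNIV (G x)"
  proof eventually_elim
    case (elim x)
    then show ?case by (cases "x \<in> \<Omega>") (auto simp: G_def[abs_def])
  qed
qed

lemma square_integrable_G_0: "square_integrable (\<lambda>x. G x 0)"
proof -
  have "integrable lebesgue (\<lambda>x. indicator \<Omega> x *\<^sub>R (f x 0)\<^sup>2)"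
    using f_0 sets_\<Omega> by (simp add: integrable_restrict_space)
  moreover have "(\<lambda>x. indicator \<Omega> x *\<^sub>R (f x 0)\<^sup>2) = (\<lambda>x. (G x 0)\<^sup>2)"
    by (auto simp: G_def indicator_def)
  ultimately show ?thesis by (simp add: square_integrable_def)
qed

text \<open>The growth bound is squared pointwise. Working in \<open>ennreal\<close> makes the
  estimate available before square integrability of the nonlinearity is known, and it is then used
  to prove just that.\<close>

lemma nn_integral_G_diff:
  assumes H: "u1 \<in> H10 \<Omega>" "u2 \<in> H10 \<Omega>" and w: "w = u1 - u2"
  shows "(\<integral>\<^sup>+x. ennreal ((G x (fn (fst u1) x) - G x (fn (fst u2) x))\<^sup>2) \<partial>lebesgue)
    \<le> ennreal (3 * c\<^sup>2) * (ennreal ((norm (fst w))\<^sup>2)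
        + quartic_int u1 w + quartic_int u2 w)"
proof -
  have sq3: "(1 + p + q)\<^sup>2 \<le> 3 * (1 + p\<^sup>2 + q\<^sup>2)" for p q :: real
  proof -
    have "0 \<le> (1 - p)\<^sup>2 + (1 - q)\<^sup>2 + (p - q)\<^sup>2" by simp
    then show ?thesis by (simp add: power2_eq_square algebra_simps)
  qed
  have "(\<integral>\<^sup>+x. ennreal ((G x (fn (fst u1) x) - G x (fn (fst u2) x))\<^sup>2) \<partial>lebesgue)
      \<le> (\<integral>\<^sup>+x. ennreal (3 * c\<^sup>2) * (ennreal ((fn (fst w) x)\<^sup>2)
          + ennreal (fn (fst u1) x ^ 4 * (fn (fst w) x)\<^sup>2) + ennreal (fn (fst u2) x ^ 4 * (fn (fst w) x)\<^sup>2)) \<partial>lebesgue)"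
  proof (rule nn_integral_mono_AE, use G_growth fn_diff[of "fst u1" "fst u2"] in eventually_elim)
    case (elim x)
    let ?a = "fn (fst u1) x" and ?b = "fn (fst u2) x" and ?w = "fn (fst w) x"
    have w': "?a - ?b = ?w" using elim by (simp add: w)
    have "\<bar>G x ?a - G x ?b\<bar> \<le> c * (1 + ?a\<^sup>2 + ?b\<^sup>2) * \<bar>?w\<bar>"
      using elim(1) w' by metis
    then have "\<bar>G x ?a - G x ?b\<bar>\<^sup>2 \<le> (c * (1 + ?a\<^sup>2 + ?b\<^sup>2) * \<bar>?w\<bar>)\<^sup>2"
      by (intro power_mono) auto
    then have "(G x ?a - G x ?b)\<^sup>2 \<le> c\<^sup>2 * ((1 + ?a\<^sup>2 + ?b\<^sup>2)\<^sup>2 * ?w\<^sup>2)"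
      by (simp add: power_mult_distrib mult.assoc)
    also have "\<dots> \<le> c\<^sup>2 * ((3 * (1 + (?a\<^sup>2)\<^sup>2 + (?b\<^sup>2)\<^sup>2)) * ?w\<^sup>2)"
      by (intro mult_left_mono mult_right_mono sq3) auto
    also have "\<dots> = 3 * c\<^sup>2 * (?w\<^sup>2 + ?a ^ 4 * ?w\<^sup>2 + ?b ^ 4 * ?w\<^sup>2)"
      by (simp add: algebra_simps flip: power_mult)
    finally have "ennreal ((G x ?a - G x ?b)\<^sup>2) \<le> ennreal (3 * c\<^sup>2 * (?w\<^sup>2 + ?a ^ 4 * ?w\<^sup>2 + ?b ^ 4 * ?w\<^sup>2))"
      by (rule ennreal_leI)
    also have "\<dots> = ennreal (3 * c\<^sup>2) * ennreal (?w\<^sup>2 + ?a ^ 4 * ?w\<^sup>2 + ?b ^ 4 * ?w\<^sup>2)"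
      by (rule ennreal_mult) auto
    also have "ennreal (?w\<^sup>2 + ?a ^ 4 * ?w\<^sup>2 + ?b ^ 4 * ?w\<^sup>2) = ennreal (?w\<^sup>2) + ennreal (?a ^ 4 * ?w\<^sup>2) + ennreal (?b ^ 4 * ?w\<^sup>2)"
      by (simp add: ennreal_plus)
    finally show ?case .
  qed
  also have "\<dots> = ennreal (3 * c\<^sup>2) * (ennreal ((norm (fst w))\<^sup>2)
        + quartic_int u1 w + quartic_int u2 w)"
    by (subst nn_integral_cmult, simp, subst nn_integral_add, simp, simp, subst nn_integral_add, simp, simp)
       (simp add: nn_integral_fn_square)
  finally show ?thesis .
qed

text \<open>Comparison with the zero function: there the nonlinearity is square integrable by
  \<open>f_0\<close>, and the difference is controlled by the Sobolev bound.\<close>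

lemma square_integrable_G:
  assumes u: "u \<in> H10 \<Omega>"
  shows "square_integrable (\<lambda>x. G x (fn (fst u) x))"
proof -
  have zero: "0 \<in> H10 \<Omega>" by (rule subspace_0[OF subspace_H10])
  have "square_integrable (\<lambda>x. G x (fn (fst u) x) - G x (fn (fst (0::h1)) x))"
  proof (rule square_integrable_nn_integral)
    have "(\<integral>\<^sup>+x. ennreal ((G x (fn (fst u) x) - G x (fn (fst (0::h1)) x))\<^sup>2) \<partial>lebesgue)
        \<le> ennreal (3 * c\<^sup>2) * (ennreal ((norm (fst u))\<^sup>2)
          + quartic_int u u + quartic_int (0::h1) u)"
      by (rule nn_integral_G_diff[OF u zero]) simp
    also have "\<dots> \<le> ennreal (3 * c\<^sup>2) * (ennreal ((norm (fst u))\<^sup>2) + ennreal (8192 * norm u ^ 4 * (norm u)\<^sup>2)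
          + ennreal (8192 * norm (0::h1) ^ 4 * (norm u)\<^sup>2))"
      by (intro mult_left_mono add_mono order_refl H10_quartic_bound[OF u u] H10_quartic_bound[OF zero u]) simp
    also have "\<dots> < \<infinity>" by (simp add: ennreal_mult_less_top)
    finally show "(\<integral>\<^sup>+x. ennreal ((G x (fn (fst u) x) - G x (fn (fst (0::h1)) x))\<^sup>2) \<partial>lebesgue) < \<infinity>" .
  qed measurable
  moreover have "square_integrable (\<lambda>x. G x (fn (fst (0::h1)) x))"
  proof -
    have "AE x in lebesgue. (G x 0)\<^sup>2 = (G x (fn (fst (0::h1)) x))\<^sup>2"
      using fn_zero by (auto elim: eventually_mono)
    then have "integrable lebesgue (\<lambda>x. (G x (fn (fst (0::h1)) x))\<^sup>2)"
      using square_integrable_G_0 unfolding square_integrable_def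
      by (subst integrable_cong_AE[symmetric, where f = "\<lambda>x. (G x 0)\<^sup>2"]) auto
    then show ?thesis by (simp add: square_integrable_def)
  qed
  ultimately have "square_integrable (\<lambda>x. (G x (fn (fst u) x) - G x (fn (fst (0::h1)) x)) + G x (fn (fst (0::h1)) x))"
    by (rule square_integrable_add)
  then show ?thesis by simp
qed

lemma nemytskii_in_L2:
  assumes "u \<in> H10 \<Omega>"
  shows "nemytskii \<Omega> f u \<in> L2 \<Omega>"
  unfolding nemytskii_G by (rule l2_class_in_L2[OF square_integrable_G[OF assms]]) (auto simp: G_def split: if_splits)

text \<open>The decisive estimate at the critical exponent. A direct use of the Sobolev bound would
  leave a factor growing with the squared size of \<open>K\<close> in front of
  \<open>norm (u1 - u2)\<close>. Replacing elements of \<open>K\<close> by bounded functions up to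
  an error \<open>\<eta>\<close> makes that factor of order \<open>c * \<eta>\<^sup>2\<close> and
  moves the size of the bounded functions into \<open>L\<close>.\<close>

lemma nemytskii_compact_Lipschitz:
  assumes K: "compact K" "K \<subseteq> H10 \<Omega>" and \<delta>: "\<delta> > 0"
  shows "\<exists>L\<ge>0. \<forall>u1\<in>K. \<forall>u2\<in>K.
    norm (nemytskii \<Omega> f u1 - nemytskii \<Omega> f u2) \<le> \<delta> * norm (u1 - u2) + L * norm (fst u1 - fst u2)"
proof -
  \<comment> \<open>The error terms will sum to
    \<open>393216 * c\<^sup>2 * \<eta> ^ 4 * n\<^sup>2\<close>, where
    \<open>393216 = 3 * 2 * 65536\<close> is below \<open>628\<^sup>2\<close>. The summand 1 keeps
    the denominator positive if \<open>c = 0\<close>.\<close>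
  define \<eta> where "\<eta> = sqrt (\<delta> / (628 * c + 1))"
  have c1: "628 * c + 1 > 0" using c by linarith
  have \<eta>: "\<eta> > 0" and \<eta>2: "\<delta> = (628 * c + 1) * \<eta>\<^sup>2" using \<delta> c1 by (simp_all add: \<eta>_def)
  obtain B where B: "B \<ge> 0"
    "\<And>u. u \<in> K \<Longrightarrow> \<exists>e\<in>H10 \<Omega>. (AE x in lebesgue. \<bar>fn (fst e) x\<bar> \<le> B) \<and> norm (u - e) \<le> \<eta>"
    using H10_compact_approx[OF K \<eta>] by blast
  \<comment> \<open>Chosen so that \<open>L\<^sup>2\<close> dominates
    \<open>3 * c\<^sup>2 * (1 + 16 * B ^ 4)\<close>, the total coefficient of the
    \<open>L\<^sup>2\<close> part.\<close>
  define L where "L = 2 * c * (1 + 4 * B\<^sup>2)"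
  have L: "L \<ge> 0" using c by (simp add: L_def)
  have "norm (nemytskii \<Omega> f u1 - nemytskii \<Omega> f u2) \<le> \<delta> * norm (u1 - u2) + L * norm (fst u1 - fst u2)"
    if u: "u1 \<in> K" "u2 \<in> K" for u1 u2
  proof -
    define w where "w = u1 - u2"
    have H: "u1 \<in> H10 \<Omega>" "u2 \<in> H10 \<Omega>" using u K by auto
    have wH: "w \<in> H10 \<Omega>" using H by (simp add: w_def subspace_diff[OF subspace_H10])
    have q: "quartic_int v w
        \<le> ennreal (8 * B ^ 4 * (norm (fst w))\<^sup>2 + 65536 * \<eta> ^ 4 * (norm w)\<^sup>2)" if v: "v \<in> K" for v
    proof -
      obtain e where "e \<in> H10 \<Omega>" "AE x in lebesgue. \<bar>fn (fst e) x\<bar> \<le> B" "norm (v - e) \<le> \<eta>"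
        using B(2)[OF v] by blast
      then show ?thesis using v K wH by (intro H10_quartic_approx) auto
    qed
    define m where "m = norm (fst w)"
    define n where "n = norm w"
    have "ennreal ((norm (nemytskii \<Omega> f u1 - nemytskii \<Omega> f u2))\<^sup>2)
        = (\<integral>\<^sup>+x. ennreal ((G x (fn (fst u1) x) - G x (fn (fst u2) x))\<^sup>2) \<partial>lebesgue)"
      unfolding nemytskii_G
      by (subst l2_class_diff, (rule square_integrable_G H)+)
         (rule norm_l2_class_nn_integral square_integrable_diff square_integrable_G H)+
    also have "\<dots> \<le> ennreal (3 * c\<^sup>2) * (ennreal (m\<^sup>2)
        + ennreal (8 * B ^ 4 * m\<^sup>2 + 65536 * \<eta> ^ 4 * n\<^sup>2) + ennreal (8 * B ^ 4 * m\<^sup>2 + 65536 * \<eta> ^ 4 * n\<^sup>2))"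
      unfolding m_def n_def
      by (rule order_trans[OF nn_integral_G_diff[OF H w_def]]) (intro mult_left_mono add_mono order_refl q u, simp)
    also have "\<dots> = ennreal (3 * c\<^sup>2 * (m\<^sup>2 + (8 * B ^ 4 * m\<^sup>2 + 65536 * \<eta> ^ 4 * n\<^sup>2) + (8 * B ^ 4 * m\<^sup>2 + 65536 * \<eta> ^ 4 * n\<^sup>2)))"
      by (simp add: ennreal_mult ennreal_plus[symmetric] del: ennreal_plus)
    finally have "(norm (nemytskii \<Omega> f u1 - nemytskii \<Omega> f u2))\<^sup>2
        \<le> 3 * c\<^sup>2 * (m\<^sup>2 + (8 * B ^ 4 * m\<^sup>2 + 65536 * \<eta> ^ 4 * n\<^sup>2) + (8 * B ^ 4 * m\<^sup>2 + 65536 * \<eta> ^ 4 * n\<^sup>2))"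
      by (subst (asm) ennreal_le_iff) auto
    also have "\<dots> = 3 * c\<^sup>2 * (1 + 16 * B ^ 4) * m\<^sup>2 + 393216 * c\<^sup>2 * \<eta> ^ 4 * n\<^sup>2"
      by (simp add: algebra_simps)
    also have "\<dots> \<le> (L * m)\<^sup>2 + (\<delta> * n)\<^sup>2"
    proof (rule add_mono)
      have "1 + 16 * B ^ 4 \<le> (1 + 4 * B\<^sup>2)\<^sup>2"
        by (simp add: power2_eq_square algebra_simps eval_nat_numeral)
      then have "3 * c\<^sup>2 * (1 + 16 * B ^ 4) \<le> 4 * c\<^sup>2 * (1 + 4 * B\<^sup>2)\<^sup>2"
        by (intro mult_mono) auto
      also have "\<dots> = L\<^sup>2" by (simp add: L_def power_mult_distrib)
      finally show "3 * c\<^sup>2 * (1 + 16 * B ^ 4) * m\<^sup>2 \<le> (L * m)\<^sup>2"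
        unfolding power_mult_distrib by (intro mult_right_mono) auto
      have "393216 * c\<^sup>2 \<le> (628 * c)\<^sup>2" by (simp add: power_mult_distrib)
      also have "\<dots> \<le> (628 * c + 1)\<^sup>2" using c by (intro power_mono) auto
      finally have "393216 * c\<^sup>2 * \<eta> ^ 4 \<le> (628 * c + 1)\<^sup>2 * \<eta> ^ 4" by (intro mult_right_mono) auto
      also have "\<dots> = \<delta>\<^sup>2" by (simp add: \<eta>2 power_mult_distrib flip: power_mult)
      finally show "393216 * c\<^sup>2 * \<eta> ^ 4 * n\<^sup>2 \<le> (\<delta> * n)\<^sup>2"
        unfolding power_mult_distrib by (intro mult_right_mono) auto
    qed
    also have "\<dots> \<le> (\<delta> * n + L * m)\<^sup>2"
      using L \<delta> by (simp add: power2_sum m_def n_def)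
    finally have "norm (nemytskii \<Omega> f u1 - nemytskii \<Omega> f u2) \<le> \<delta> * n + L * m"
      by (rule power2_le_imp_le) (use L \<delta> in \<open>simp add: m_def n_def\<close>)
    then show ?thesis by (simp add: m_def n_def w_def)
  qed
  with L show ?thesis by blast
qed

end

section \<open>Regularity of compact invariant sets\<close>

lemma norm_fst_le': "norm (fst z) \<le> norm z" and norm_snd_le': "norm (snd z) \<le> norm z"
  by (cases z; simp add: norm_fst_le norm_snd_le)+

section \<open>The Lyapunov form and the decay of the wave semigroup\<close>

context elliptic_form
begin

text \<open>The polarised modified energy. The first two terms are the natural energy, whose
  dissipation sees only \<open>v\<close>; the cross term makes the form in \<open>u\<close>
  dissipate as well, and the last term compensates the product of \<open>u\<close> and
  \<open>v\<close> that the damping creates out of the cross term.\<close>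

definition lyapunov :: "real \<Rightarrow> h1 \<times> l2 \<Rightarrow> h1 \<times> l2 \<Rightarrow> real" where
  "lyapunov \<epsilon> z z' = E (fst z) (fst z') + \<epsilon> * inner (snd z) (snd z')
     + \<epsilon> / 2 * (inner (fst (fst z)) (snd z') + inner (snd z) (fst (fst z')))
     + 1 / 2 * inner (fst (fst z)) (fst (fst z'))"

lemma lyapunov_add:
  assumes "x \<in> Z0 \<Omega>" "y \<in> Z0 \<Omega>" "z \<in> Z0 \<Omega>"
  shows "lyapunov \<epsilon> (x + y) z = lyapunov \<epsilon> x z + lyapunov \<epsilon> y z"
  using assms by (simp add: lyapunov_def Z0_def mem_Times_iff E_add inner_add_left algebra_simps)

lemma lyapunov_scaleR: "lyapunov \<epsilon> (k *\<^sub>R x) z = k * lyapunov \<epsilon> x z"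
  by (simp add: lyapunov_def E_scaleR algebra_simps)

lemma lyapunov_sym: "lyapunov \<epsilon> x y = lyapunov \<epsilon> y x"
  by (simp add: lyapunov_def E_sym[of "fst x"] inner_commute)

lemma lyapunov_bounded:
  assumes \<epsilon>: "0 < \<epsilon>" "\<epsilon> \<le> 1"
    and K: "K \<ge> 0" "\<And>u v. u \<in> H10 \<Omega> \<Longrightarrow> v \<in> H10 \<Omega> \<Longrightarrow> \<bar>E u v\<bar> \<le> K * norm u * norm v"
    and Z: "x \<in> Z0 \<Omega>" "y \<in> Z0 \<Omega>"
  shows "\<bar>lyapunov \<epsilon> x y\<bar> \<le> (K + 3) * norm x * norm y"
proof -
  define n where "n = norm x * norm y"
  have prod: "norm p * norm q \<le> n" if "norm p \<le> norm x" "norm q \<le> norm y" for p q :: l2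
    unfolding n_def by (intro mult_mono that) auto
  have le: "norm (fst (fst x)) \<le> norm x" "norm (snd x) \<le> norm x"
    "norm (fst (fst y)) \<le> norm y" "norm (snd y) \<le> norm y"
    by (rule norm_snd_le' order_trans[OF norm_fst_le' norm_fst_le'])+
  have inner_le: "\<bar>inner p q\<bar> \<le> n" if "norm p \<le> norm x" "norm q \<le> norm y" for p q :: l2
    using Cauchy_Schwarz_ineq2[of p q] prod[OF that] by linarith
  have E_le: "\<bar>E (fst x) (fst y)\<bar> \<le> K * n"
  proof -
    have "\<bar>E (fst x) (fst y)\<bar> \<le> K * (norm (fst x) * norm (fst y))"
      using K(2) Z by (simp add: Z0_def mem_Times_iff mult.assoc)
    also have "\<dots> \<le> K * n"
      unfolding n_def by (intro mult_left_mono mult_mono norm_fst_le' K) auto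
    finally show ?thesis .
  qed
  have n0: "n \<ge> 0" by (simp add: n_def)
  have s: "\<bar>k * i\<bar> \<le> n" if "\<bar>i\<bar> \<le> n" "0 \<le> k" "k \<le> 1" for k i :: real
  proof -
    have "\<bar>k * i\<bar> \<le> 1 * n" unfolding abs_mult using that by (intro mult_mono) auto
    then show ?thesis by simp
  qed
  have "\<bar>\<epsilon> * inner (snd x) (snd y)\<bar> \<le> n"
    using \<epsilon> by (intro s inner_le le) auto
  moreover have "\<bar>\<epsilon> / 2 * (inner (fst (fst x)) (snd y) + inner (snd x) (fst (fst y)))\<bar> \<le> n"
  proof -
    have "\<bar>\<epsilon> * ((inner (fst (fst x)) (snd y) + inner (snd x) (fst (fst y))) / 2)\<bar> \<le> n"
      using \<epsilon> inner_le[OF le(1,4)] inner_le[OF le(2,3)] by (intro s) (auto simp: abs_le_iff)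
    then show ?thesis by simp
  qed
  moreover have "\<bar>1 / 2 * inner (fst (fst x)) (fst (fst y))\<bar> \<le> n"
    by (intro s inner_le le) auto
  ultimately have "\<bar>lyapunov \<epsilon> x y\<bar> \<le> K * n + n + n + n"
    using E_le unfolding lyapunov_def by linarith
  then show ?thesis by (simp add: n_def algebra_simps)
qed

text \<open>Completing squares: the nonnegative square of
  \<open>\<epsilon> *\<^sub>R snd z + fst (fst z)\<close> shows, with
  \<open>\<epsilon>\<^sup>2 \<le> \<epsilon>\<close>, that the cross term uses up at most half of
  the kinetic term and the last term. The square of \<open>snd z - fst (fst z)\<close> gives the
  upper bound.\<close>

lemma lyapunov_diagonal_bounds:
  fixes z :: "h1 \<times> l2"
  assumes \<epsilon>: "0 < \<epsilon>" "\<epsilon> \<le> 1"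
  shows "E (fst z) (fst z) + \<epsilon> / 2 * (norm (snd z))\<^sup>2 \<le> lyapunov \<epsilon> z z"
    and "lyapunov \<epsilon> z z \<le> E (fst z) (fst z) + 2 * (norm (snd z))\<^sup>2 + (norm (fst (fst z)))\<^sup>2"
proof -
  define m where "m = (norm (fst (fst z)))\<^sup>2"
  define n where "n = (norm (snd z))\<^sup>2"
  define i where "i = inner (fst (fst z)) (snd z)"
  have m0: "m \<ge> 0" "n \<ge> 0" by (auto simp: m_def n_def)
  have eq: "lyapunov \<epsilon> z z = E (fst z) (fst z) + \<epsilon> * n + \<epsilon> * i + 1 / 2 * m"
    by (simp add: lyapunov_def m_def n_def i_def power2_norm_eq_inner inner_commute[of "snd z" "fst (fst z)"])
  have "0 \<le> (norm (\<epsilon> *\<^sub>R snd z + fst (fst z)))\<^sup>2" by simp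
  also have "\<dots> = \<epsilon>\<^sup>2 * n + 2 * \<epsilon> * i + m"
    unfolding m_def n_def i_def power2_norm_eq_inner
    by (simp add: inner_add inner_commute[of "snd z" "fst (fst z)"] power2_eq_square algebra_simps)
  finally have 1: "0 \<le> \<epsilon>\<^sup>2 * n + 2 * \<epsilon> * i + m" .
  have "\<epsilon>\<^sup>2 * n \<le> \<epsilon> * n" using \<epsilon> m0 by (intro mult_right_mono) (simp_all add: power2_eq_square mult_left_le)
  with 1 show "E (fst z) (fst z) + \<epsilon> / 2 * (norm (snd z))\<^sup>2 \<le> lyapunov \<epsilon> z z"
    unfolding eq n_def[symmetric] by simp
  have "0 \<le> (norm (snd z - fst (fst z)))\<^sup>2" by simp
  also have "\<dots> = n - 2 * i + m"
    by (simp add: m_def n_def i_def power2_norm_eq_inner inner_diff inner_commute[of "snd z" "fst (fst z)"])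
  finally have "2 * i \<le> n + m" by simp
  then have "\<epsilon> * (2 * i) \<le> \<epsilon> * (n + m)" using \<epsilon> by (intro mult_left_mono) auto
  moreover have "\<epsilon> * n \<le> 1 * n" "\<epsilon> * (n + m) \<le> 1 * (n + m)" 
    using mult_right_mono[of \<epsilon> 1 n] mult_right_mono[of \<epsilon> 1 "n + m"] \<epsilon> m0 by auto
  ultimately show "lyapunov \<epsilon> z z \<le> E (fst z) (fst z) + 2 * (norm (snd z))\<^sup>2 + (norm (fst (fst z)))\<^sup>2"
    unfolding eq m_def[symmetric] n_def[symmetric] using m0 by simp
qed

text \<open>The energy of \<open>u\<close> against \<open>w\<close> cancels between the first two
  parts of the form, and the products of \<open>u\<close> and \<open>v\<close> cancel because of the
  coefficient \<open>1 / 2\<close> of the last part. What remains is negative in \<open>u\<close>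
  and in \<open>v\<close>, as \<open>\<epsilon> \<le> 1\<close>.\<close>

lemma lyapunov_dissipative:
  assumes \<epsilon>: "0 < \<epsilon>" "\<epsilon> \<le> 1" and zz': "(z, z') \<in> wave_op_graph \<Omega> A \<beta> \<epsilon>"
  shows "lyapunov \<epsilon> z z' = - (1 - \<epsilon> / 2) * (norm (snd z))\<^sup>2 - 1 / 2 * E (fst z) (fst z)"
proof -
  obtain u w y where eq: "z = (u, fst w)" "z' = (w, - ((1 / \<epsilon>) *\<^sub>R (fst w + y)))"
    and uy: "(u, y) \<in> form_op_graph \<Omega> A \<beta>" and w: "w \<in> H10 \<Omega>"
    using zz' unfolding wave_op_graph_def by blast
  have y: "E u v = inner y (fst v)" if "v \<in> H10 \<Omega>" for v
    using uy that by (auto simp: form_op_graph_def)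
  have u: "u \<in> H10 \<Omega>" using uy by (auto simp: form_op_graph_def)
  show ?thesis
    using \<epsilon>
    by (simp add: lyapunov_def eq y[OF w] y[OF u] inner_add inner_diff inner_commute power2_norm_eq_inner field_simps)
qed

lemma wave_semigroup_locale:
  assumes "wave_semigroup \<Omega> A \<beta> \<epsilon> T"
  shows "hilbert_c0_semigroup (Z0 \<Omega>) T"
  by unfold_locales (use assms subspace_Z0 closed_Z0 in \<open>auto simp: wave_semigroup_def\<close>)

lemma wave_exponential_decay:
  assumes \<epsilon>: "0 < \<epsilon>" "\<epsilon> \<le> 1" and T: "wave_semigroup \<Omega> A \<beta> \<epsilon> T"
  obtains M \<omega> where "M > 0" "\<omega> > 0"
    "\<And>t x. t \<ge> 0 \<Longrightarrow> x \<in> Z0 \<Omega> \<Longrightarrow> norm (T t x) \<le> M * exp (- \<omega> * t) * norm x"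
proof -
  interpret hilbert_c0_semigroup "Z0 \<Omega>" T by (rule wave_semigroup_locale[OF T])
  have gen_eq: "gen = wave_op_graph \<Omega> A \<beta> \<epsilon>" using T by (simp add: wave_semigroup_def)
  obtain K where K: "K \<ge> 0" "\<And>u v. u \<in> H10 \<Omega> \<Longrightarrow> v \<in> H10 \<Omega> \<Longrightarrow> \<bar>E u v\<bar> \<le> K * norm u * norm v"
    using E_bounded by blast
  obtain c where c: "c > 0" "\<And>u. u \<in> H10 \<Omega> \<Longrightarrow> c * (norm u)\<^sup>2 \<le> E u u"
    using E_diagonal_bounds by metis
  define c' where "c' = min c (\<epsilon> / 2)"
  \<comment> \<open>The form is at most \<open>(1 + 1 / c) * e + 2 * n\<close>, with
    \<open>e\<close> the energy of \<open>u\<close> and \<open>n\<close> the squared norm of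
    \<open>v\<close>, while the dissipation is at least \<open>e / 2 + n / 2\<close>. The two
    entries of the minimum match the coefficients of \<open>n\<close> and of
    \<open>e\<close>.\<close>
  define \<omega> where "\<omega> = min (1 / 4) (c / (2 * (c + 1)))"
  have c': "c' > 0" and \<omega>: "\<omega> > 0" using c \<epsilon> by (auto simp: c'_def \<omega>_def)
  have \<omega>_le: "\<omega> \<le> 1 / 4" "\<omega> \<le> c / (2 * (c + 1))" by (simp_all only: \<omega>_def min.cobounded1 min.cobounded2)
  have coercive: "c' * (norm z)\<^sup>2 \<le> lyapunov \<epsilon> z z" if z: "z \<in> Z0 \<Omega>" for z
  proof -
    have "(norm z)\<^sup>2 = (norm (fst z))\<^sup>2 + (norm (snd z))\<^sup>2" by (cases z) (simp add: norm_Pair)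
    then have "c' * (norm z)\<^sup>2 = c' * (norm (fst z))\<^sup>2 + c' * (norm (snd z))\<^sup>2" by (simp add: distrib_left)
    also have "\<dots> \<le> c * (norm (fst z))\<^sup>2 + \<epsilon> / 2 * (norm (snd z))\<^sup>2"
      by (intro add_mono mult_right_mono) (auto simp: c'_def)
    also have "\<dots> \<le> E (fst z) (fst z) + \<epsilon> / 2 * (norm (snd z))\<^sup>2"
      using c(2) z by (simp add: Z0_def mem_Times_iff)
    also have "\<dots> \<le> lyapunov \<epsilon> z z" by (rule lyapunov_diagonal_bounds(1)[OF \<epsilon>])
    finally show ?thesis .
  qed
  have dissipative: "lyapunov \<epsilon> z z' \<le> - \<omega> * lyapunov \<epsilon> z z" if zz': "(z, z') \<in> gen" for z z'
  proof -
    define n where "n = (norm (snd z))\<^sup>2"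
    define e where "e = E (fst z) (fst z)"
    have z: "fst z \<in> H10 \<Omega>" using genD(1)[OF zz'] by (simp add: Z0_def mem_Times_iff)
    have n0: "n \<ge> 0" by (simp add: n_def)
    have "c * (norm (fst (fst z)))\<^sup>2 \<le> c * (norm (fst z))\<^sup>2"
      using c(1) by (intro mult_left_mono power_mono norm_fst_le') auto
    also have "\<dots> \<le> e" unfolding e_def by (rule c(2)[OF z])
    finally have m: "(norm (fst (fst z)))\<^sup>2 \<le> e / c" using c(1) by (simp add: field_simps)
    have e0: "e \<ge> 0" using c(2)[OF z] c(1) by (simp add: e_def) (meson order_trans mult_nonneg_nonneg less_imp_le zero_le_power2)
    have "lyapunov \<epsilon> z z \<le> e + 2 * n + e / c"
      using lyapunov_diagonal_bounds(2)[OF \<epsilon>, of z] m by (simp add: e_def n_def)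
    then have "\<omega> * lyapunov \<epsilon> z z \<le> \<omega> * (e + 2 * n + e / c)" using \<omega> by (intro mult_left_mono) auto
    also have "\<dots> = \<omega> * ((c + 1) / c * e) + \<omega> * (2 * n)" using c(1) by (simp add: field_simps)
    also have "\<dots> \<le> (c / (2 * (c + 1))) * ((c + 1) / c * e) + (1 / 4) * (2 * n)"
      using c(1) e0 n0 by (intro add_mono mult_right_mono \<omega>_le) auto
    also have "\<dots> = 1 / 2 * e + 1 / 2 * n"
    proof -
      have "c / (2 * k) * (k / c * e) = 1 / 2 * e" if "k > 0" for k using that c(1) by simp
      from this[of "c + 1"] show ?thesis using c(1) by simp
    qed
    also have "\<dots> \<le> 1 / 2 * e + (1 - \<epsilon> / 2) * n"
      using \<epsilon> n0 by (intro add_left_mono mult_right_mono) auto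
    also have "\<dots> = - lyapunov \<epsilon> z z'"
      using lyapunov_dissipative[OF \<epsilon>, of z z'] zz' by (simp add: gen_eq e_def n_def algebra_simps)
    finally show ?thesis by simp
  qed
  have "norm (T t x) \<le> sqrt (\<bar>K + 3\<bar> / c') * exp (- \<omega> * t) * norm x" if "t \<ge> 0" "x \<in> Z0 \<Omega>" for t x
    using lyapunov_add lyapunov_scaleR lyapunov_sym lyapunov_bounded[OF \<epsilon> K] c' coercive dissipative that(2,1)
    by (rule exponential_decay[where Q = "lyapunov \<epsilon>"])
  moreover have "sqrt (\<bar>K + 3\<bar> / c') > 0" using K c' by simp
  ultimately show ?thesis using that \<omega> by blast
qed

text \<open>The descriptions in \<open>form_op\<close> and \<open>as_h1\<close> are resolved by
  single-valuedness of the generator: two candidates would produce two images of one state. Reading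
  \<open>w\<close> and \<open>y\<close> off \<open>z'\<close> gives
  \<open>norm y \<le> 2 * norm z'\<close> and \<open>E w w \<le> K * (norm z')\<^sup>2\<close>,
  whence \<open>4 + K\<close>.\<close>

lemma wave_op_Z1:
  assumes \<epsilon>: "0 < \<epsilon>" "\<epsilon> \<le> 1" and T: "wave_semigroup \<Omega> A \<beta> \<epsilon> T"
    and K: "K \<ge> 0" "\<And>u v. u \<in> H10 \<Omega> \<Longrightarrow> v \<in> H10 \<Omega> \<Longrightarrow> \<bar>E u v\<bar> \<le> K * norm u * norm v"
    and zz': "(z, z') \<in> generator_on (Z0 \<Omega>) T"
  shows "z \<in> Z1 \<Omega> A \<beta>" and "Z1_norm \<Omega> A \<beta> z \<le> sqrt (4 + K) * norm z'"
proof -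
  interpret hilbert_c0_semigroup "Z0 \<Omega>" T by (rule wave_semigroup_locale[OF T])
  have gen_eq: "gen = wave_op_graph \<Omega> A \<beta> \<epsilon>" using T by (simp add: wave_semigroup_def)
  obtain u w y where eq: "z = (u, fst w)" "z' = (w, - ((1 / \<epsilon>) *\<^sub>R (fst w + y)))"
    and uy: "(u, y) \<in> form_op_graph \<Omega> A \<beta>" and w: "w \<in> H10 \<Omega>"
    using zz' unfolding gen_eq wave_op_graph_def by blast
  show "z \<in> Z1 \<Omega> A \<beta>" using uy w by (auto simp: Z1_def form_op_dom_def eq)
  have "form_op \<Omega> A \<beta> u = y"
    unfolding form_op_def
  proof (rule the_equality)
    show "(u, y) \<in> form_op_graph \<Omega> A \<beta>" by (rule uy)
    fix y' assume "(u, y') \<in> form_op_graph \<Omega> A \<beta>"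
    then have "((u, fst w), (w, - ((1 / \<epsilon>) *\<^sub>R (fst w + y')))) \<in> gen"
      unfolding gen_eq wave_op_graph_def using w by blast
    from gen_unique[OF this zz'[unfolded eq]] have "(1 / \<epsilon>) *\<^sub>R (fst w + y') = (1 / \<epsilon>) *\<^sub>R (fst w + y)"
      by simp
    then show "y' = y" using \<epsilon> by simp
  qed
  moreover have "as_h1 \<Omega> (fst w) = w"
    unfolding as_h1_def
  proof (rule the_equality, simp add: w)
    fix w' assume w': "w' \<in> H10 \<Omega> \<and> fst w' = fst w"
    have "E 0 v = 0" for v using E_scaleR[of 0 0 v] by simp
    \<comment> \<open>Over \<open>u = 0\<close> the generator sends \<open>(0, fst v)\<close> to a
      state with first component \<open>v\<close>. So the class of a function determines its weak
      gradient, which is what uniqueness of the lift requires.\<close>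
    then have 0: "(0, 0) \<in> form_op_graph \<Omega> A \<beta>"
      by (simp add: form_op_graph_def subspace_0[OF subspace_H10] subspace_0[OF subspace_L2])
    then have in_gen: "((0, fst v), (v, - ((1 / \<epsilon>) *\<^sub>R (fst v + 0)))) \<in> gen" if "v \<in> H10 \<Omega>" for v
      unfolding gen_eq wave_op_graph_def using that by blast
    show "w' = w"
      using gen_unique[OF in_gen[of w'], of "(w, - ((1 / \<epsilon>) *\<^sub>R (fst w + 0)))"] in_gen[OF w] w' by auto
  qed
  ultimately have Z1: "Z1_norm \<Omega> A \<beta> z = sqrt ((norm y)\<^sup>2 + E w w)"
    by (simp add: Z1_norm_def eq)
  define r where "r = norm z'"
  have wr: "norm w \<le> r" and yr: "norm ((1 / \<epsilon>) *\<^sub>R (fst w + y)) \<le> r"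
    using norm_fst_le'[of z'] norm_snd_le'[of z'] by (simp_all add: r_def eq)
  have "norm (fst w + y) = \<epsilon> * norm ((1 / \<epsilon>) *\<^sub>R (fst w + y))" using \<epsilon> by simp
  also have "\<dots> \<le> 1 * r" using yr \<epsilon> by (intro mult_mono) auto
  finally have "norm y \<le> 2 * r"
    using norm_triangle_ineq4[of "fst w + y" "fst w"] norm_fst_le'[of w] wr by simp
  then have "(norm y)\<^sup>2 \<le> (2 * r)\<^sup>2" by (intro power_mono) auto
  moreover have "E w w \<le> K * r\<^sup>2"
  proof -
    have "E w w \<le> K * (norm w)\<^sup>2" using K(2)[OF w w] by (simp add: power2_eq_square mult.assoc)
    also have "\<dots> \<le> K * r\<^sup>2" using K wr by (intro mult_left_mono power_mono) auto
    finally show ?thesis .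
  qed
  ultimately have "(norm y)\<^sup>2 + E w w \<le> (4 + K) * r\<^sup>2" by (simp add: power_mult_distrib distrib_right)
  then have "sqrt ((norm y)\<^sup>2 + E w w) \<le> sqrt ((4 + K) * r\<^sup>2)" by (rule real_sqrt_le_mono)
  also have "\<dots> = sqrt (4 + K) * norm z'" by (simp add: real_sqrt_mult r_def)
  finally show "Z1_norm \<Omega> A \<beta> z \<le> sqrt (4 + K) * norm z'" unfolding Z1 .
qed

end

section \<open>The bound in \<open>Z1\<close> for compact invariant sets\<close>

locale damped_wave = elliptic_form \<Omega> A \<beta> a0 a1 lam1 + cubic_nonlinearity \<Omega> f c
  for \<Omega> A \<beta> a0 a1 lam1 f c +
  fixes \<epsilon> :: real and T :: "real \<Rightarrow> h1 \<times> l2 \<Rightarrow> h1 \<times> l2"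
  assumes \<epsilon>: "0 < \<epsilon>" "\<epsilon> \<le> 1" and T: "wave_semigroup \<Omega> A \<beta> \<epsilon> T"
begin

lemma compact_invariant_bounded_in_Z1:
  assumes \<I>: "compact \<I>" and inv: "invariant_set \<Omega> f \<epsilon> T \<I>"
  shows "bounded_in_Z1 \<Omega> A \<beta> \<I>"
proof (cases "\<I> = {}")
  case True
  then show ?thesis by (simp add: bounded_in_Z1_def)
next
  case False
  interpret S: hilbert_c0_semigroup "Z0 \<Omega>" T by (rule wave_semigroup_locale[OF T])
  have gen_eq: "S.gen = wave_op_graph \<Omega> A \<beta> \<epsilon>" using T by (simp add: wave_semigroup_def)
  have \<I>_Z0: "\<I> \<subseteq> Z0 \<Omega>" using inv by (simp add: invariant_set_def)
  obtain M \<omega> where M: "M > 0" "\<omega> > 0"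
    and decay: "\<And>t x. t \<ge> 0 \<Longrightarrow> x \<in> Z0 \<Omega> \<Longrightarrow> norm (T t x) \<le> M * exp (- \<omega> * t) * norm x"
    using wave_exponential_decay[OF \<epsilon> T] by blast
  obtain R where R: "\<And>z. z \<in> \<I> \<Longrightarrow> norm z \<le> R"
    using compact_imp_bounded[OF \<I>] by (auto simp: bounded_iff)
  \<comment> \<open>The largest value allowed by the absorption condition
    \<open>M * \<delta> \<le> \<omega> / 2\<close>. The nonlinearity is estimated with
    \<open>\<epsilon> * \<delta>\<close> because the forcing carries the factor
    \<open>1 / \<epsilon>\<close>.\<close>
  define \<delta> where "\<delta> = \<omega> / (2 * M)"
  have \<delta>: "\<delta> > 0" "M * \<delta> \<le> \<omega> / 2" using M by (simp_all add: \<delta>_def)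
  have "compact (fst ` \<I>)" by (intro compact_continuous_image \<I> continuous_intros)
  moreover have fst_H10: "fst ` \<I> \<subseteq> H10 \<Omega>" using \<I>_Z0 by (auto simp: Z0_def)
  ultimately obtain L where L: "L \<ge> 0" and lip: "\<And>u1 u2. u1 \<in> fst ` \<I> \<Longrightarrow> u2 \<in> fst ` \<I> \<Longrightarrow>
      norm (nemytskii \<Omega> f u1 - nemytskii \<Omega> f u2) \<le> \<epsilon> * \<delta> * norm (u1 - u2) + L * norm (fst u1 - fst u2)"
    using nemytskii_compact_Lipschitz[of "fst ` \<I>" "\<epsilon> * \<delta>"] \<epsilon> \<delta> by (meson mult_pos_pos)
  \<comment> \<open>The weak seminorm in which a large constant \<open>L\<close> is harmless. The
    first component of the generator is \<open>v\<close>, so \<open>P_gen\<close> holds with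
    constant 1.\<close>
  define P :: "h1 \<times> l2 \<Rightarrow> l2" where "P z = fst (fst z)" for z
  have P: "bounded_linear P"
    unfolding P_def using bounded_linear_compose[OF bounded_linear_fst bounded_linear_fst] .
  have P_le: "norm (P z) \<le> norm z" for z
    unfolding P_def by (rule order_trans[OF norm_fst_le' norm_fst_le'])
  have P_gen: "norm (P z') \<le> 1 * norm z" if "(z, z') \<in> S.gen" for z z'
    using that norm_snd_le'[of z] unfolding gen_eq by (auto simp: wave_op_graph_def P_def)
  define F :: "h1 \<times> l2 \<Rightarrow> h1 \<times> l2" where "F z = (0, (1 / \<epsilon>) *\<^sub>R nemytskii \<Omega> f (fst z))" for z
  have F_lip: "norm (F z1 - F z2) \<le> \<delta> * norm (z1 - z2) + L / \<epsilon> * norm (P (z1 - z2))"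
    if z: "z1 \<in> \<I>" "z2 \<in> \<I>" for z1 z2
  proof -
    let ?n = "norm (nemytskii \<Omega> f (fst z1) - nemytskii \<Omega> f (fst z2))"
    have "?n \<le> \<epsilon> * \<delta> * norm (fst (z1 - z2)) + L * norm (P (z1 - z2))"
      using lip[of "fst z1" "fst z2"] z by (simp add: P_def)
    also have "\<dots> \<le> \<epsilon> * \<delta> * norm (z1 - z2) + L * norm (P (z1 - z2))"
      using \<epsilon> \<delta> by (intro add_right_mono mult_left_mono norm_fst_le') auto
    finally have "1 / \<epsilon> * ?n \<le> 1 / \<epsilon> * (\<epsilon> * \<delta> * norm (z1 - z2) + L * norm (P (z1 - z2)))"
      using \<epsilon> by (intro mult_left_mono) auto
    moreover have "norm (F z1 - F z2) = 1 / \<epsilon> * ?n"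
      using \<epsilon> by (simp add: F_def norm_Pair flip: scaleR_diff_right)
    moreover have "1 / \<epsilon> * (\<epsilon> * \<delta> * norm (z1 - z2) + L * norm (P (z1 - z2)))
        = \<delta> * norm (z1 - z2) + L / \<epsilon> * norm (P (z1 - z2))"
      using \<epsilon> by (simp add: field_simps)
    ultimately show ?thesis by simp
  qed
  obtain z0 where z0: "z0 \<in> \<I>" using False by blast
  \<comment> \<open>The forcing at one state plus its Lipschitz constant times \<open>2 * R\<close>,
    a bound for the diameter of the set.\<close>
  define R' where "R' = norm (F z0) + (\<delta> + L / \<epsilon>) * (2 * R)"
  have F_le: "norm (F z) \<le> R'" if z: "z \<in> \<I>" for z
  proof -
    have "norm (z - z0) \<le> 2 * R" using norm_triangle_ineq4[of z z0] R[OF z] R[OF z0] by linarith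
    moreover have "L / \<epsilon> * norm (P (z - z0)) \<le> L / \<epsilon> * norm (z - z0)"
      using L \<epsilon> by (intro mult_left_mono P_le) auto
    ultimately have "norm (F z - F z0) \<le> (\<delta> + L / \<epsilon>) * norm (z - z0)"
      using F_lip[OF z z0] by (simp add: distrib_right)
    also have "\<dots> \<le> (\<delta> + L / \<epsilon>) * (2 * R)"
      using \<open>norm (z - z0) \<le> 2 * R\<close> \<delta> L \<epsilon> by (intro mult_left_mono) auto
    finally show ?thesis using norm_triangle_ineq2[of "F z" "F z0"] by (simp add: R'_def)
  qed
  define B where "B = 2 * M * (L / \<epsilon>) * (1 * M * R + M * R') / \<omega> + M * R'"
  have in_gen: "\<exists>z'. (z, z') \<in> S.gen \<and> norm z' \<le> B" if z: "z \<in> \<I>" for z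
  proof -
    obtain U where U: "full_solution \<Omega> f \<epsilon> T U" "U 0 = z" "\<And>t. U t \<in> \<I>"
      using inv z by (auto simp: invariant_set_def)
    have F_Z0: "F (U t) \<in> Z0 \<Omega>" for t
    proof -
      have "nemytskii \<Omega> f (fst (U t)) \<in> L2 \<Omega>" using U(3) fst_H10 by (intro nemytskii_in_L2) blast
      then show ?thesis
        by (simp add: F_def Z0_def subspace_0[OF subspace_H10] subspace_scale[OF subspace_L2])
    qed
    \<comment> \<open>The nonlinear term is frozen along the chosen full solution through
      \<open>z\<close>. Only \<open>U\<close> depends on \<open>z\<close>; the constants belong to
      the whole set, so \<open>B\<close> is uniform.\<close>
    interpret W: exp_stable_mild_solution "Z0 \<Omega>" T M \<omega> U "\<lambda>t. F (U t)"
    proof unfold_locales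
      show "U t \<in> Z0 \<Omega>" for t using U(3) \<I>_Z0 by blast
      show "((\<lambda>p. T (t - p) (F (U p))) has_integral U t - T (t - s) (U s)) {s..t}" if "s \<le> t" for s t
        using U(1) that by (simp add: full_solution_def F_def)
    qed (use M decay F_Z0 in auto)
    have "\<exists>z'. (U 0, z') \<in> S.gen \<and> norm z' \<le> 2 * M * (L / \<epsilon>) * (1 * M * R + M * R') / \<omega> + M * R'"
      by (rule W.bounded_in_gen[OF P P_le P_gen _ R[OF U(3)] F_le[OF U(3)] F_lip[OF U(3) U(3)]])
         (use L \<epsilon> \<delta> in auto)
    then show ?thesis by (simp add: U(2) B_def)
  qed
  obtain K where K: "K \<ge> 0" "\<And>u v. u \<in> H10 \<Omega> \<Longrightarrow> v \<in> H10 \<Omega> \<Longrightarrow> \<bar>E u v\<bar> \<le> K * norm u * norm v"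
    using E_bounded by blast
  have "z \<in> Z1 \<Omega> A \<beta> \<and> Z1_norm \<Omega> A \<beta> z \<le> sqrt (4 + K) * B" if z: "z \<in> \<I>" for z
  proof -
    obtain z' where z': "(z, z') \<in> S.gen" "norm z' \<le> B" using in_gen[OF z] by blast
    have "sqrt (4 + K) * norm z' \<le> sqrt (4 + K) * B" using z'(2) K(1) by (intro mult_left_mono) auto
    then show ?thesis using wave_op_Z1[OF \<epsilon> T K z'(1)] by auto
  qed
  then show ?thesis unfolding bounded_in_Z1_def by blast
qed

end

theorem corollary2p9:
  fixes \<Omega> :: "(real^3) set"
    and A :: "real^3 \<Rightarrow> real^3^3"
    and \<beta> :: "real^3 \<Rightarrow> real"
    and f :: "real^3 \<Rightarrow> real \<Rightarrow> real"
    and a0 a1 lam1 C \<gamma> \<alpha> \<epsilon> :: real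
    and T :: "real \<Rightarrow> h1 \<times> l2 \<Rightarrow> h1 \<times> l2"
    and \<I> :: "(h1 \<times> l2) set"
  assumes "open \<Omega>"
    and "0 < a0" "0 < a1"
    and "\<And>i j. Linfty \<Omega> (\<lambda>x. A x $ i $ j)"
    and "\<And>i j. AE x in lebesgue_on \<Omega>. A x $ i $ j = A x $ j $ i"
    and "AE x in lebesgue_on \<Omega>. \<forall>\<xi>::real^3.
           a0 * (norm \<xi>)\<^sup>2 \<le> (\<Sum>i\<in>UNIV. \<Sum>j\<in>UNIV. A x $ i $ j * \<xi> $ i * \<xi> $ j) \<and>
           (\<Sum>i\<in>UNIV. \<Sum>j\<in>UNIV. A x $ i $ j * \<xi> $ i * \<xi> $ j) \<le> a1 * (norm \<xi>)\<^sup>2"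
    and "\<beta> \<in> borel_measurable (lebesgue_on \<Omega>)"
    and "\<forall>\<nu>>0. \<exists>C\<nu>>0. \<forall>u\<in>H10 \<Omega>.
           (\<integral>\<^sup>+ x. ennreal (\<bar>\<beta> x\<bar> * (fn (fst u) x)\<^sup>2) \<partial>lebesgue_on \<Omega>)
             \<le> ennreal (\<nu> * (\<integral>x. (\<Sum>i\<in>UNIV. (grad u i x)\<^sup>2) \<partial>lebesgue_on \<Omega>)
                        + C\<nu> * (\<integral>x. (fn (fst u) x)\<^sup>2 \<partial>lebesgue_on \<Omega>))"
    and "0 < lam1"
    and "\<forall>u\<in>H10 \<Omega>. energy_form \<Omega> A \<beta> u u
           \<ge> lam1 * (\<integral>x. (fn (fst u) x)\<^sup>2 \<partial>lebesgue_on \<Omega>)"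
    and "\<And>u. (\<lambda>x. f x u) \<in> borel_measurable (lebesgue_on \<Omega>)"
    and "integrable (lebesgue_on \<Omega>) (\<lambda>x. (f x 0)\<^sup>2)"
    and "AE x in lebesgue_on \<Omega>. (f x) C1_differentiable_on UNIV"
    and "Linfty \<Omega> (\<lambda>x. deriv (f x) 0)"
    and "0 < C" "0 < \<gamma>" "\<gamma> \<le> 1" "1 \<le> \<alpha>" "\<alpha> < 2" "\<alpha> + \<gamma> = 2"
    and "AE x in lebesgue_on \<Omega>. \<forall>u1 u2.
           \<bar>deriv (f x) u1 - deriv (f x) u2\<bar>
             \<le> C * (1 + \<bar>u1\<bar> powr \<alpha> + \<bar>u2\<bar> powr \<alpha>) * \<bar>u1 - u2\<bar> powr \<gamma>"
    and "0 < \<epsilon>" "\<epsilon> \<le> 1"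
    and "wave_semigroup \<Omega> A \<beta> \<epsilon> T"
    and "compact \<I>"
    and "invariant_set \<Omega> f \<epsilon> T \<I>"
  shows "bounded_in_Z1 \<Omega> A \<beta> \<I>"
proof -
  have sets_\<Omega>: "\<Omega> \<in> sets lebesgue" using \<open>open \<Omega>\<close> by (simp add: borel_open)
  obtain K where K: "AE x in lebesgue_on \<Omega>. \<bar>deriv (f x) 0\<bar> \<le> K"
    using \<open>Linfty \<Omega> (\<lambda>x. deriv (f x) 0)\<close> by (auto simp: Linfty_def)
  \<comment> \<open>The absolute value keeps the growth constant nonnegative even for empty
    \<open>\<Omega>\<close>, where an essential bound \<open>K\<close> may be negative.\<close>
  have growth: "AE x in lebesgue_on \<Omega>. \<forall>a b. \<bar>f x a - f x b\<bar> \<le> (\<bar>K\<bar> + 2 * C) * (1 + a\<^sup>2 + b\<^sup>2) * \<bar>a - b\<bar>"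
    using assms(13,21) K
  proof eventually_elim
    case (elim x)
    show ?case
    proof (intro allI)
      fix a b
      show "\<bar>f x a - f x b\<bar> \<le> (\<bar>K\<bar> + 2 * C) * (1 + a\<^sup>2 + b\<^sup>2) * \<bar>a - b\<bar>"
        by (rule growth_of_Hoelder_derivative[where \<alpha> = \<alpha> and \<gamma> = \<gamma>]) (use elim assms in auto)
    qed
  qed
  have cont: "AE x in lebesgue_on \<Omega>. continuous_on UNIV (f x)"
    using assms(13)
  proof eventually_elim
    case (elim x)
    then show ?case
      by (intro continuous_at_imp_continuous_on ballI DERIV_isCont[OF C1_differentiable_has_deriv])
  qed
  interpret damped_wave \<Omega> A \<beta> a0 a1 lam1 f "\<bar>K\<bar> + 2 * C" \<epsilon> T
    by unfold_locales (fact assms growth cont | use \<open>0 < C\<close> in simp)+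
  show ?thesis by (rule compact_invariant_bounded_in_Z1[OF \<open>compact \<I>\<close> \<open>invariant_set \<Omega> f \<epsilon> T \<I>\<close>])
qed

end
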